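(* Let $p$ be an odd prime and let $p-1\leq k\leq 2p-2$. Then $\operatorname{index}_{\mathbb{Z}/p}\Delta_{k,p}=H^{\geq p-1}(\mathrm{B}(\mathbb{Z}/p);\mathbb{F}_p)$.
   Context: The chessboard complex $\Delta_{k,p}$ has vertex set $[k]\times[p]$, simplices being vertex sets with pairwise distinct first and pairwise distinct second coordinates; $\mathbb{Z}/p$ (generated by $(12\cdots p)\in\mathfrak{S}_p$) acts by permuting the second coordinate. For a $G$-space $X$, $\operatorname{index}_G X=\ker\big(H^*(\mathrm{B}G;\mathbb{F}_p)\to H^*(\mathrm{E}G\times_G X;\mathbb{F}_p)\big)$ (Fadell–Husseini index). $H^{\geq m}$ denotes the ideal of elements of degree at least $m$ in $H^*(\mathrm{B}(\mathbb{Z}/p);\mathbb{F}_p)=\mathbb{F}_p[t]\otimes\Lambda[e]$, $\deg t=2$, $\deg e=1$. *)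

theory Defs
  imports
    "HOL-Homology.Homology"
    "HOL-Algebra.Group_Action"
    "HOL-Algebra.Sym_Groups"
    "HOL-Computational_Algebra.Primes"
begin

text \<open>Cochains are the homomorphisms from the singular chain group to the coefficient group \<open>A\<close>
  (a multiplicatively written record, as for \<^const>\<open>homology_group\<close>). The product group supplies
  the pointwise operations and restricts to functions that are extensional on the chains.\<close>

definition cochain_group ::
    "nat \<Rightarrow> 'a topology \<Rightarrow> ('c, 'd) monoid_scheme \<Rightarrow> ('a chain \<Rightarrow> 'c) monoid"
  where "cochain_group n X A =
    subgroup_generated (product_group (singular_chain_set n X) (\<lambda>_. A)) (hom (chain_group n X) A)"

definition coboundary_map :: "nat \<Rightarrow> 'a topology \<Rightarrow> ('a chain \<Rightarrow> 'c) \<Rightarrow> 'a chain \<Rightarrow> 'c"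
  where "coboundary_map n X \<phi> = (\<lambda>c\<in>singular_chain_set (Suc n) X. \<phi> (chain_boundary (Suc n) c))"

definition cocycles :: "nat \<Rightarrow> 'a topology \<Rightarrow> ('c, 'd) monoid_scheme \<Rightarrow> ('a chain \<Rightarrow> 'c) set"
  where "cocycles n X A =
    kernel (cochain_group n X A) (cochain_group (Suc n) X A) (coboundary_map n X)"

definition coboundaries :: "nat \<Rightarrow> 'a topology \<Rightarrow> ('c, 'd) monoid_scheme \<Rightarrow> ('a chain \<Rightarrow> 'c) set"
  where "coboundaries n X A =
    (case n of
      0 \<Rightarrow> {\<one>\<^bsub>cochain_group 0 X A\<^esub>}
    | Suc m \<Rightarrow> coboundary_map m X ` carrier (cochain_group m X A))"

definition cocycle_group ::
    "nat \<Rightarrow> 'a topology \<Rightarrow> ('c, 'd) monoid_scheme \<Rightarrow> ('a chain \<Rightarrow> 'c) monoid"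
  where "cocycle_group n X A = subgroup_generated (cochain_group n X A) (cocycles n X A)"

definition cohomology_group ::
    "nat \<Rightarrow> 'a topology \<Rightarrow> ('c, 'd) monoid_scheme \<Rightarrow> ('a chain \<Rightarrow> 'c) set monoid"
  where "cohomology_group n X A = cocycle_group n X A Mod coboundaries n X A"

definition cochain_pullback ::
    "nat \<Rightarrow> 'a topology \<Rightarrow> ('a \<Rightarrow> 'b) \<Rightarrow> ('b chain \<Rightarrow> 'c) \<Rightarrow> 'a chain \<Rightarrow> 'c"
  where "cochain_pullback n X f \<phi> = (\<lambda>c\<in>singular_chain_set n X. \<phi> (chain_map n f c))"

text \<open>For a cohomology class \<open>u\<close> all the cosets in the union below coincide; see
  \<open>cohom_induced_coset\<close>.\<close>

definition cohom_induced ::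
    "nat \<Rightarrow> 'a topology \<Rightarrow> ('c, 'd) monoid_scheme \<Rightarrow> ('a \<Rightarrow> 'b) \<Rightarrow>
      ('b chain \<Rightarrow> 'c) set \<Rightarrow> ('a chain \<Rightarrow> 'c) set"
  where "cohom_induced n X A f u =
    (\<Union>\<phi>\<in>u. coboundaries n X A #>\<^bsub>cocycle_group n X A\<^esub> cochain_pullback n X f \<phi>)"

definition total_cohomology ::
    "'a topology \<Rightarrow> ('c, 'd) monoid_scheme \<Rightarrow> (nat \<Rightarrow> ('a chain \<Rightarrow> 'c) set) monoid"
  where "total_cohomology X A = sum_group UNIV (\<lambda>n. cohomology_group n X A)"

definition total_cohom_induced ::
    "'a topology \<Rightarrow> ('c, 'd) monoid_scheme \<Rightarrow> ('a \<Rightarrow> 'b) \<Rightarrow>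
      (nat \<Rightarrow> ('b chain \<Rightarrow> 'c) set) \<Rightarrow> nat \<Rightarrow> ('a chain \<Rightarrow> 'c) set"
  where "total_cohom_induced X A f u = (\<lambda>n. cohom_induced n X A f (u n))"

definition cohomology_ge ::
    "nat \<Rightarrow> 'a topology \<Rightarrow> ('c, 'd) monoid_scheme \<Rightarrow> (nat \<Rightarrow> ('a chain \<Rightarrow> 'c) set) set"
  where "cohomology_ge m X A =
    {u \<in> carrier (total_cohomology X A). \<forall>n<m. u n = \<one>\<^bsub>cohomology_group n X A\<^esub>}"

lemma carrier_cochain_group:
  assumes "comm_group A"
  shows "carrier (cochain_group n X A) =
    {\<phi> \<in> hom (chain_group n X) A. \<phi> \<in> extensional (singular_chain_set n X)}" (is "_ = ?H")
proof -
  interpret A: comm_group A by fact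
  interpret P: group "product_group (singular_chain_set n X) (\<lambda>_. A)"
    by simp
  interpret C: group "chain_group n X" by simp
  have eq: "carrier (product_group (singular_chain_set n X) (\<lambda>_. A)) \<inter> hom (chain_group n X) A = ?H"
    by (auto simp: hom_def PiE_def Pi_def)
  have sub: "subgroup ?H (product_group (singular_chain_set n X) (\<lambda>_. A))"
  proof (rule P.subgroupI)
    show "?H \<subseteq> carrier (product_group (singular_chain_set n X) (\<lambda>_. A))"
      using eq by blast
    have "(\<lambda>c\<in>singular_chain_set n X. \<one>\<^bsub>A\<^esub>) \<in> ?H"
      by (auto simp: hom_def singular_chain_add)
    then show "?H \<noteq> {}" by blast
  next
    fix a assume a: "a \<in> ?H"
    then have "a \<in> (\<Pi>\<^sub>E c\<in>singular_chain_set n X. carrier A)" using eq by auto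
    then have i: "inv\<^bsub>product_group (singular_chain_set n X) (\<lambda>_. A)\<^esub> a = (\<lambda>c\<in>singular_chain_set n X. inv\<^bsub>A\<^esub> a c)"
      by (rule inv_product_group) simp
    show "inv\<^bsub>product_group (singular_chain_set n X) (\<lambda>_. A)\<^esub> a \<in> ?H"
      unfolding i using a by (auto simp: hom_def singular_chain_add Pi_def A.inv_mult)
  next
    fix a b assume "a \<in> ?H" "b \<in> ?H"
    then show "a \<otimes>\<^bsub>product_group (singular_chain_set n X) (\<lambda>_. A)\<^esub> b \<in> ?H"
      by (auto simp: hom_def singular_chain_add Pi_def A.m_ac)
  qed
  show ?thesis
    using eq P.generate_subgroup_incl[OF order_refl sub] 
    by (simp add: cochain_group_def carrier_subgroup_generated) (blast intro: generate.incl)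
qed

lemma mult_cochain_group:
  "\<phi> \<otimes>\<^bsub>cochain_group n X A\<^esub> \<psi> = (\<lambda>c\<in>singular_chain_set n X. \<phi> c \<otimes>\<^bsub>A\<^esub> \<psi> c)"
  by (simp add: cochain_group_def subgroup_generated_def product_group_def)

lemma one_cochain_group:
  "\<one>\<^bsub>cochain_group n X A\<^esub> = (\<lambda>c\<in>singular_chain_set n X. \<one>\<^bsub>A\<^esub>)"
  by (simp add: cochain_group_def subgroup_generated_def product_group_def)

lemma comm_group_cochain_group:
  assumes "comm_group A" shows "comm_group (cochain_group n X A)"
proof -
  interpret A: comm_group A by fact
  have "group (product_group (singular_chain_set n X) (\<lambda>_. A))" by simp
  then have g: "group (cochain_group n X A)"
    unfolding cochain_group_def by (rule group.group_subgroup_generated)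
  show ?thesis
  proof (rule group.group_comm_groupI[OF g])
    fix x y assume "x \<in> carrier (cochain_group n X A)" "y \<in> carrier (cochain_group n X A)"
    then show "x \<otimes>\<^bsub>cochain_group n X A\<^esub> y = y \<otimes>\<^bsub>cochain_group n X A\<^esub> x"
      by (auto simp: carrier_cochain_group[OF assms] mult_cochain_group hom_def Pi_def A.m_comm intro!: restrict_ext)
  qed
qed

lemma coboundary_map_hom:
  assumes "comm_group A"
  shows "coboundary_map n X \<in> hom (cochain_group n X A) (cochain_group (Suc n) X A)"
proof -
  interpret A: comm_group A by fact
  show ?thesis
  proof (rule homI)
    fix x assume "x \<in> carrier (cochain_group n X A)"
    then show "coboundary_map n X x \<in> carrier (cochain_group (Suc n) X A)"
      by (auto simp: carrier_cochain_group[OF assms] coboundary_map_def hom_def Pi_def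
            singular_chain_add singular_chain_boundary_alt chain_boundary_add)
  next
    fix x y
    show "coboundary_map n X (x \<otimes>\<^bsub>cochain_group n X A\<^esub> y) =
       coboundary_map n X x \<otimes>\<^bsub>cochain_group (Suc n) X A\<^esub> coboundary_map n X y"
      by (auto simp: mult_cochain_group coboundary_map_def singular_chain_boundary_alt intro!: restrict_ext)
  qed
qed

lemma cochain_pullback_hom:
  assumes "comm_group A" and f: "continuous_map X Y f"
  shows "cochain_pullback n X f \<in> hom (cochain_group n Y A) (cochain_group n X A)"
proof -
  interpret A: comm_group A by fact
  show ?thesis
  proof (rule homI)
    fix x assume "x \<in> carrier (cochain_group n Y A)"
    then show "cochain_pullback n X f x \<in> carrier (cochain_group n X A)"
      by (auto simp: carrier_cochain_group[OF assms(1)] cochain_pullback_def hom_def Pi_def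
            singular_chain_add singular_chain_chain_map[OF _ f] chain_map_add)
  next
    fix x y
    show "cochain_pullback n X f (x \<otimes>\<^bsub>cochain_group n Y A\<^esub> y) =
       cochain_pullback n X f x \<otimes>\<^bsub>cochain_group n X A\<^esub> cochain_pullback n X f y"
      by (auto simp: mult_cochain_group cochain_pullback_def singular_chain_chain_map[OF _ f] intro!: restrict_ext)
  qed
qed

lemma coboundary_map_pullback:
  assumes f: "continuous_map X Y f"
  shows "coboundary_map n X (cochain_pullback n X f \<phi>) =
         cochain_pullback (Suc n) X f (coboundary_map n Y \<phi>)"
  by (auto simp: coboundary_map_def cochain_pullback_def singular_chain_boundary_alt
        singular_chain_chain_map[OF _ f] chain_boundary_chain_map intro!: restrict_ext)

lemma cochain_pullback_one:
  assumes f: "continuous_map X Y f"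
  shows "cochain_pullback n X f \<one>\<^bsub>cochain_group n Y A\<^esub> = \<one>\<^bsub>cochain_group n X A\<^esub>"
  by (auto simp: one_cochain_group cochain_pullback_def singular_chain_chain_map[OF _ f] intro!: restrict_ext)

lemma cochain_pullback_cocycles:
  assumes "comm_group A" and f: "continuous_map X Y f" and "\<phi> \<in> cocycles n Y A"
  shows "cochain_pullback n X f \<phi> \<in> cocycles n X A"
  using assms(3) hom_in_carrier[OF cochain_pullback_hom[OF assms(1,2)]]
  by (auto simp: cocycles_def kernel_def coboundary_map_pullback[OF f] cochain_pullback_one[OF f])

lemma cochain_pullback_coboundaries:
  assumes "comm_group A" and f: "continuous_map X Y f" and "\<phi> \<in> coboundaries n Y A"
  shows "cochain_pullback n X f \<phi> \<in> coboundaries n X A"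
proof (cases n)
  case 0
  then show ?thesis using assms cochain_pullback_one[OF f, of 0 A] by (auto simp: coboundaries_def)
next
  case (Suc m)
  then show ?thesis 
    using assms hom_in_carrier[OF cochain_pullback_hom[OF assms(1,2)]]
    by (auto simp: coboundaries_def coboundary_map_pullback[OF f, symmetric])
qed

lemma subgroup_cocycles:
  assumes "comm_group A"
  shows "subgroup (cocycles n X A) (cochain_group n X A)"
proof -
  have "group_hom (cochain_group n X A) (cochain_group (Suc n) X A) (coboundary_map n X)"
    using assms by (simp add: group_hom_def group_hom_axioms_def coboundary_map_hom
      comm_group.axioms comm_group_cochain_group)
  then show ?thesis unfolding cocycles_def by (rule group_hom.subgroup_kernel)
qed

lemma carrier_cocycle_group:
  assumes "comm_group A"
  shows "carrier (cocycle_group n X A) = cocycles n X A"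
  using subgroup_cocycles[OF assms] unfolding cocycle_group_def
  by (rule subgroup.carrier_subgroup_generated_subgroup)

lemma mult_cocycle_group [simp]: "monoid.mult (cocycle_group n X A) = monoid.mult (cochain_group n X A)"
  and one_cocycle_group [simp]: "monoid.one (cocycle_group n X A) = monoid.one (cochain_group n X A)"
  by (simp_all add: cocycle_group_def)

lemma comm_group_cocycle_group:
  assumes "comm_group A" shows "comm_group (cocycle_group n X A)"
  unfolding cocycle_group_def
  by (simp add: assms comm_group.axioms group.abelian_subgroup_generated comm_group_cochain_group)

lemma coboundaries_subset:
  assumes "comm_group A"
  shows "coboundaries n X A \<subseteq> cocycles n X A"
proof (cases n)
  case 0
  then show ?thesis
    using subgroup.one_closed[OF subgroup_cocycles[OF assms]] by (auto simp: coboundaries_def)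
next
  case (Suc m)
  have "coboundary_map (Suc m) X (coboundary_map m X \<phi>) = \<one>\<^bsub>cochain_group (Suc (Suc m)) X A\<^esub>"
    if "\<phi> \<in> carrier (cochain_group m X A)" for \<phi>
  proof -
    have "group_hom (chain_group m X) A \<phi>"
      using that assms by (simp add: carrier_cochain_group group_hom_def group_hom_axioms_def comm_group.axioms)
    then have "\<phi> 0 = \<one>\<^bsub>A\<^esub>" using group_hom.hom_one by fastforce
    then show ?thesis
      by (auto simp: coboundary_map_def one_cochain_group singular_chain_boundary_alt
           chain_boundary_boundary_alt intro!: restrict_ext)
  qed
  then show ?thesis
    using Suc hom_in_carrier[OF coboundary_map_hom[OF assms]]
    by (auto simp: coboundaries_def cocycles_def kernel_def)
qed

lemma subgroup_coboundaries:
  assumes "comm_group A"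
  shows "subgroup (coboundaries n X A) (cocycle_group n X A)"
proof -
  interpret C: group "cochain_group n X A"
    using assms by (simp add: comm_group.axioms comm_group_cochain_group)
  have "subgroup (coboundaries n X A) (cochain_group n X A)"
  proof (cases n)
    case 0
    then show ?thesis using C.triv_subgroup by (simp add: coboundaries_def)
  next
    case (Suc m)
    have "group_hom (cochain_group m X A) (cochain_group n X A) (coboundary_map m X)"
      using assms by (simp add: group_hom_def group_hom_axioms_def coboundary_map_hom
        comm_group.axioms comm_group_cochain_group Suc)
    then show ?thesis
      using group_hom.img_is_subgroup by (fastforce simp add: coboundaries_def Suc)
  qed
  then show ?thesis
    by (metis C.subgroup_of_subgroup_generated assms coboundaries_subset cocycle_group_def)
qed

lemma normal_coboundaries:
  assumes "comm_group A"
  shows "coboundaries n X A \<lhd> cocycle_group n X A"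
  by (simp add: assms comm_group.subgroup_imp_normal comm_group_cocycle_group subgroup_coboundaries)

lemma comm_group_cohomology_group:
  assumes "comm_group A" shows "comm_group (cohomology_group n X A)"
  unfolding cohomology_group_def
  by (simp add: assms comm_group.abelian_FactGroup comm_group_cocycle_group subgroup_coboundaries)

lemma cohom_induced_coset:
  assumes A: "comm_group A" and f: "continuous_map X Y f" and \<phi>: "\<phi> \<in> cocycles n Y A"
  shows "cohom_induced n X A f (coboundaries n Y A #>\<^bsub>cocycle_group n Y A\<^esub> \<phi>) =
         coboundaries n X A #>\<^bsub>cocycle_group n X A\<^esub> cochain_pullback n X f \<phi>"
proof -
  interpret ZX: group "cocycle_group n X A"
    using A by (simp add: comm_group.axioms comm_group_cocycle_group)
  interpret ZY: group "cocycle_group n Y A"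
    using A by (simp add: comm_group.axioms comm_group_cocycle_group)
  let ?f = "cochain_pullback n X f"
  have cosets: "coboundaries n X A #>\<^bsub>cocycle_group n X A\<^esub> ?f \<psi> =
       coboundaries n X A #>\<^bsub>cocycle_group n X A\<^esub> ?f \<phi>"
    if \<psi>: "\<psi> \<in> coboundaries n Y A #>\<^bsub>cocycle_group n Y A\<^esub> \<phi>" for \<psi>
  proof -
    obtain \<beta> where \<beta>: "\<beta> \<in> coboundaries n Y A" "\<psi> = \<beta> \<otimes>\<^bsub>cochain_group n Y A\<^esub> \<phi>"
      using \<psi> by (auto simp: r_coset_def)
    have "?f \<psi> = ?f \<beta> \<otimes>\<^bsub>cochain_group n X A\<^esub> ?f \<phi>"
      unfolding \<beta>(2)
      by (rule hom_mult[OF cochain_pullback_hom[OF A f]])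
        (use \<beta>(1) \<phi> coboundaries_subset[OF A, of n Y] in \<open>auto simp: cocycles_def kernel_def\<close>)
    moreover have "?f \<beta> \<in> coboundaries n X A"
      by (rule cochain_pullback_coboundaries[OF A f \<beta>(1)])
    ultimately have "?f \<psi> \<in> coboundaries n X A #>\<^bsub>cocycle_group n X A\<^esub> ?f \<phi>"
      by (auto simp: r_coset_def)
    then show ?thesis
      using ZX.repr_independence[OF _ _ subgroup_coboundaries[OF A]] 
        cochain_pullback_cocycles[OF A f \<phi>] by (metis A carrier_cocycle_group)
  qed
  have "\<phi> \<in> coboundaries n Y A #>\<^bsub>cocycle_group n Y A\<^esub> \<phi>"
    by (simp add: A carrier_cocycle_group \<phi> ZY.rcos_self subgroup_coboundaries)
  with cosets show ?thesis unfolding cohom_induced_def by blast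
qed

lemma cohom_induced_hom:
  assumes A: "comm_group A" and f: "continuous_map X Y f"
  shows "cohom_induced n X A f \<in> hom (cohomology_group n Y A) (cohomology_group n X A)"
proof -
  interpret NX: normal "coboundaries n X A" "cocycle_group n X A" by (rule normal_coboundaries[OF A])
  interpret NY: normal "coboundaries n Y A" "cocycle_group n Y A" by (rule normal_coboundaries[OF A])
  have cls: "\<exists>\<phi>\<in>cocycles n Y A. u = coboundaries n Y A #>\<^bsub>cocycle_group n Y A\<^esub> \<phi>"
    if "u \<in> carrier (cohomology_group n Y A)" for u
    using that by (auto simp: cohomology_group_def FactGroup_def RCOSETS_def carrier_cocycle_group[OF A])
  show ?thesis
  proof (rule homI)
    fix u assume "u \<in> carrier (cohomology_group n Y A)"
    then show "cohom_induced n X A f u \<in> carrier (cohomology_group n X A)"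
      using cls cochain_pullback_cocycles[OF A f]
      by (fastforce simp: cohom_induced_coset[OF A f] cohomology_group_def FactGroup_def RCOSETS_def carrier_cocycle_group[OF A])
  next
    fix u v assume "u \<in> carrier (cohomology_group n Y A)" "v \<in> carrier (cohomology_group n Y A)"
    then obtain \<phi> \<psi> where *: "\<phi> \<in> cocycles n Y A" "u = coboundaries n Y A #>\<^bsub>cocycle_group n Y A\<^esub> \<phi>"
      "\<psi> \<in> cocycles n Y A" "v = coboundaries n Y A #>\<^bsub>cocycle_group n Y A\<^esub> \<psi>"
      using cls by meson
    have m: "\<phi> \<otimes>\<^bsub>cochain_group n Y A\<^esub> \<psi> \<in> cocycles n Y A"
      using *(1,3) subgroup.m_closed[OF subgroup_cocycles[OF A]] by blast
    have h: "cochain_pullback n X f (\<phi> \<otimes>\<^bsub>cochain_group n Y A\<^esub> \<psi>) =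
       cochain_pullback n X f \<phi> \<otimes>\<^bsub>cochain_group n X A\<^esub> cochain_pullback n X f \<psi>"
      using hom_mult[OF cochain_pullback_hom[OF A f]] *(1,3) by (auto simp: cocycles_def kernel_def)
    show "cohom_induced n X A f (u \<otimes>\<^bsub>cohomology_group n Y A\<^esub> v) =
       cohom_induced n X A f u \<otimes>\<^bsub>cohomology_group n X A\<^esub> cohom_induced n X A f v"
      using * m h NY.rcos_sum[of \<phi> \<psi>] NX.rcos_sum[of "cochain_pullback n X f \<phi>" "cochain_pullback n X f \<psi>"]
        cochain_pullback_cocycles[OF A f]
      by (simp add: cohomology_group_def carrier_cocycle_group[OF A] cohom_induced_coset[OF A f])
  qed
qed

lemma total_cohom_induced_hom:
  assumes A: "comm_group A" and f: "continuous_map X Y f"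
  shows "total_cohom_induced X A f \<in> hom (total_cohomology Y A) (total_cohomology X A)"
proof -
  have g: "group (cohomology_group n Z A)" for n and Z :: "'z topology"
    using A by (simp add: comm_group.axioms comm_group_cohomology_group)
  have h: "group_hom (cohomology_group n Y A) (cohomology_group n X A) (cohom_induced n X A f)" for n
    by (simp add: group_hom_def group_hom_axioms_def g cohom_induced_hom[OF A f])
  have 1: "finite {n. cohom_induced n X A f (u n) \<noteq> \<one>\<^bsub>cohomology_group n X A\<^esub>}"
    if "finite {n. u n \<noteq> \<one>\<^bsub>cohomology_group n Y A\<^esub>}" for u
    by (rule finite_subset[OF _ that]) (use group_hom.hom_one[OF h] in force)
  show ?thesis
    unfolding total_cohomology_def
    by (rule homI)
      (auto simp: carrier_sum_group g total_cohom_induced_def 1 PiE_iff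
        hom_in_carrier[OF cohom_induced_hom[OF A f]] hom_mult[OF cohom_induced_hom[OF A f]])
qed

text \<open>A simplicial complex is given by its set of (finite) simplices. Points of the realization
  are written in barycentric coordinates, and the topology is the weak topology with respect to
  the closed simplices. The empty simplex may be included; it contributes no points.\<close>

definition geometric_simplex :: "'v set \<Rightarrow> ('v \<Rightarrow> real) set"
  where "geometric_simplex \<sigma> =
    {x. (\<forall>v. 0 \<le> x v) \<and> (\<forall>v. v \<notin> \<sigma> \<longrightarrow> x v = 0) \<and> (\<Sum>v\<in>\<sigma>. x v) = 1}"

definition geometric_realization :: "'v set set \<Rightarrow> ('v \<Rightarrow> real) topology"
  where "geometric_realization K = topology (\<lambda>U. U \<subseteq> (\<Union>\<sigma>\<in>K. geometric_simplex \<sigma>) \<and>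
    (\<forall>\<sigma>\<in>K. openin (subtopology (powertop_real UNIV) (geometric_simplex \<sigma>))
              (U \<inter> geometric_simplex \<sigma>)))"

text \<open>The affine extension of a simplicial map given on vertices.\<close>

definition realization_map :: "'v set set \<Rightarrow> ('v \<Rightarrow> 'w) \<Rightarrow> ('v \<Rightarrow> real) \<Rightarrow> 'w \<Rightarrow> real"
  where "realization_map K f =
    (\<lambda>x\<in>topspace (geometric_realization K). \<lambda>w. \<Sum>v | x v \<noteq> 0 \<and> f v = w. x v)"

lemma istopology_geometric_realization:
  "istopology (\<lambda>U. U \<subseteq> (\<Union>\<sigma>\<in>K. geometric_simplex \<sigma>) \<and>
    (\<forall>\<sigma>\<in>K. openin (subtopology (powertop_real UNIV) (geometric_simplex \<sigma>))
              (U \<inter> geometric_simplex \<sigma>)))" (is "istopology ?P")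
  unfolding istopology_def
proof (intro conjI allI impI ballI)
  fix S T assume *: "?P S" "?P T"
  show "S \<inter> T \<subseteq> (\<Union>\<sigma>\<in>K. geometric_simplex \<sigma>)" using * by blast
  show "openin (subtopology (powertop_real UNIV) (geometric_simplex \<sigma>)) (S \<inter> T \<inter> geometric_simplex \<sigma>)"
    if \<sigma>: "\<sigma> \<in> K" for \<sigma>
  proof -
    have eq: "S \<inter> T \<inter> geometric_simplex \<sigma> = (S \<inter> geometric_simplex \<sigma>) \<inter> (T \<inter> geometric_simplex \<sigma>)"
      by blast
    show ?thesis
      unfolding eq by (rule openin_Int) (use * \<sigma> in blast)+
  qed
next
  fix \<U> assume *: "\<forall>U\<in>\<U>. ?P U"
  show "\<Union>\<U> \<subseteq> (\<Union>\<sigma>\<in>K. geometric_simplex \<sigma>)" using * by blast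
  show "openin (subtopology (powertop_real UNIV) (geometric_simplex \<sigma>)) (\<Union>\<U> \<inter> geometric_simplex \<sigma>)"
    if \<sigma>: "\<sigma> \<in> K" for \<sigma>
  proof -
    have eq: "\<Union>\<U> \<inter> geometric_simplex \<sigma> = \<Union>((\<lambda>U. U \<inter> geometric_simplex \<sigma>) ` \<U>)"
      by blast
    show ?thesis
      unfolding eq by (rule openin_Union) (use * \<sigma> in blast)
  qed
qed

lemma openin_geometric_realization:
  "openin (geometric_realization K) U \<longleftrightarrow> U \<subseteq> (\<Union>\<sigma>\<in>K. geometric_simplex \<sigma>) \<and>
    (\<forall>\<sigma>\<in>K. openin (subtopology (powertop_real UNIV) (geometric_simplex \<sigma>))
              (U \<inter> geometric_simplex \<sigma>))"
  unfolding geometric_realization_def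
  by (simp only: topology_inverse'[OF istopology_geometric_realization])

lemma topspace_geometric_realization:
  "topspace (geometric_realization K) = (\<Union>\<sigma>\<in>K. geometric_simplex \<sigma>)" (is "_ = ?S")
proof
  have "openin (subtopology (powertop_real UNIV) (geometric_simplex \<sigma>)) (?S \<inter> geometric_simplex \<sigma>)"
    if "\<sigma> \<in> K" for \<sigma>
  proof -
    have "?S \<inter> geometric_simplex \<sigma> = topspace (subtopology (powertop_real UNIV) (geometric_simplex \<sigma>))"
      using that by (auto simp: topspace_subtopology)
    then show ?thesis by (simp only: openin_topspace)
  qed
  then have "openin (geometric_realization K) ?S"
    unfolding openin_geometric_realization by blast
  then show "?S \<subseteq> topspace (geometric_realization K)"
    by (rule openin_subset)
  show "topspace (geometric_realization K) \<subseteq> ?S"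
    using openin_topspace[of "geometric_realization K"] unfolding openin_geometric_realization by (rule conjunct1)
qed

lemma realization_map_on_simplex:
  assumes "\<sigma> \<in> K" "finite \<sigma>" "x \<in> geometric_simplex \<sigma>"
  shows "realization_map K f x = (\<lambda>w. \<Sum>v | v \<in> \<sigma> \<and> f v = w. x v)"
proof -
  have "(\<Sum>v | x v \<noteq> 0 \<and> f v = w. x v) = (\<Sum>v | v \<in> \<sigma> \<and> f v = w. x v)" for w
    using assms by (intro sum.mono_neutral_left) (auto simp: geometric_simplex_def)
  then show ?thesis
    using assms by (auto simp: realization_map_def topspace_geometric_realization)
qed

lemma realization_map_in_simplex:
  assumes "\<sigma> \<in> K" "finite \<sigma>" "x \<in> geometric_simplex \<sigma>"
  shows "realization_map K f x \<in> geometric_simplex (f ` \<sigma>)"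
proof -
  have "(\<Sum>w\<in>f ` \<sigma>. \<Sum>v | v \<in> \<sigma> \<and> f v = w. x v) = (\<Sum>v\<in>\<sigma>. x v)"
    using assms(2) by (intro sum.group) auto
  moreover have "(\<Sum>v | v \<in> \<sigma> \<and> f v = w. x v) = 0" if "w \<notin> f ` \<sigma>" for w
    using that by (intro sum.neutral) auto
  ultimately show ?thesis
    using assms by (auto simp: realization_map_on_simplex geometric_simplex_def intro!: sum_nonneg)
qed

lemma realization_map_compose:
  assumes "\<sigma> \<in> K" "finite \<sigma>" "x \<in> geometric_simplex \<sigma>" "f ` \<sigma> \<in> L"
    and "\<And>v. v \<in> \<sigma> \<Longrightarrow> h v = g (f v)"
  shows "realization_map L g (realization_map K f x) = realization_map K h x"
proof
  fix u
  have "realization_map L g (realization_map K f x) u =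
        (\<Sum>w | w \<in> f ` \<sigma> \<and> g w = u. \<Sum>v | v \<in> \<sigma> \<and> f v = w. x v)"
    using realization_map_on_simplex[OF assms(4) _ realization_map_in_simplex[OF assms(1-3)], of g] assms(2)
    by (simp add: realization_map_on_simplex[OF assms(1-3)])
  also have "\<dots> = (\<Sum>w | w \<in> f ` \<sigma> \<and> g w = u. \<Sum>v | v \<in> {v \<in> \<sigma>. h v = u} \<and> f v = w. x v)"
    using assms(5) by (intro sum.cong refl) auto
  also have "\<dots> = (\<Sum>v | v \<in> \<sigma> \<and> h v = u. x v)"
    using assms(2,5) by (intro sum.group) auto
  also have "\<dots> = realization_map K h x u"
    using assms by (simp add: realization_map_on_simplex)
  finally show "realization_map L g (realization_map K f x) u = realization_map K h x u" .
qed

lemma group_actionI: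
  fixes G (structure)
  assumes G: "group G"
    and ext: "\<And>g. g \<in> carrier G \<Longrightarrow> \<alpha> g \<in> extensional E"
    and closed: "\<And>g x. \<lbrakk>g \<in> carrier G; x \<in> E\<rbrakk> \<Longrightarrow> \<alpha> g x \<in> E"
    and one: "\<And>x. x \<in> E \<Longrightarrow> \<alpha> \<one>\<^bsub>G\<^esub> x = x"
    and mult: "\<And>g h x. \<lbrakk>g \<in> carrier G; h \<in> carrier G; x \<in> E\<rbrakk> \<Longrightarrow> \<alpha> (g \<otimes>\<^bsub>G\<^esub> h) x = \<alpha> g (\<alpha> h x)"
  shows "group_action G E \<alpha>"
proof -
  interpret group G by fact
  have Bij: "\<alpha> g \<in> Bij E" if g: "g \<in> carrier G" for g
  proof -
    have "bij_betw (\<alpha> g) E E"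
      by (rule bij_betwI[where g = "\<alpha> (inv g)"])
        (use g closed one mult[of g "inv g"] mult[of "inv g" g] in auto)
    then show ?thesis using ext g by (simp add: Bij_def)
  qed
  have "\<alpha> \<in> hom G (BijGroup E)"
  proof (rule homI)
    fix g h assume gh: "g \<in> carrier G" "h \<in> carrier G"
    have "\<alpha> (g \<otimes> h) = compose E (\<alpha> g) (\<alpha> h)"
      using gh mult ext by (intro extensionalityI[of _ E]) (auto simp: compose_def)
    then show "\<alpha> (g \<otimes> h) = \<alpha> g \<otimes>\<^bsub>BijGroup E\<^esub> \<alpha> h"
      using gh Bij by (simp add: BijGroup_def)
  qed (simp add: BijGroup_def Bij)
  then show ?thesis
    by (simp add: group_action_def group_hom_def group_hom_axioms_def G group_BijGroup)
qed

lemma group_action_realization: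
  assumes G: "group G" and fin: "\<And>\<sigma>. \<sigma> \<in> K \<Longrightarrow> finite \<sigma>"
    and closed: "\<And>g \<sigma>. \<lbrakk>g \<in> carrier G; \<sigma> \<in> K\<rbrakk> \<Longrightarrow> a g ` \<sigma> \<in> K"
    and one: "\<And>v. v \<in> \<Union>K \<Longrightarrow> a \<one>\<^bsub>G\<^esub> v = v"
    and mult: "\<And>g h v. \<lbrakk>g \<in> carrier G; h \<in> carrier G; v \<in> \<Union>K\<rbrakk> \<Longrightarrow> a (g \<otimes>\<^bsub>G\<^esub> h) v = a g (a h v)"
  shows "group_action G (topspace (geometric_realization K)) (\<lambda>g. realization_map K (a g))"
proof (rule group_actionI[OF G])
  fix x assume "x \<in> topspace (geometric_realization K)"
  then obtain \<sigma> where \<sigma>: "\<sigma> \<in> K" "x \<in> geometric_simplex \<sigma>"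
    by (auto simp: topspace_geometric_realization)
  show "realization_map K (a g) x \<in> topspace (geometric_realization K)" if "g \<in> carrier G" for g
    using realization_map_in_simplex[OF \<sigma>(1) fin[OF \<sigma>(1)] \<sigma>(2)] closed[OF that \<sigma>(1)]
    by (auto simp: topspace_geometric_realization)
  show "realization_map K (a \<one>\<^bsub>G\<^esub>) x = x"
  proof
    fix w
    have "a \<one>\<^bsub>G\<^esub> v = v" if "v \<in> \<sigma>" for v
      using one \<sigma>(1) that by blast
    then have "{v \<in> \<sigma>. a \<one>\<^bsub>G\<^esub> v = w} = (if w \<in> \<sigma> then {w} else {})"
      by auto
    then show "realization_map K (a \<one>\<^bsub>G\<^esub>) x w = x w"
      using \<sigma> by (auto simp: realization_map_on_simplex[OF \<sigma>(1) fin[OF \<sigma>(1)] \<sigma>(2)] geometric_simplex_def)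
  qed
  show "realization_map K (a (g \<otimes>\<^bsub>G\<^esub> h)) x = realization_map K (a g) (realization_map K (a h) x)"
    if "g \<in> carrier G" "h \<in> carrier G" for g h
    by (rule realization_map_compose[symmetric, where \<sigma> = \<sigma>])
      (use \<sigma> that fin closed mult in blast)+
qed (simp add: realization_map_def)

definition orbit_space ::
    "('g, 'h) monoid_scheme \<Rightarrow> 'x topology \<Rightarrow> ('g \<Rightarrow> 'x \<Rightarrow> 'x) \<Rightarrow> 'x set topology"
  where "orbit_space G X \<alpha> =
    topology (\<lambda>\<U>. \<U> \<subseteq> orbits G (topspace X) \<alpha> \<and> openin X (\<Union>\<U>))"

lemma openin_orbit_space:
  assumes "group_action G (topspace X) \<alpha>"
  shows "openin (orbit_space G X \<alpha>) \<U> \<longleftrightarrow>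
         \<U> \<subseteq> orbits G (topspace X) \<alpha> \<and> openin X (\<Union>\<U>)"
proof -
  interpret group_action G "topspace X" \<alpha> by fact
  have "istopology (\<lambda>\<U>. \<U> \<subseteq> orbits G (topspace X) \<alpha> \<and> openin X (\<Union>\<U>))"
    unfolding istopology_def
  proof (intro conjI allI impI)
    fix S T assume *: "S \<subseteq> orbits G (topspace X) \<alpha> \<and> openin X (\<Union>S)"
      "T \<subseteq> orbits G (topspace X) \<alpha> \<and> openin X (\<Union>T)"
    have "\<Union>(S \<inter> T) = \<Union>S \<inter> \<Union>T"
    proof
      show "\<Union>S \<inter> \<Union>T \<subseteq> \<Union>(S \<inter> T)"
      proof
        fix x assume "x \<in> \<Union>S \<inter> \<Union>T"
        then obtain A B where AB: "A \<in> S" "x \<in> A" "B \<in> T" "x \<in> B" by blast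
        then have "A = B" using disjoint_union[of A B] * by blast
        then show "x \<in> \<Union>(S \<inter> T)" using AB by blast
      qed
    qed blast
    then show "openin X (\<Union>(S \<inter> T))" using * by (metis openin_Int)
    show "S \<inter> T \<subseteq> orbits G (topspace X) \<alpha>" using * by blast
  next
    fix \<K> assume *: "\<forall>K\<in>\<K>. K \<subseteq> orbits G (topspace X) \<alpha> \<and> openin X (\<Union>K)"
    then show "\<Union>\<K> \<subseteq> orbits G (topspace X) \<alpha>" by blast
    have "\<Union>(\<Union>\<K>) = \<Union>(Union ` \<K>)" by blast
    moreover have "openin X (\<Union>(Union ` \<K>))" using * by (intro openin_Union) auto
    ultimately show "openin X (\<Union>(\<Union>\<K>))" by simp
  qed
  then show ?thesis by (simp add: orbit_space_def topology_inverse')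
qed

lemma topspace_orbit_space:
  assumes "group_action G (topspace X) \<alpha>"
  shows "topspace (orbit_space G X \<alpha>) = orbits G (topspace X) \<alpha>"
proof -
  have "openin (orbit_space G X \<alpha>) (orbits G (topspace X) \<alpha>)"
    using group_action.orbits_coverture[OF assms] by (simp add: openin_orbit_space[OF assms])
  then show ?thesis
    by (metis assms openin_orbit_space openin_subset openin_topspace subset_antisym)
qed

lemma quotient_map_orbit:
  assumes "group_action G (topspace X) \<alpha>"
  shows "quotient_map X (orbit_space G X \<alpha>) (orbit G \<alpha>)"
proof -
  interpret group_action G "topspace X" \<alpha> by fact
  have eq: "{x \<in> topspace X. orbit G \<alpha> x \<in> \<U>} = \<Union>\<U>" if U: "\<U> \<subseteq> orbits G (topspace X) \<alpha>" for \<U>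
  proof (intro equalityI subsetI)
    fix x assume "x \<in> {x \<in> topspace X. orbit G \<alpha> x \<in> \<U>}"
    then show "x \<in> \<Union>\<U>" using orbit_refl by blast
  next
    fix x assume "x \<in> \<Union>\<U>"
    then obtain O' where O: "O' \<in> \<U>" "x \<in> O'" by blast
    then obtain y where y: "y \<in> topspace X" "O' = orbit G \<alpha> y" using U by (auto simp: orbits_def)
    have x: "x \<in> topspace X" using O y element_image by (auto simp: orbit_def)
    then have "orbit G \<alpha> x \<in> orbits G (topspace X) \<alpha>" by (auto simp: orbits_def)
    then have "orbit G \<alpha> x = O'"
      using O U x orbit_refl[OF x] disjoint_union by blast
    then show "x \<in> {x \<in> topspace X. orbit G \<alpha> x \<in> \<U>}" using x O by simp
  qed
  show ?thesis
    unfolding quotient_map_def topspace_orbit_space[OF assms]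
    by (auto simp: openin_orbit_space[OF assms] eq orbits_def)
qed

text \<open>Groups are discrete. As a model of \<open>EG\<close> we use Milnor's infinite join \<open>G * G * \<dots>\<close>, that
  is, the realization of the simplicial complex on \<open>\<nat> \<times> G\<close> whose simplices have pairwise
  distinct first coordinates, with \<open>G\<close> acting by left translation on the second coordinate.\<close>

definition EG_complex :: "('g, 'h) monoid_scheme \<Rightarrow> (nat \<times> 'g) set set"
  where "EG_complex G = {\<sigma>. finite \<sigma> \<and> \<sigma> \<subseteq> UNIV \<times> carrier G \<and> inj_on fst \<sigma>}"

definition EG :: "('g, 'h) monoid_scheme \<Rightarrow> (nat \<times> 'g \<Rightarrow> real) topology"
  where "EG G = geometric_realization (EG_complex G)"

definition EG_action ::
    "('g, 'h) monoid_scheme \<Rightarrow> 'g \<Rightarrow> (nat \<times> 'g \<Rightarrow> real) \<Rightarrow> nat \<times> 'g \<Rightarrow> real"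
  where "EG_action G g = realization_map (EG_complex G) (\<lambda>(i, h). (i, g \<otimes>\<^bsub>G\<^esub> h))"

lemma group_action_EG:
  assumes "group G"
  shows "group_action G (topspace (EG G)) (EG_action G)"
proof -
  interpret group G by fact
  have "group_action G (topspace (geometric_realization (EG_complex G)))
      (\<lambda>g. realization_map (EG_complex G) ((\<lambda>g (i, h). (i, g \<otimes>\<^bsub>G\<^esub> h)) g))"
  proof (rule group_action_realization[OF assms])
    show "(\<lambda>(i, h). (i, g \<otimes>\<^bsub>G\<^esub> h)) ` \<sigma> \<in> EG_complex G"
      if g: "g \<in> carrier G" and \<sigma>: "\<sigma> \<in> EG_complex G" for g \<sigma>
    proof -
      have "(\<lambda>(i, h). (i, g \<otimes>\<^bsub>G\<^esub> h)) ` \<sigma> \<subseteq> UNIV \<times> carrier G"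
        using g \<sigma> by (auto simp: EG_complex_def)
      moreover have "inj_on (fst \<circ> (\<lambda>(i, h). (i, g \<otimes>\<^bsub>G\<^esub> h))) \<sigma>"
        using \<sigma> by (simp add: EG_complex_def inj_on_def case_prod_unfold)
      ultimately show ?thesis using \<sigma> by (simp add: EG_complex_def inj_on_imageI)
    qed
  qed (auto simp: EG_complex_def m_assoc)
  then show ?thesis unfolding EG_def EG_action_def by simp
qed

definition BG :: "('g, 'h) monoid_scheme \<Rightarrow> (nat \<times> 'g \<Rightarrow> real) set topology"
  where "BG G = orbit_space G (EG G) (EG_action G)"

definition diagonal_action ::
    "('g, 'h) monoid_scheme \<Rightarrow> 'x topology \<Rightarrow> ('g \<Rightarrow> 'x \<Rightarrow> 'x) \<Rightarrow>
      'g \<Rightarrow> (nat \<times> 'g \<Rightarrow> real) \<times> 'x \<Rightarrow> (nat \<times> 'g \<Rightarrow> real) \<times> 'x"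
  where "diagonal_action G X \<alpha> g =
    (\<lambda>(e, x)\<in>topspace (prod_topology (EG G) X). (EG_action G g e, \<alpha> g x))"

lemma group_action_diagonal:
  assumes G: "group G" and \<alpha>: "group_action G (topspace X) \<alpha>"
  shows "group_action G (topspace (prod_topology (EG G) X)) (diagonal_action G X \<alpha>)"
proof -
  interpret E: group_action G "topspace (EG G)" "EG_action G" by (rule group_action_EG[OF G])
  interpret X: group_action G "topspace X" \<alpha> by fact
  have closed: "EG_action G g e \<in> topspace (EG G)" "\<alpha> g x \<in> topspace X"
    if "g \<in> carrier G" "e \<in> topspace (EG G)" "x \<in> topspace X" for g e x
    using that E.surj_prop X.surj_prop by blast+
  have one: "EG_action G \<one>\<^bsub>G\<^esub> e = e" "\<alpha> \<one>\<^bsub>G\<^esub> x = x"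
    if "e \<in> topspace (EG G)" "x \<in> topspace X" for e x
    using that E.id_eq_one[THEN fun_cong, of e] X.id_eq_one[THEN fun_cong, of x] by simp_all
  show ?thesis
  proof (rule group_actionI[OF G])
    fix g assume "g \<in> carrier G"
    show "diagonal_action G X \<alpha> g \<in> extensional (topspace (prod_topology (EG G) X))"
      unfolding diagonal_action_def by (rule restrict_extensional)
  qed (auto simp: diagonal_action_def closed one E.composition_rule X.composition_rule)
qed

definition borel_construction ::
    "('g, 'h) monoid_scheme \<Rightarrow> 'x topology \<Rightarrow> ('g \<Rightarrow> 'x \<Rightarrow> 'x) \<Rightarrow>
      ((nat \<times> 'g \<Rightarrow> real) \<times> 'x) set topology"
  where "borel_construction G X \<alpha> =
    orbit_space G (prod_topology (EG G) X) (diagonal_action G X \<alpha>)"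

text \<open>The projection \<open>EG \<times>\<^sub>G X \<rightarrow> BG\<close> sends the orbit of \<open>(e, x)\<close> to the orbit of \<open>e\<close>, which is
  the image of the former under \<^const>\<open>fst\<close>.\<close>

definition borel_projection :: "('e \<times> 'x) set \<Rightarrow> 'e set"
  where "borel_projection u = fst ` u"

lemma borel_projection_orbit:
  assumes "x \<in> topspace X" "e \<in> topspace (EG G)"
  shows "borel_projection (orbit G (diagonal_action G X \<alpha>) (e, x)) = orbit G (EG_action G) e"
  using assms by (force simp: borel_projection_def orbit_def diagonal_action_def image_iff)

lemma continuous_map_borel_projection:
  assumes G: "group G" and \<alpha>: "group_action G (topspace X) \<alpha>"
  shows "continuous_map (borel_construction G X \<alpha>) (BG G) borel_projection"
proof -
  let ?q = "orbit G (diagonal_action G X \<alpha>)"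
  have q: "quotient_map (prod_topology (EG G) X) (borel_construction G X \<alpha>) ?q"
    unfolding borel_construction_def by (rule quotient_map_orbit[OF group_action_diagonal[OF G \<alpha>]])
  have r: "continuous_map (EG G) (BG G) (orbit G (EG_action G))"
    unfolding BG_def by (rule quotient_imp_continuous_map[OF quotient_map_orbit[OF group_action_EG[OF G]]])
  have "continuous_map (prod_topology (EG G) X) (BG G) (borel_projection \<circ> ?q)"
    by (rule continuous_map_eq[OF continuous_map_compose[OF continuous_map_fst r]])
      (auto simp: borel_projection_orbit)
  then show ?thesis using continuous_compose_quotient_map_eq[OF q] by blast
qed

text \<open>The index is an ideal of the cohomology ring; it is represented by its set of elements, so
  only the additive structure of cohomology enters.\<close>

definition fadell_husseini_index ::
    "('g, 'h) monoid_scheme \<Rightarrow> ('c, 'd) monoid_scheme \<Rightarrow> 'x topology \<Rightarrow> ('g \<Rightarrow> 'x \<Rightarrow> 'x) \<Rightarrow>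
      (nat \<Rightarrow> ((nat \<times> 'g \<Rightarrow> real) set chain \<Rightarrow> 'c) set) set"
  where "fadell_husseini_index G A X \<alpha> =
    kernel (total_cohomology (BG G) A) (total_cohomology (borel_construction G X \<alpha>) A)
      (total_cohom_induced (borel_construction G X \<alpha>) A borel_projection)"

definition chessboard_complex :: "nat \<Rightarrow> nat \<Rightarrow> (nat \<times> nat) set set"
  where "chessboard_complex k p =
    {\<sigma>. \<sigma> \<subseteq> {1..k} \<times> {1..p} \<and> inj_on fst \<sigma> \<and> inj_on snd \<sigma>}"

definition chessboard_space :: "nat \<Rightarrow> nat \<Rightarrow> (nat \<times> nat \<Rightarrow> real) topology"
  where "chessboard_space k p = geometric_realization (chessboard_complex k p)"

definition cyclic_perm_group :: "nat \<Rightarrow> (nat \<Rightarrow> nat) monoid"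
  where "cyclic_perm_group p = subgroup_generated (sym_group p) {cycle_of_list [1..<Suc p]}"

definition chessboard_action ::
    "nat \<Rightarrow> nat \<Rightarrow> (nat \<Rightarrow> nat) \<Rightarrow> (nat \<times> nat \<Rightarrow> real) \<Rightarrow> nat \<times> nat \<Rightarrow> real"
  where "chessboard_action k p g = realization_map (chessboard_complex k p) (\<lambda>(i, j). (i, g j))"

lemma group_cyclic_perm_group: "group (cyclic_perm_group p)"
  unfolding cyclic_perm_group_def
  by (rule group.group_subgroup_generated[OF sym_group_is_group])

lemma cyclic_perm_group_permutes:
  assumes "g \<in> carrier (cyclic_perm_group p)"
  shows "g permutes {1..p}"
proof -
  have "carrier (cyclic_perm_group p) \<subseteq> carrier (sym_group p)"
    unfolding cyclic_perm_group_def
    by (rule group.carrier_subgroup_generated_subset[OF sym_group_is_group])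
  then have "g \<in> carrier (sym_group p)" using assms by (rule subsetD)
  then show ?thesis by (simp only: sym_group_carrier)
qed

lemma group_action_chessboard:
  "group_action (cyclic_perm_group p) (topspace (chessboard_space k p)) (chessboard_action k p)"
proof -
  have "group_action (cyclic_perm_group p) (topspace (geometric_realization (chessboard_complex k p)))
      (\<lambda>g. realization_map (chessboard_complex k p) ((\<lambda>g (i, j). (i, g j)) g))"
  proof (rule group_action_realization[OF group_cyclic_perm_group])
    show "finite \<sigma>" if "\<sigma> \<in> chessboard_complex k p" for \<sigma>
      using that finite_subset[of \<sigma> "{1..k} \<times> {1..p}"] by (auto simp: chessboard_complex_def)
    show "(\<lambda>(i, j). (i, g j)) ` \<sigma> \<in> chessboard_complex k p"
      if g: "g \<in> carrier (cyclic_perm_group p)" and \<sigma>: "\<sigma> \<in> chessboard_complex k p" for g \<sigma>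
    proof -
      note P = cyclic_perm_group_permutes[OF g]
      have mem: "g j \<in> {1..p} \<longleftrightarrow> j \<in> {1..p}" and inj: "g j = g j' \<longleftrightarrow> j = j'" for j j'
        by (rule permutes_in_image[OF P], rule inj_eq[OF permutes_inj[OF P]])
      have "(\<lambda>(i, j). (i, g j)) ` \<sigma> \<subseteq> {1..k} \<times> {1..p}"
      proof (rule image_subsetI)
        fix v assume "v \<in> \<sigma>"
        then have "v \<in> {1..k} \<times> {1..p}" using \<sigma> unfolding chessboard_complex_def by blast
        then show "(case v of (i, j) \<Rightarrow> (i, g j)) \<in> {1..k} \<times> {1..p}"
          using mem[of "snd v"] by (simp add: case_prod_unfold mem_Times_iff)
      qed
      moreover have "inj_on (fst \<circ> (\<lambda>(i, j). (i, g j))) \<sigma>" "inj_on (snd \<circ> (\<lambda>(i, j). (i, g j))) \<sigma>"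
        using \<sigma> by (simp_all add: chessboard_complex_def inj_on_def inj case_prod_unfold)
      ultimately show ?thesis by (simp add: chessboard_complex_def inj_on_imageI)
    qed
  qed (auto simp: cyclic_perm_group_def subgroup_generated_def sym_group_def)
  then show ?thesis unfolding chessboard_space_def chessboard_action_def by simp
qed

end

theory Submission
  imports Defs "HOL-Number_Theory.Cong"
begin

text \<open>
  Write \<open>X\<close> for the chessboard complex, \<open>G = \<int>/p\<close>, and \<open>Y\<close> for the boundary of the
  simplex with vertex set \<open>G\<close>. Everything is compared with \<open>Y\<close>, on the level of equivariant
  chains modulo \<open>p\<close>.

  Up to dimension \<open>p - 2\<close>, averaging a simplex of \<open>Y\<close> over all its lifts to the first \<open>p - 1\<close>
  rows is, up to factors prime to \<open>p\<close>, an equivariant chain map from \<open>Y\<close> to \<open>X\<close>. Composed with the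
  projection to \<open>EG\<close> it is homotopic to multiplication by \<open>(p - 1)!\<close> because \<open>EG\<close> is acyclic, so
  no nonzero class of degree at most \<open>p - 2\<close> dies in the Borel construction.

  Conversely, forgetting the rows maps \<open>X\<close> to the full simplex on \<open>G\<close>. Facets with \<open>p - 1\<close> rows
  \<open>R\<close> are corrected by \<open>h R\<close> times the boundary of the full simplex, where the weights \<open>h R\<close> of the
  \<open>(p - 1)\<close>-subsets of any \<open>p\<close> rows add up to 1 modulo \<open>p\<close>; such weights exist because
  \<open>k \<le> 2 p - 2\<close>. The corrected map vanishes in degrees at least \<open>p - 1\<close> and is again
  homotopic to \<open>(p - 1)!\<close> times the projection, which kills all classes in these degrees.
\<close>

section \<open>Chains of words\<close>

text \<open>The Borel construction is studied through singular chains, whereas both comparison maps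
  are combinatorial. The bridge is an equivariant labelling of points by vertices, in general
  discontinuous: it sends a singular simplex to the word of labels of its vertices. Labels may
  repeat, so chains of words replace simplicial chains, and maps that change sign under swaps of
  letters take care of the repetitions. For the second comparison the labels along a simplex must
  span a simplex of X, which forces an equivariant subdivision into pieces that are small with
  respect to stars in X. The constant (p - 1)! is the number p - 1 of lifts of one vertex times the
  normalising factor (p - 2)!; it is the augmentation of both maps and a unit modulo p. Chains
  modulo p are represented by integral chains up to multiples of p. Chain groups are free, so a
  chain p e determines e, and integral acyclicity passes to acyclicity modulo p.\<close>

text \<open>Words stand for ordered simplices of dimension one less than their length. The cone
  formula suits structural induction; a single letter has the empty word as boundary, so the complex
  is augmented.\<close>

primrec list_boundary :: "'a list \<Rightarrow> 'a list \<Rightarrow>\<^sub>0 int"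
  where
    "list_boundary [] = 0"
  | "list_boundary (x # t) = frag_of t - frag_extend (frag_of \<circ> (#) x) (list_boundary t)"

abbreviation list_chain_boundary :: "('a list \<Rightarrow>\<^sub>0 int) \<Rightarrow> 'a list \<Rightarrow>\<^sub>0 int"
  where "list_chain_boundary \<equiv> frag_extend list_boundary"

text \<open>Adjacent swaps generate all permutations. The case x = y is included, which makes g
  vanish on a doubled letter.\<close>

definition alternating :: "('a list \<Rightarrow> 'b \<Rightarrow>\<^sub>0 int) \<Rightarrow> bool"
  where "alternating g \<longleftrightarrow> (\<forall>u x y v. g (u @ x # y # v) + g (u @ y # x # v) = 0)"

lemma frag_extend_id: "frag_extend (\<lambda>x. frag_of x) c = c"
  using frag_expansion[of c] by (simp add: comp_def)

lemma frag_extend_frag_extend: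
  "frag_extend f (frag_extend g c) = frag_extend (\<lambda>x. frag_extend f (g x)) c"
  by (induction c rule: frag_induction[OF subset_UNIV]) (auto simp: frag_extend_diff)

lemma frag_extend_fun_add:
  "frag_extend (\<lambda>x. f x + g x) c = frag_extend f c + frag_extend g c"
  by (induction c rule: frag_induction[OF subset_UNIV])
    (auto simp: frag_extend_diff)

lemma frag_cmul_diff: "frag_cmul k (a - b) = frag_cmul k a - frag_cmul k b"
  by (rule poly_mapping_eqI) (simp add: lookup_minus algebra_simps)

lemma frag_cmul_minus: "frag_cmul k (- c) = frag_cmul (- k) c"
  by (rule poly_mapping_eqI) simp

lemma frag_cmul_sum_left: "(\<Sum>i\<in>I. frag_cmul (f i) c) = frag_cmul (\<Sum>i\<in>I. f i) c"
  by (induction I rule: infinite_finite_induct) (simp_all add: frag_cmul_distrib)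

lemma frag_extend_fun_cmul:
  "frag_extend (\<lambda>x. frag_cmul k (f x)) c = frag_cmul k (frag_extend f c)"
  by (induction c rule: frag_induction[OF subset_UNIV])
    (auto simp: frag_extend_diff frag_cmul_diff)

lemma frag_extend_fun_diff:
  "frag_extend (\<lambda>x. f x - g x) c = frag_extend f c - frag_extend g c"
  by (induction c rule: frag_induction[OF subset_UNIV]) (auto simp: frag_extend_diff)

lemma frag_extend_fun_zero [simp]: "frag_extend (\<lambda>x. 0) c = 0"
  by (induction c rule: frag_induction[OF subset_UNIV]) (auto simp: frag_extend_diff)

lemma list_boundary_boundary: "list_chain_boundary (list_boundary t) = 0"
proof (induction t)
  case (Cons x t)
  \<comment> \<open>Prefixing x is a cone: the boundary of x c is c minus x times the boundary of
    c.\<close>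
  have "list_chain_boundary (frag_extend (frag_of \<circ> (#) x) c) =
      c - frag_extend (frag_of \<circ> (#) x) (list_chain_boundary c)" for c
    by (simp add: frag_extend_frag_extend frag_extend_fun_diff frag_extend_id)
  with Cons show ?case by (simp add: frag_extend_diff)
qed simp

lemma list_boundary_sum:
  "list_boundary t = (\<Sum>k<length t. frag_cmul ((-1) ^ k) (frag_of (take k t @ drop (Suc k) t)))"
proof (induction t)
  case (Cons x t)
  have "frag_extend (frag_of \<circ> (#) x) (\<Sum>k<length t. frag_cmul ((-1) ^ k) (frag_of (take k t @ drop (Suc k) t)))
      = (\<Sum>k<length t. frag_cmul ((-1) ^ k) (frag_of (x # take k t @ drop (Suc k) t)))"
    by (subst frag_extend_sum) (auto simp: frag_extend_cmul)
  then show ?case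
    unfolding list_boundary.simps Cons
    by (simp add: sum.lessThan_Suc_shift sum_negf[symmetric] comp_def del: sum.lessThan_Suc)
qed simp

lemma keys_list_boundary:
  assumes "s \<in> Poly_Mapping.keys (list_boundary t)"
  shows "\<exists>k<length t. s = take k t @ drop (Suc k) t"
proof -
  have "Poly_Mapping.keys (list_boundary t) \<subseteq> (\<Union>k<length t. {take k t @ drop (Suc k) t})"
    unfolding list_boundary_sum
    by (rule order_trans[OF keys_sum]) (auto simp: in_keys_iff split: if_splits)
  then show ?thesis using assms by auto
qed

lemma length_list_boundary:
  assumes "s \<in> Poly_Mapping.keys (list_boundary t)"
  shows "length t = Suc (length s)"
  using keys_list_boundary[OF assms] by auto

lemma set_list_boundary:
  assumes "s \<in> Poly_Mapping.keys (list_boundary t)"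
  shows "set s \<subseteq> set t"
  using keys_list_boundary[OF assms] by (auto dest: in_set_takeD in_set_dropD)

lemma list_boundary_map:
  "list_boundary (map f t) = frag_extend (frag_of \<circ> map f) (list_boundary t)"
proof (induction t)
  case (Cons x t)
  then show ?case
    by (simp add: frag_extend_diff frag_extend_frag_extend comp_def)
qed simp

text \<open>The faces that drop x or y are exchanged by the swap with opposite signs, and all other
  faces still contain a swap. Generalising over h lets the induction absorb the first letter of u
  into the function.\<close>

lemma alternating_boundary_aux:
  assumes "\<forall>u x y v. h (u @ x # y # v) + h (u @ y # x # v) = 0"
  shows "frag_extend h (list_boundary (u @ x # y # v)) + frag_extend h (list_boundary (u @ y # x # v)) = 0"
  using assms
proof (induction u arbitrary: h)
  case Nil
  have "frag_extend (\<lambda>s. h (x # y # s)) c + frag_extend (\<lambda>s. h (y # x # s)) c = 0" for c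
    unfolding frag_extend_fun_add[symmetric] using Nil[rule_format, of "[]"] by simp
  then show ?case
    by (simp add: frag_extend_diff frag_extend_frag_extend comp_def add_eq_0_iff)
next
  case (Cons z u)
  have "frag_extend (\<lambda>s. h (z # s)) (list_boundary (u @ x # y # v)) +
        frag_extend (\<lambda>s. h (z # s)) (list_boundary (u @ y # x # v)) = 0"
    by (rule Cons.IH) (use Cons.prems in \<open>metis append_Cons\<close>)
  moreover have "h (u @ x # y # v) + h (u @ y # x # v) = 0" using Cons.prems by blast
  ultimately show ?case
    by (simp add: frag_extend_diff frag_extend_frag_extend comp_def algebra_simps eq_neg_iff_add_eq_0 minus_unique)
qed

lemma alternating_boundary:
  assumes "alternating g"
  shows "alternating (\<lambda>t. frag_extend g (list_boundary t))"
  using alternating_boundary_aux[of g] assms unfolding alternating_def by blast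

lemma alternating_move:
  assumes "alternating g"
  shows "g (u @ v @ x # w) = frag_cmul ((-1) ^ length v) (g (u @ x # v @ w))"
proof (induction v arbitrary: u)
  case (Cons y v)
  have "g (u @ y # x # v @ w) = - g (u @ x # y # v @ w)"
    using assms by (simp add: alternating_def eq_neg_iff_add_eq_0)
  with Cons[of "u @ [y]"] show ?case
    by (simp add: frag_cmul_minus_one[symmetric] del: frag_cmul_minus_one)
qed simp

lemma frag_double_zero: "c + c = 0 \<Longrightarrow> c = (0 :: 'a \<Rightarrow>\<^sub>0 int)"
  by (rule poly_mapping_eqI) (metis double_zero lookup_add lookup_zero)

text \<open>The second occurrence of a repeated letter is moved next to the first; a doubled letter
  gives c + c = 0, and integral chains have no torsion.\<close>

lemma alternating_not_distinct:
  assumes "alternating g" "\<not> distinct t"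
  shows "g t = 0"
proof -
  obtain u v w x where t: "t = u @ [x] @ v @ [x] @ w"
    using not_distinct_decomp[OF assms(2)] by blast
  have "g (u @ x # x # v @ w) = 0"
    using assms(1) frag_double_zero unfolding alternating_def by blast
  then show ?thesis
    using alternating_move[OF assms(1), of "u @ [x]" v x w] t by simp
qed

section \<open>Spreading words over rows\<close>

text \<open>Signed sum of all ways to pull one letter out to the front. It is
  \<open>list_boundary\<close> with memory: the deleted letter is kept as first component.\<close>

primrec head_split :: "'a list \<Rightarrow> ('a \<times> 'a list) \<Rightarrow>\<^sub>0 int"
  where
    "head_split [] = 0"
  | "head_split (x # t) = frag_of (x, t) - frag_extend (\<lambda>(y, s). frag_of (y, x # s)) (head_split t)"

lemma keys_head_split:
  "(x, s) \<in> Poly_Mapping.keys (head_split t) \<Longrightarrow>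
     length t = Suc (length s) \<and> x \<in> set t \<and> set s \<subseteq> set t \<and> (distinct t \<longrightarrow> distinct s \<and> x \<notin> set s)"
proof (induction t arbitrary: x s)
  case (Cons y t)
  have "Poly_Mapping.keys (head_split (y # t)) \<subseteq>
     {(y, t)} \<union> (\<Union>(z, s)\<in>Poly_Mapping.keys (head_split t). {(z, y # s)})"
    using keys_diff[of "frag_of (y, t)"] keys_frag_extend[of "\<lambda>(z, s). frag_of (z, y # s)" "head_split t"]
    by (fastforce simp: case_prod_unfold)
  then consider "x = y" "s = t" | s' where "(x, s') \<in> Poly_Mapping.keys (head_split t)" "s = y # s'"
    using Cons.prems by auto
  then show ?case
    by cases (use Cons.IH in auto)
qed simp

lemma head_split_map:
  "head_split (map f t) = frag_extend (\<lambda>(x, s). frag_of (f x, map f s)) (head_split t)"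
  by (induction t) (auto simp: frag_extend_diff frag_extend_frag_extend case_prod_unfold)

text \<open>Two letters removed in either order come with opposite signs, exactly as in the proof
  that the boundary squares to zero.\<close>

lemma head_split_boundary:
  "frag_extend head_split (list_boundary t) +
     frag_extend (\<lambda>(x, s). frag_extend (\<lambda>s. frag_of (x, s)) (list_boundary s)) (head_split t) = 0"
proof (induction t)
  case (Cons x t)
  let ?c = "frag_extend (\<lambda>(y, s). frag_of (y, x # s))"
  let ?d = "frag_extend (\<lambda>(x, s). frag_extend (\<lambda>s. frag_of (x, s)) (list_boundary s))"
  have 1: "frag_extend head_split (list_boundary (x # t)) = head_split t -
      (frag_extend (\<lambda>s. frag_of (x, s)) (list_boundary t) - ?c (frag_extend head_split (list_boundary t)))"
    by (simp add: frag_extend_diff frag_extend_frag_extend comp_def frag_extend_fun_diff)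
  have 2: "?d (?c a) = a - ?c (?d a)" for a
    by (simp add: frag_extend_frag_extend case_prod_unfold frag_extend_diff comp_def
        frag_extend_fun_diff frag_extend_id)
  have 3: "?d (head_split (x # t)) = frag_extend (\<lambda>s. frag_of (x, s)) (list_boundary t) - ?d (?c (head_split t))"
    by (simp add: frag_extend_diff)
  have "?c (frag_extend head_split (list_boundary t)) + ?c (?d (head_split t)) = 0"
    using Cons by (simp add: frag_extend_add[symmetric])
  then show ?case
    unfolding 1 3 2 by (simp add: algebra_simps)
qed simp

text \<open>As for the boundary: the two terms that pull out x or y cancel against those of the
  swapped word, and only the remaining words have to be alternating.\<close>

lemma alternating_head_split:
  assumes "\<forall>z u x y v. h (z, u @ x # y # v) + h (z, u @ y # x # v) = 0"
  shows "frag_extend h (head_split (u @ x # y # v)) + frag_extend h (head_split (u @ y # x # v)) = 0"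
  using assms
proof (induction u arbitrary: h)
  case Nil
  have "frag_extend (\<lambda>s. h (fst s, x # y # snd s)) c + frag_extend (\<lambda>s. h (fst s, y # x # snd s)) c = 0" for c
    unfolding frag_extend_fun_add[symmetric] using Nil[rule_format, of _ "[]"] by simp
  then show ?case
    by (simp add: frag_extend_diff frag_extend_frag_extend case_prod_unfold add_eq_0_iff)
next
  case (Cons z u)
  have "frag_extend (\<lambda>s. h (fst s, z # snd s)) (head_split (u @ x # y # v)) +
        frag_extend (\<lambda>s. h (fst s, z # snd s)) (head_split (u @ y # x # v)) = 0"
    by (rule Cons.IH) (use Cons.prems in \<open>auto, metis append_Cons\<close>)
  moreover have "h (z, u @ x # y # v) + h (z, u @ y # x # v) = 0" using Cons.prems by blast
  ultimately show ?case
    by (simp add: frag_extend_diff frag_extend_frag_extend case_prod_unfold algebra_simps eq_neg_iff_add_eq_0 minus_unique)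
qed

text \<open>Each row in turn is skipped or receives one letter. The result is the sum of all lifts
  of t to words of pairs with rows in the order of R and every letter used once, with the sign of
  the rearrangement; it is 0 if t is longer than R.\<close>

primrec row_sum :: "'r list \<Rightarrow> 'a list \<Rightarrow> ('r \<times> 'a) list \<Rightarrow>\<^sub>0 int"
  where
    "row_sum [] t = (if t = [] then frag_of [] else 0)"
  | "row_sum (r # R) t = row_sum R t +
       frag_extend (\<lambda>(x, s). frag_extend (frag_of \<circ> (#) (r, x)) (row_sum R s)) (head_split t)"

text \<open>A face of a lift of t is a lift of a face s of t. Conversely a lift of s arises once for
  each row that it leaves free, as the deleted letter may have been in any of these; their number is
  |R| - (|t| - 1).\<close>

lemma row_sum_boundary:
  fixes R :: "'r list" and t :: "'a list"
  shows "list_chain_boundary (row_sum R t) =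
     frag_cmul (int (length R) + 1 - int (length t)) (frag_extend (row_sum R) (list_boundary t))"
proof (induction R arbitrary: t)
  case Nil
  show ?case
  proof (cases t)
    case (Cons x s)
    show ?thesis
    proof (cases s)
      case (Cons y s')
      have "frag_extend (row_sum ([] :: 'r list)) (list_boundary t) = 0"
        using length_list_boundary[of _ t] \<open>t = x # s\<close> Cons
        by (intro frag_extend_eq_0) (metis Suc_inject list.distinct(1) list.size(4) length_0_conv add_Suc_right
          add_0_right nat.distinct(1) row_sum.simps(1))
      moreover have "row_sum ([] :: 'r list) t = 0" using \<open>t = x # s\<close> by simp
      ultimately show ?thesis by (simp only: frag_extend_0 frag_cmul_zero2)
    qed (use \<open>t = x # s\<close> in simp)
  qed simp
next
  case (Cons r R)
  define a where "a = int (length R) + 1 - int (length t)"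
  define K :: "('a \<times> 'a list \<Rightarrow>\<^sub>0 int) \<Rightarrow> _" where "K = frag_extend (\<lambda>(x, s). frag_extend (frag_of \<circ> (#) (r, x)) (row_sum R s))"
  have cone: "list_chain_boundary (frag_extend (frag_of \<circ> (#) v) c) =
      c - frag_extend (frag_of \<circ> (#) v) (list_chain_boundary c)" for c and v :: "'r \<times> 'a"
    by (simp add: frag_extend_frag_extend frag_extend_fun_diff frag_extend_id)
  \<comment> \<open>Forgetting the letter that was pulled out turns \<open>head_split\<close> into
    the boundary.\<close>
  have hs: "frag_extend (\<lambda>(x, s). frag_of s) (head_split t) = list_boundary t" for t :: "'a list"
  proof (induction t)
    case (Cons x t)
    show ?case
      using arg_cong[OF Cons, of "frag_extend (frag_of \<circ> (#) x)"]
      by (simp add: frag_extend_diff frag_extend_frag_extend case_prod_unfold comp_def)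
  qed simp
  have "list_chain_boundary (K (head_split t)) =
      frag_extend (\<lambda>(x, s). row_sum R s - frag_cmul (a + 1) (frag_extend (frag_of \<circ> (#) (r, x))
         (frag_extend (row_sum R) (list_boundary s)))) (head_split t)"
    unfolding K_def
  proof (subst frag_extend_frag_extend, rule frag_extend_eq)
    fix z assume z: "z \<in> Poly_Mapping.keys (head_split t)"
    obtain x s where xs: "z = (x, s)" by fastforce
    \<comment> \<open>The word s is one letter shorter than t, so the induction hypothesis applies
      with factor a + 1.\<close>
    then have l: "int (length R) + 1 - int (length s) = a + 1"
      using keys_head_split z by (fastforce simp: a_def)
    show "list_chain_boundary (case z of (x, s) \<Rightarrow> frag_extend (frag_of \<circ> (#) (r, x)) (row_sum R s)) =
       (case z of (x, s) \<Rightarrow> row_sum R s - frag_cmul (a + 1) (frag_extend (frag_of \<circ> (#) (r, x))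
         (frag_extend (row_sum R) (list_boundary s))))"
      unfolding xs prod.case cone Cons l frag_extend_cmul ..
  qed
  also have "\<dots> = frag_extend (row_sum R) (frag_extend (\<lambda>(x, s). frag_of s) (head_split t))
      - frag_cmul (a + 1) (K (frag_extend (\<lambda>(x, s). frag_extend (\<lambda>s. frag_of (x, s)) (list_boundary s)) (head_split t)))"
    unfolding K_def
    by (simp add: frag_extend_frag_extend case_prod_unfold frag_extend_fun_diff frag_extend_fun_cmul)
  also have "frag_extend (\<lambda>(x, s). frag_extend (\<lambda>s. frag_of (x, s)) (list_boundary s)) (head_split t)
      = - frag_extend head_split (list_boundary t)"
    using head_split_boundary[of t] by (simp add: eq_neg_iff_add_eq_0 add.commute)
  finally have F1: "list_chain_boundary (K (head_split t)) = frag_extend (row_sum R) (list_boundary t)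
      + frag_cmul (a + 1) (K (frag_extend head_split (list_boundary t)))"
    by (simp add: hs K_def frag_extend_minus frag_cmul_minus add.commute)
  have F2: "list_chain_boundary (row_sum (r # R) t) = list_chain_boundary (row_sum R t) + list_chain_boundary (K (head_split t))"
    by (simp add: K_def frag_extend_add)
  have F3: "frag_extend (row_sum (r # R)) (list_boundary t) =
      frag_extend (row_sum R) (list_boundary t) + K (frag_extend head_split (list_boundary t))"
  proof -
    have "row_sum (r # R) = (\<lambda>t. row_sum R t + K (head_split t))"
      by (simp add: fun_eq_iff K_def)
    then show ?thesis
      by (simp add: K_def frag_extend_fun_add frag_extend_frag_extend del: row_sum.simps)
  qed
  have F4: "int (length (r # R)) + 1 - int (length t) = a + 1" by (simp add: a_def)
  \<comment> \<open>The lifts avoiding r give a copies of the first summand in F3; dropping the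
    vertex in row r supplies one more. Both summands then carry the factor a + 1.\<close>
  show ?case
    unfolding F4 F2 F1 F3 Cons[of t] a_def[symmetric]
    by (simp add: frag_cmul_distrib frag_cmul_distrib2 add_ac)
qed

lemma alternating_row_sum:
  fixes R :: "'r list"
  shows "alternating (row_sum R :: 'a list \<Rightarrow> _)"
proof (induction R)
  case Nil
  show ?case by (simp add: alternating_def)
next
  case (Cons r R)
  show ?case
    unfolding alternating_def
  proof (intro allI)
    have z: "row_sum R (u @ x # y # v) + row_sum R (u @ y # x # v) = 0" for u x y and v :: "'a list"
      using Cons unfolding alternating_def by blast
    fix u x y and v :: "'a list"
    let ?h = "\<lambda>(x, s). frag_extend (frag_of \<circ> (#) (r, x)) (row_sum R s)"
    have "frag_extend ?h (head_split (u @ x # y # v)) + frag_extend ?h (head_split (u @ y # x # v)) = 0"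
      by (rule alternating_head_split) (simp add: z frag_extend_add[symmetric])
    moreover note z[of u x y v]
    ultimately show "row_sum (r # R) (u @ x # y # v) + row_sum (r # R) (u @ y # x # v) = 0"
      by (simp add: algebra_simps)
  qed
qed

lemma keys_row_sum:
  "w \<in> Poly_Mapping.keys (row_sum R t) \<Longrightarrow>
    length w = length t \<and> set (map fst w) \<subseteq> set R \<and> set (map snd w) \<subseteq> set t \<and>
    (distinct R \<longrightarrow> distinct (map fst w)) \<and> (distinct t \<longrightarrow> distinct (map snd w))"
proof (induction R arbitrary: w t)
  case Nil
  then show ?case by (auto split: if_splits)
next
  case (Cons r R)
  let ?h = "\<lambda>(x, s). frag_extend (frag_of \<circ> (#) (r, x)) (row_sum R s)"
  consider "w \<in> Poly_Mapping.keys (row_sum R t)" | "w \<in> Poly_Mapping.keys (frag_extend ?h (head_split t))"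
    using Cons.prems keys_add[of "row_sum R t"] by auto
  then show ?case
  proof cases
    case 1
    then show ?thesis using Cons.IH[OF 1] by auto
  next
    case 2
    then obtain x s where xs: "(x, s) \<in> Poly_Mapping.keys (head_split t)"
      "w \<in> Poly_Mapping.keys (frag_extend (frag_of \<circ> (#) (r, x)) (row_sum R s))"
      using keys_frag_extend by fastforce
    then obtain w' where w': "w' \<in> Poly_Mapping.keys (row_sum R s)" "w = (r, x) # w'"
      using keys_frag_extend by fastforce
    show ?thesis using Cons.IH[OF w'(1)] keys_head_split[OF xs(1)] w'(2) by auto
  qed
qed

lemma row_sum_map:
  "row_sum R (map f t) = frag_extend (frag_of \<circ> map (apsnd f)) (row_sum R t)"
proof (induction R arbitrary: t)
  case (Cons r R)
  then show ?case
    by (simp add: frag_extend_add head_split_map frag_extend_frag_extend case_prod_unfold comp_def)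
qed simp

section \<open>Evaluation and divisibility of integral chains\<close>

text \<open>With u = 1 this is the augmentation; with representatives of residues it is a cochain
  before reduction modulo p.\<close>

definition frag_eval :: "('a \<Rightarrow> int) \<Rightarrow> ('a \<Rightarrow>\<^sub>0 int) \<Rightarrow> int"
  where "frag_eval u c = (\<Sum>x\<in>Poly_Mapping.keys c. Poly_Mapping.lookup c x * u x)"

lemma frag_eval_superset:
  assumes "finite S" "Poly_Mapping.keys c \<subseteq> S"
  shows "frag_eval u c = (\<Sum>x\<in>S. Poly_Mapping.lookup c x * u x)"
  unfolding frag_eval_def using assms
  by (intro sum.mono_neutral_left) (auto simp: in_keys_iff)

lemma frag_eval_0 [simp]: "frag_eval u 0 = 0"
  by (simp add: frag_eval_def)

lemma frag_eval_of [simp]: "frag_eval u (frag_of x) = u x"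
  by (simp add: frag_eval_def)

lemma frag_eval_add: "frag_eval u (a + b) = frag_eval u a + frag_eval u b"
proof -
  have "Poly_Mapping.keys (a + b) \<subseteq> Poly_Mapping.keys a \<union> Poly_Mapping.keys b"
    by (rule keys_add)
  then show ?thesis
    using frag_eval_superset[of "Poly_Mapping.keys a \<union> Poly_Mapping.keys b" _ u]
    by (simp add: lookup_add algebra_simps sum.distrib)
qed

lemma frag_eval_cmul: "frag_eval u (frag_cmul k c) = k * frag_eval u c"
  using frag_eval_superset[of "Poly_Mapping.keys c" "frag_cmul k c" u]
  by (simp add: keys_cmul frag_eval_def sum_distrib_left mult.assoc)

lemma frag_eval_minus: "frag_eval u (- c) = - frag_eval u c"
  using frag_eval_cmul[of u "-1" c] by simp

lemma frag_eval_diff: "frag_eval u (a - b) = frag_eval u a - frag_eval u b"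
  using frag_eval_add[of u a "- b"] by (simp add: frag_eval_minus)

lemma frag_eval_extend: "frag_eval u (frag_extend f c) = frag_eval (\<lambda>x. frag_eval u (f x)) c"
  by (induction c rule: frag_induction[OF subset_UNIV]) (auto simp: frag_extend_diff frag_eval_diff)

lemma frag_eval_cong:
  "(\<And>x. x \<in> Poly_Mapping.keys c \<Longrightarrow> u x = v x) \<Longrightarrow> frag_eval u c = frag_eval v c"
  by (simp add: frag_eval_def)

lemma frag_eval_fun_add: "frag_eval (\<lambda>x. u x + v x) c = frag_eval u c + frag_eval v c"
  by (simp add: frag_eval_def algebra_simps sum.distrib)

lemma frag_eval_fun_cmul: "frag_eval (\<lambda>x. k * u x) c = k * frag_eval u c"
  by (simp add: frag_eval_def algebra_simps sum_distrib_left)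

text \<open>The chain vanishes modulo p. Phrasing this for integral chains allows one chain group
  for all coefficients.\<close>

definition frag_dvd :: "nat \<Rightarrow> ('a \<Rightarrow>\<^sub>0 int) \<Rightarrow> bool"
  where "frag_dvd p c \<longleftrightarrow> (\<exists>e. c = frag_cmul (int p) e)"

lemma frag_dvdI: "c = frag_cmul (int p * k) e \<Longrightarrow> frag_dvd p c"
  unfolding frag_dvd_def by (metis frag_cmul_cmul)

lemma frag_dvd_0 [simp]: "frag_dvd p 0"
  unfolding frag_dvd_def by (metis frag_cmul_zero2)

lemma frag_dvd_add: "frag_dvd p a \<Longrightarrow> frag_dvd p b \<Longrightarrow> frag_dvd p (a + b)"
  unfolding frag_dvd_def by (metis frag_cmul_distrib2)

lemma frag_dvd_diff: "frag_dvd p a \<Longrightarrow> frag_dvd p b \<Longrightarrow> frag_dvd p (a - b)"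
  unfolding frag_dvd_def by (metis frag_cmul_diff)

lemma frag_dvd_cmul: "frag_dvd p a \<Longrightarrow> frag_dvd p (frag_cmul k a)"
  unfolding frag_dvd_def by (metis frag_cmul_cmul mult.commute)

lemma frag_dvd_minus: "frag_dvd p a \<Longrightarrow> frag_dvd p (- a)"
  using frag_dvd_cmul[of p a "-1"] by simp

lemma frag_dvd_frag_eval: "frag_dvd p c \<Longrightarrow> int p dvd frag_eval u c"
  unfolding frag_dvd_def by (auto simp: frag_eval_cmul)

lemma frag_dvd_extend:
  assumes "\<And>x. x \<in> Poly_Mapping.keys c \<Longrightarrow> frag_dvd p (f x)"
  shows "frag_dvd p (frag_extend f c)"
  using subset_refl[of "Poly_Mapping.keys c"]
proof (induction c rule: frag_induction)
  case (diff a b)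
  then show ?case by (simp add: frag_extend_diff frag_dvd_diff)
qed (use assms in auto)

lemma frag_dvd_extend_arg: "frag_dvd p c \<Longrightarrow> frag_dvd p (frag_extend f c)"
  unfolding frag_dvd_def by (auto simp: frag_extend_cmul)

section \<open>The normalised lift and its truncation\<close>

text \<open>The factorial absorbs the factor in \<open>row_sum_boundary\<close>, which makes this a chain map.\<close>

definition rows_chain :: "'r list \<Rightarrow> 'a list \<Rightarrow> ('r \<times> 'a) list \<Rightarrow>\<^sub>0 int"
  where "rows_chain R t = frag_cmul (fact (length R - length t)) (row_sum R t)"

text \<open>The factor |R| + 1 - |t| turns the factorial belonging to t into the one belonging to
  its faces. For |t| = |R| + 1 the left side is 0 while the right side need not vanish: that cycle,
  \<open>rows_boundary\<close>, is the obstruction to be removed later.\<close>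

lemma rows_chain_boundary:
  assumes "length t \<le> length R"
  shows "list_chain_boundary (rows_chain R t) = frag_extend (rows_chain R) (list_boundary t)"
proof (cases t)
  case (Cons x s)
  define n where "n = length R - length t"
  have n: "int (length R) + 1 - int (length t) = int (Suc n)" using assms by (simp add: n_def)
  have "frag_extend (rows_chain R) (list_boundary t) =
      frag_extend (\<lambda>s. frag_cmul (fact (Suc n)) (row_sum R s)) (list_boundary t)"
    by (rule frag_extend_eq)
      (use length_list_boundary assms in \<open>fastforce simp: rows_chain_def n_def Suc_diff_Suc Cons simp del: fact_Suc\<close>)
  then show ?thesis
    by (simp add: rows_chain_def frag_extend_cmul row_sum_boundary n frag_extend_fun_cmul n_def[symmetric] mult.commute)
qed (simp add: rows_chain_def frag_extend_cmul row_sum_boundary)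

lemma row_sum_Nil [simp]: "row_sum R [] = frag_of []"
  by (induction R) auto

text \<open>A letter has one lift per row, weighted by (|R| - 1)!. For |R| = p - 1 this is the
  constant (p - 1)! of both homotopies.\<close>

lemma frag_eval_rows_chain_single:
  assumes "R \<noteq> []"
  shows "frag_eval (\<lambda>_. 1) (rows_chain R [x]) = fact (length R)"
proof -
  have "frag_eval (\<lambda>_. 1) (row_sum R [x]) = int (length R)"
    by (induction R) (auto simp: frag_eval_add)
  then show ?thesis
    using assms by (cases R) (simp_all add: rows_chain_def frag_eval_cmul mult.commute)
qed

lemma alternating_rows_chain: "alternating (rows_chain R)"
  using alternating_row_sum[of R] unfolding alternating_def rows_chain_def
  by (simp add: frag_cmul_distrib2[symmetric] add_ac)

lemma keys_rows_chain:
  "w \<in> Poly_Mapping.keys (rows_chain R t) \<Longrightarrow> w \<in> Poly_Mapping.keys (row_sum R t)"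
  by (simp add: rows_chain_def)

lemma rows_chain_map:
  "rows_chain R (map f t) = frag_extend (frag_of \<circ> map (apsnd f)) (rows_chain R t)"
  by (simp add: rows_chain_def row_sum_map frag_extend_cmul)

definition rows_boundary :: "'r list \<Rightarrow> 'a list \<Rightarrow> ('r \<times> 'a) list \<Rightarrow>\<^sub>0 int"
  where "rows_boundary R t = frag_extend (rows_chain R) (list_boundary t)"

text \<open>Determined if t consists of all letters of G but one. On words with repetitions any
  value will do, since the alternating \<open>rows_boundary\<close> vanishes there.\<close>

definition missing_letter :: "'a set \<Rightarrow> 'a list \<Rightarrow> 'a"
  where "missing_letter G t = (SOME m. m \<in> G - set t)"

text \<open>The correction in top degree kills the boundary of the full simplex modulo \<open>p\<close>,
  provided that the weights \<open>h\<close> of the facets of any \<open>p\<close> rows add up to 1.\<close>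

definition row_correction ::
    "'r list \<Rightarrow> 'a set \<Rightarrow> ('r set \<Rightarrow> int) \<Rightarrow> ('r \<times> 'a) list \<Rightarrow> ('r \<times> 'a) list \<Rightarrow>\<^sub>0 int"
  where "row_correction R G h \<tau> = frag_cmul (h (fst ` set \<tau>))
     (rows_boundary R (missing_letter G (map snd \<tau>) # map snd \<tau>))"

text \<open>The rows of \<tau> are forgotten and its letters spread over the fixed rows R. With p -
  1 rows the correction takes place in dimension p - 2, and the map is 0 from dimension p - 1
  on.\<close>

definition truncated_chain ::
    "'r list \<Rightarrow> 'a set \<Rightarrow> ('r set \<Rightarrow> int) \<Rightarrow> ('r \<times> 'a) list \<Rightarrow> ('r \<times> 'a) list \<Rightarrow>\<^sub>0 int"
  where "truncated_chain R G h \<tau> =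
    (if length \<tau> < length R then rows_chain R (map snd \<tau>)
     else if length \<tau> = length R then rows_chain R (map snd \<tau>) - row_correction R G h \<tau>
     else 0)"

lemma alternating_rows_boundary: "alternating (rows_boundary R)"
  unfolding rows_boundary_def using alternating_boundary[OF alternating_rows_chain] .

lemma alternating_row_correction:
  fixes R :: "'r list" and G :: "'a set"
  shows "alternating (row_correction R G h)"
  unfolding alternating_def
proof (intro allI)
  fix u x y and v :: "('r \<times> 'a) list"
  have s: "set (map snd (u @ x # y # v)) = set (map snd (u @ y # x # v))"
     "fst ` set (u @ x # y # v) = fst ` set (u @ y # x # v)" by auto
  then have m: "missing_letter G (map snd (u @ x # y # v)) = missing_letter G (map snd (u @ y # x # v))" (is "?m = _")
    by (simp add: missing_letter_def)
  have "rows_boundary R ((?m # map snd u) @ snd x # snd y # map snd v) + rows_boundary R ((?m # map snd u) @ snd y # snd x # map snd v) = 0"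
    using alternating_rows_boundary[where R = R and ?'a = 'a] unfolding alternating_def by blast
  then show "row_correction R G h (u @ x # y # v) + row_correction R G h (u @ y # x # v) = 0"
    unfolding row_correction_def s m[symmetric] 
    by (simp add: frag_cmul_distrib2[symmetric])
qed

text \<open>Since the faces of t have at most |R| letters, the lift commutes with their boundaries.
  The correction thus consists of cycles and leaves the map compatible with boundaries in its own
  degree.\<close>

lemma rows_boundary_boundary:
  assumes "length t \<le> Suc (length R)"
  shows "list_chain_boundary (rows_boundary R t) = 0"
proof -
  have "list_chain_boundary (rows_boundary R t) =
     frag_extend (\<lambda>s. frag_extend (rows_chain R) (list_boundary s)) (list_boundary t)"
    unfolding rows_boundary_def frag_extend_frag_extend
    by (rule frag_extend_eq, rule rows_chain_boundary) (use assms length_list_boundary in fastforce)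
  also have "\<dots> = frag_extend (rows_chain R) (list_chain_boundary (list_boundary t))"
    by (simp add: frag_extend_frag_extend)
  finally show ?thesis by (simp add: list_boundary_boundary)
qed

lemma rows_boundary_map_snd:
  "frag_extend (\<lambda>s. rows_chain R (map snd s)) (list_boundary \<tau>) = rows_boundary R (map snd \<tau>)"
  by (simp add: rows_boundary_def list_boundary_map frag_extend_frag_extend)

lemma truncated_chain_boundary:
  assumes "length \<tau> \<le> length R"
  shows "list_chain_boundary (truncated_chain R G h \<tau>) =
     frag_extend (truncated_chain R G h) (list_boundary \<tau>)"
proof -
  have "frag_extend (truncated_chain R G h) (list_boundary \<tau>) =
     frag_extend (\<lambda>s. rows_chain R (map snd s)) (list_boundary \<tau>)"
    by (rule frag_extend_eq) (use length_list_boundary assms in \<open>fastforce simp: truncated_chain_def\<close>)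
  also have "\<dots> = list_chain_boundary (rows_chain R (map snd \<tau>))"
    using assms by (simp add: rows_boundary_map_snd rows_chain_boundary rows_boundary_def)
  finally show ?thesis
    using assms
    by (auto simp: truncated_chain_def frag_extend_diff row_correction_def frag_extend_cmul rows_boundary_boundary)
qed

text \<open>The uncorrected faces add up to the obstruction \<open>rows_boundary R t\<close>. Each
  facet is corrected by the same chain up to sign, weighted by its set of rows; the signs cancel,
  and the total weight is 1 modulo p.\<close>

lemma truncated_chain_top:
  assumes len: "length \<tau> = Suc (length R)" and G: "set (map snd \<tau>) \<subseteq> G" "card G = Suc (length R)"
    and dist: "distinct \<tau> \<Longrightarrow> distinct (map fst \<tau>) \<and> distinct (map snd \<tau>)"
    and h: "distinct \<tau> \<Longrightarrow> [(\<Sum>r\<in>fst ` set \<tau>. h (fst ` set \<tau> - {r})) = 1] (mod int p)"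
  shows "frag_dvd p (frag_extend (truncated_chain R G h) (list_boundary \<tau>))"
proof -
  define t where "t = map snd \<tau>"
  define S where "S = fst ` set \<tau>"
  have eq: "frag_extend (truncated_chain R G h) (list_boundary \<tau>) =
     rows_boundary R t - frag_extend (row_correction R G h) (list_boundary \<tau>)"
    unfolding t_def rows_boundary_map_snd[symmetric] frag_extend_fun_diff[symmetric]
    by (rule frag_extend_eq) (use length_list_boundary len in \<open>fastforce simp: truncated_chain_def\<close>)
  show ?thesis
  proof (cases "distinct \<tau>")
    \<comment> \<open>A repeated vertex repeats a letter, so obstruction and correction both vanish
      by alternation.\<close>
    case False
    then have "\<not> distinct t" unfolding t_def by (simp add: distinct_map)
    then show ?thesis
      using alternating_not_distinct[OF alternating_boundary[OF alternating_row_correction] False]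
      unfolding eq by (simp add: alternating_not_distinct[OF alternating_rows_boundary])
  next
    case True
    note d = dist[OF True]
    have fin: "finite G" using G(2) by (metis card.infinite nat.distinct(1))
    have tG: "set t = G"
      using d len G distinct_card[of t] by (intro card_subset_eq[OF fin]) (simp_all add: t_def)
    have corr: "row_correction R G h (take k \<tau> @ drop (Suc k) \<tau>) =
       frag_cmul (h (S - {fst (\<tau> ! k)})) (frag_cmul ((-1) ^ k) (rows_boundary R t))" if k: "k < length \<tau>" for k
    proof -
      have \<tau>: "\<tau> = take k \<tau> @ \<tau> ! k # drop (Suc k) \<tau>" using k by (rule id_take_nth_drop)
      have t: "t = map snd (take k \<tau>) @ snd (\<tau> ! k) # map snd (drop (Suc k) \<tau>)"
        unfolding t_def by (subst \<tau>) simp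
      have "fst (\<tau> ! k) \<notin> fst ` set (take k \<tau> @ drop (Suc k) \<tau>)"
        using d by (subst (asm) \<tau>) auto
      moreover have "S = insert (fst (\<tau> ! k)) (fst ` set (take k \<tau> @ drop (Suc k) \<tau>))"
        unfolding S_def by (subst \<tau>) auto
      ultimately have 1: "fst ` set (take k \<tau> @ drop (Suc k) \<tau>) = S - {fst (\<tau> ! k)}" by auto
      have dt: "distinct t" using d by (simp add: t_def)
      \<comment> \<open>The word t uses every letter of G once, so the letter missing from the k-th
        face is the one just deleted.\<close>
      have "G - set (map snd (take k \<tau> @ drop (Suc k) \<tau>)) = {snd (\<tau> ! k)}"
        using dt unfolding tG[symmetric] t by auto
      then have 2: "missing_letter G (map snd (take k \<tau> @ drop (Suc k) \<tau>)) = snd (\<tau> ! k)"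
        by (simp add: missing_letter_def)
      \<comment> \<open>Bringing the deleted letter back from the front to position k costs the sign
        of the k-th face, which cancels the sign in the boundary formula.\<close>
      have "rows_boundary R t = frag_cmul ((-1) ^ k)
           (rows_boundary R (snd (\<tau> ! k) # map snd (take k \<tau> @ drop (Suc k) \<tau>)))"
        using alternating_move[OF alternating_rows_boundary, of R "[]" "map snd (take k \<tau>)"] t k by simp
      then have 3: "rows_boundary R (snd (\<tau> ! k) # map snd (take k \<tau> @ drop (Suc k) \<tau>)) = 
            frag_cmul ((-1) ^ k) (rows_boundary R t)" by (simp add: power_mult_distrib[symmetric])
      show ?thesis unfolding row_correction_def 1 2 3 ..
    qed
    have "frag_extend (row_correction R G h) (list_boundary \<tau>) =
       (\<Sum>k<length \<tau>. frag_cmul ((-1) ^ k) (row_correction R G h (take k \<tau> @ drop (Suc k) \<tau>)))"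
      unfolding list_boundary_sum by (subst frag_extend_sum) (auto simp: frag_extend_cmul)
    also have "\<dots> = (\<Sum>k<length \<tau>. frag_cmul (h (S - {fst (\<tau> ! k)})) (rows_boundary R t))"
      by (rule sum.cong) (simp_all add: corr power_mult_distrib[symmetric] mult.commute mult.left_commute)
    also have "\<dots> = frag_cmul (\<Sum>k<length \<tau>. h (S - {fst (\<tau> ! k)})) (rows_boundary R t)"
      by (simp add: frag_cmul_sum_left)
    also have "(\<Sum>k<length \<tau>. h (S - {fst (\<tau> ! k)})) = (\<Sum>r\<in>S. h (S - {r}))"
      using sum.distinct_set_conv_list[of "map fst \<tau>" "\<lambda>r. h (S - {r})"] d
      by (simp add: S_def sum_list_sum_nth atLeast0LessThan)
    finally have "frag_extend (truncated_chain R G h) (list_boundary \<tau>) =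
      frag_cmul (1 - (\<Sum>r\<in>S. h (S - {r}))) (rows_boundary R t)"
      using eq by (simp add: frag_cmul_diff_distrib)
    moreover obtain j where "1 - (\<Sum>r\<in>S. h (S - {r})) = int p * j"
      using h[OF True] unfolding S_def[symmetric] by (metis cong_iff_dvd_diff cong_sym dvdE)
    ultimately show ?thesis by (intro frag_dvdI[of _ _ j]) simp
  qed
qed

text \<open>Equivariance is in doubt only for the choice in \<open>missing_letter\<close>. For
  distinct letters the missing one is unique and is carried along by the bijection; otherwise the
  corrections on both sides vanish.\<close>

lemma truncated_chain_map:
  assumes f: "bij_betw f G G" and \<tau>: "set (map snd \<tau>) \<subseteq> G" and G: "card G = Suc (length R)"
  shows "truncated_chain R G h (map (apsnd f) \<tau>) =
     frag_extend (frag_of \<circ> map (apsnd f)) (truncated_chain R G h \<tau>)"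
proof -
  have ms: "map snd (map (apsnd f) \<tau>) = map f (map snd \<tau>)" by simp
  have rb: "rows_boundary R (map f t) = frag_extend (frag_of \<circ> map (apsnd f)) (rows_boundary R t)" for t
    by (simp add: rows_boundary_def list_boundary_map frag_extend_frag_extend rows_chain_map)
  have "row_correction R G h (map (apsnd f) \<tau>) = frag_extend (frag_of \<circ> map (apsnd f)) (row_correction R G h \<tau>)"
    if len: "length \<tau> = length R"
  proof (cases "distinct (map snd \<tau>)")
    case True
    have fin: "finite G" using G by (metis card.infinite nat.distinct(1))
    have "card (G - set (map snd \<tau>)) = 1"
      using card_Diff_subset[OF _ \<tau>] G len distinct_card[OF True] by simp
    then obtain m where m: "G - set (map snd \<tau>) = {m}" by (auto simp: card_1_singleton_iff)
    have "G - set (map f (map snd \<tau>)) = f ` G - f ` set (map snd \<tau>)"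
      using f unfolding bij_betw_def set_map by simp
    also have "\<dots> = f ` (G - set (map snd \<tau>))"
      using f \<tau> inj_on_image_set_diff[of f G G "set (map snd \<tau>)"] unfolding bij_betw_def by blast
    finally have "missing_letter G (map f (map snd \<tau>)) = f (missing_letter G (map snd \<tau>))"
      using m by (simp add: missing_letter_def)
    then show ?thesis
      unfolding row_correction_def ms
      by (simp add: frag_extend_cmul image_image flip: rb)
  next
    case False
    then have "\<not> distinct (m # map f (map snd \<tau>))" "\<not> distinct (m # map snd \<tau>)" for m
      using distinct_map[of f "map snd \<tau>"] by auto
    then have "rows_boundary R (m # map f (map snd \<tau>)) = 0" "rows_boundary R (m # map snd \<tau>) = 0" for m
      by (blast intro: alternating_not_distinct[OF alternating_rows_boundary])+
    then show ?thesis unfolding row_correction_def ms by simp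
  qed
  then show ?thesis
    by (simp add: truncated_chain_def ms rows_chain_map frag_extend_diff del: map_map)
qed

text \<open>Distinct rows are what a simplex of the Milnor join needs. Letters may repeat, so these
  words need not come from the chessboard complex.\<close>

lemma keys_truncated_chain:
  assumes w: "w \<in> Poly_Mapping.keys (truncated_chain R G h \<tau>)" and \<tau>: "set (map snd \<tau>) \<subseteq> G"
    and G: "card G = Suc (length R)" and R: "distinct R"
  shows "length w = length \<tau> \<and> fst ` set w \<subseteq> set R \<and> snd ` set w \<subseteq> G \<and> distinct (map fst w)"
proof -
  consider "w \<in> Poly_Mapping.keys (rows_chain R (map snd \<tau>))"
    | "length \<tau> = length R" "w \<in> Poly_Mapping.keys (row_correction R G h \<tau>)"
    using w keys_diff[of "rows_chain R (map snd \<tau>)" "row_correction R G h \<tau>"]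
    by (auto simp: truncated_chain_def split: if_splits)
  then show ?thesis
  proof cases
    case 1
    note k = keys_row_sum[OF keys_rows_chain[OF this]]
    then have "snd ` set w \<subseteq> G" using \<tau> unfolding set_map by blast
    then show ?thesis using k R by simp
  next
    case 2
    define m where "m = missing_letter G (map snd \<tau>)"
    have "card (set (map snd \<tau>)) < card G" using card_length[of "map snd \<tau>"] 2 G by simp
    then have "\<not> G \<subseteq> set (map snd \<tau>)" using card_mono[OF finite_set, of G "map snd \<tau>"] by linarith
    then have "\<exists>m. m \<in> G - set (map snd \<tau>)" by blast
    then have m: "m \<in> G" unfolding m_def missing_letter_def by (rule someI2_ex) blast
    have "w \<in> Poly_Mapping.keys (rows_boundary R (m # map snd \<tau>))"
      using 2 by (simp add: row_correction_def m_def)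
    then obtain s where s: "s \<in> Poly_Mapping.keys (list_boundary (m # map snd \<tau>))"
      "w \<in> Poly_Mapping.keys (rows_chain R s)"
      using subsetD[OF keys_frag_extend[of "rows_chain R" "list_boundary (m # map snd \<tau>)"], of w]
      unfolding rows_boundary_def by blast
    note k = keys_row_sum[OF keys_rows_chain[OF s(2)]]
    have "set s \<subseteq> G" using set_list_boundary[OF s(1)] m \<tau> by auto
    then have "snd ` set w \<subseteq> G" using k unfolding set_map by blast
    then show ?thesis using k R length_list_boundary[OF s(1)] by simp
  qed
qed

text \<open>With more than one row a single letter lies below the corrected length, so vertices are
  left alone and the augmentation is that of \<open>rows_chain\<close>. For p - 1 rows this uses
  that p is at least 3.\<close>

lemma frag_eval_truncated_chain_single:
  assumes "1 < length R"
  shows "frag_eval (\<lambda>_. 1) (truncated_chain R G h [v]) = fact (length R)"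
proof -
  have "R \<noteq> []" using assms by auto
  then show ?thesis using assms by (simp add: truncated_chain_def frag_eval_rows_chain_single)
qed

text \<open>The weight of a set of rows depends on the number s of its rows below p. It has to drop
  by 1/s from s - 1 to s, so it is a negated harmonic sum modulo p.\<close>

lemma facet_weights_exist:
  assumes p: "prime p" and k: "k \<le> 2 * p - 2"
  obtains h :: "nat set \<Rightarrow> int" where
    "\<And>S. S \<subseteq> {1..k} \<Longrightarrow> card S = p \<Longrightarrow> [(\<Sum>r\<in>S. h (S - {r})) = 1] (mod int p)"
proof -
  have "\<exists>y. [int i * y = 1] (mod int p)" if "0 < i" "i < p" for i
    using p that by (intro cong_solve_coprime_int)
      (metis coprime_commute coprime_int_iff nat_dvd_not_less prime_imp_coprime_nat)
  then obtain v where v: "\<And>i. 0 < i \<Longrightarrow> i < p \<Longrightarrow> [int i * v i = 1] (mod int p)" by metis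
  txt \<open>If \<open>s\<close> of the \<open>p\<close> rows are smaller than \<open>p\<close>, the weights \<open>g\<close> below add up to
    \<open>s g(s - 1) + (p - s) g(s)\<close>, which is \<open>s (g(s - 1) - g(s))\<close> modulo \<open>p\<close>; the bound on \<open>k\<close> ensures \<open>0 < s < p\<close>.\<close>
  define g where "g s = - (\<Sum>i\<in>{1..s}. v i)" for s
  define h where "h S = g (card (S \<inter> {1..<p}))" for S
  show thesis
  proof (rule that[of h])
    fix S assume S: "S \<subseteq> {1..k}" "card S = p"
    have p2: "2 \<le> p" using p by (rule prime_ge_2_nat)
    have fin: "finite S" using S(1) finite_subset by blast
    define A where "A = S \<inter> {1..<p}"
    define s where "s = card A"
    \<comment> \<open>At most k + 1 - p, hence at most p - 1, of the rows are p or larger, so among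
      p rows one is below p.\<close>
    have "S - A \<subseteq> {p..k}" using S(1) by (auto simp: A_def)
    then have "card (S - A) \<le> Suc k - p" using card_mono[of "{p..k}"] by fastforce
    moreover have "card S = card A + card (S - A)"
      using card_Int_Diff[OF fin, of "{1..<p}"] unfolding A_def Diff_Int_distrib2 by (simp add: Diff_Int)
    ultimately have "0 < s" using S(2) k p2 by (simp add: s_def)
    have "s \<le> card {1..<p}" unfolding s_def A_def by (rule card_mono) auto
    then have "s < p" using p2 by simp
    have "(\<Sum>r\<in>S. h (S - {r})) = (\<Sum>r\<in>A. h (S - {r})) + (\<Sum>r\<in>S - A. h (S - {r}))"
      using fin by (metis A_def Int_lower1 add.commute sum.subset_diff)
    also have "(\<Sum>r\<in>A. h (S - {r})) = (\<Sum>r\<in>A. g (s - 1))"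
    proof (rule sum.cong)
      fix r assume "r \<in> A"
      then have "(S - {r}) \<inter> {1..<p} = A - {r}" by (auto simp: A_def)
      then show "h (S - {r}) = g (s - 1)" using \<open>r \<in> A\<close> by (simp add: h_def s_def)
    qed simp
    also have "(\<Sum>r\<in>S - A. h (S - {r})) = (\<Sum>r\<in>S - A. g s)"
    proof (rule sum.cong)
      fix r assume "r \<in> S - A"
      then have "(S - {r}) \<inter> {1..<p} = A" by (auto simp: A_def)
      then show "h (S - {r}) = g s" by (simp add: h_def s_def)
    qed simp
    also have "(\<Sum>r\<in>A. g (s - 1)) + (\<Sum>r\<in>S - A. g s) = int s * g (s - 1) + int (card (S - A)) * g s"
      by (simp add: s_def)
    also have "int (card (S - A)) = int p - int s"
      using \<open>card S = card A + card (S - A)\<close> S(2) by (simp add: s_def)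
    also have "g s = g (s - 1) - v s"
      using \<open>0 < s\<close> by (cases s) (simp_all add: g_def)
    also have "int s * g (s - 1) + (int p - int s) * (g (s - 1) - v s) = int s * v s + int p * (g (s - 1) - v s)"
      by (simp add: algebra_simps)
    finally have "[(\<Sum>r\<in>S. h (S - {r})) = int s * v s] (mod int p)"
      by (simp add: cong_iff_dvd_diff)
    then show "[(\<Sum>r\<in>S. h (S - {r})) = 1] (mod int p)"
      using v[OF \<open>0 < s\<close> \<open>s < p\<close>] cong_trans by blast
  qed
qed

section \<open>Lifting simplices through the orbit map of a covering action\<close>

text \<open>The condition makes the translates of U pairwise disjoint, so the action is free and the
  orbit map is a covering with sheets of this form.\<close>

locale covering_action = group_action G "topspace X" \<alpha>
  for G (structure) and X :: "'x topology" and \<alpha> :: "'g \<Rightarrow> 'x \<Rightarrow> 'x" +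
  assumes continuous_action: "g \<in> carrier G \<Longrightarrow> continuous_map X X (\<alpha> g)"
    and separated: "x \<in> topspace X \<Longrightarrow>
      \<exists>U. openin X U \<and> x \<in> U \<and> (\<forall>g\<in>carrier G. g \<noteq> \<one> \<longrightarrow> \<alpha> g ` U \<inter> U = {})"
begin

abbreviation "quot \<equiv> orbit G \<alpha>"

lemma group_G: "group G"
  using group_hom group_hom.axioms(1) by blast

sublocale G: group G by (rule group_G)

lemma act_closed [simp]: "g \<in> carrier G \<Longrightarrow> x \<in> topspace X \<Longrightarrow> \<alpha> g x \<in> topspace X"
  using element_image by blast

lemma act_one [simp]: "x \<in> topspace X \<Longrightarrow> \<alpha> \<one> x = x"
  using id_eq_one[THEN fun_cong, of x] by simp

lemma act_mult: "g \<in> carrier G \<Longrightarrow> h \<in> carrier G \<Longrightarrow> x \<in> topspace X \<Longrightarrow> \<alpha> (g \<otimes> h) x = \<alpha> g (\<alpha> h x)"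
  by (rule composition_rule) auto

lemma act_inv [simp]:
  assumes "g \<in> carrier G" "x \<in> topspace X"
  shows "\<alpha> (inv g) (\<alpha> g x) = x" "\<alpha> g (\<alpha> (inv g) x) = x"
  using assms by (simp_all flip: act_mult)

lemma act_eq_one:
  assumes "g \<in> carrier G" "x \<in> topspace X" "\<alpha> g x = x"
  shows "g = \<one>"
proof -
  obtain U where U: "x \<in> U" "\<forall>g\<in>carrier G. g \<noteq> \<one> \<longrightarrow> \<alpha> g ` U \<inter> U = {}"
    using separated[OF assms(2)] by blast
  then have "x \<in> \<alpha> g ` U \<inter> U" using assms(3) by (metis IntI imageI)
  then show ?thesis using U assms(1) by (metis empty_iff)
qed

lemma act_inj:
  assumes "g \<in> carrier G" "h \<in> carrier G" "x \<in> topspace X" "\<alpha> g x = \<alpha> h x"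
  shows "g = h"
proof -
  have "\<alpha> (inv h \<otimes> g) x = x" using assms act_mult[of "inv h" g x] by simp
  then have "inv h \<otimes> g = \<one>" using assms by (intro act_eq_one) auto
  then show ?thesis using assms by (metis G.inv_closed G.inv_equality G.inv_inv)
qed

lemma quot_eq_iff:
  assumes "x \<in> topspace X" "y \<in> topspace X"
  shows "quot x = quot y \<longleftrightarrow> (\<exists>g\<in>carrier G. y = \<alpha> g x)"
proof
  assume "quot x = quot y"
  then have "y \<in> quot x" using orbit_refl[OF assms(2)] by simp
  then show "\<exists>g\<in>carrier G. y = \<alpha> g x" by (auto simp: orbit_def)
next
  assume "\<exists>g\<in>carrier G. y = \<alpha> g x"
  then obtain g where g: "g \<in> carrier G" "y = \<alpha> g x" by blast
  have "\<exists>k. \<alpha> h x = \<alpha> k y \<and> k \<in> carrier G" if "h \<in> carrier G" for h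
    using that g assms act_mult[of "h \<otimes> inv g" g x]
    by (intro exI[of _ "h \<otimes> inv g"]) (simp add: G.m_assoc)
  moreover have "\<exists>k. \<alpha> h y = \<alpha> k x \<and> k \<in> carrier G" if "h \<in> carrier G" for h
    using that g assms act_mult[of h g x] by (intro exI[of _ "h \<otimes> g"]) simp
  ultimately show "quot x = quot y" by (fastforce simp: orbit_def)
qed

lemma quot_act [simp]: "g \<in> carrier G \<Longrightarrow> x \<in> topspace X \<Longrightarrow> quot (\<alpha> g x) = quot x"
  using quot_eq_iff[of x "\<alpha> g x"] by auto

lemma continuous_map_quot: "continuous_map X (orbit_space G X \<alpha>) quot"
  by (rule quotient_imp_continuous_map[OF quotient_map_orbit]) unfold_locales

lemma topspace_quot: "topspace (orbit_space G X \<alpha>) = quot ` topspace X"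
  using topspace_orbit_space[of G X \<alpha>] group_action_axioms by (auto simp: orbits_def)

lemma openin_act_image:
  assumes "openin X U" "g \<in> carrier G"
  shows "openin X (\<alpha> g ` U)"
proof -
  have "\<alpha> g ` U = {x \<in> topspace X. \<alpha> (inv g) x \<in> U}"
    using assms openin_subset[OF assms(1)] by (force simp: image_iff subset_iff)
  then show ?thesis
    using openin_continuous_map_preimage[OF continuous_action[of "inv g"] assms(1)] assms(2) by simp
qed

lemma openin_quot_image:
  assumes "openin X U"
  shows "openin (orbit_space G X \<alpha>) (quot ` U)"
proof -
  have U: "U \<subseteq> topspace X" by (rule openin_subset[OF assms])
  have "\<Union>(quot ` U) = (\<Union>g\<in>carrier G. \<alpha> g ` U)"
    by (auto simp: orbit_def)
  then have "openin X (\<Union>(quot ` U))"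
    using openin_act_image[OF assms] by (auto intro: openin_Union)
  then show ?thesis
    using U openin_orbit_space[OF group_action_axioms] by (auto simp: orbits_def)
qed

text \<open>The sets on which the second lift is h times the first are open, since two lifts close
  to a common sheet can differ only by h. By freeness they are disjoint, so connectedness leaves a
  single one.\<close>

lemma unique_lift:
  assumes Z: "connected_space Z" and F: "continuous_map Z X F" "continuous_map Z X F'"
    and eq: "\<And>z. z \<in> topspace Z \<Longrightarrow> quot (F z) = quot (F' z)"
  shows "\<exists>g\<in>carrier G. \<forall>z\<in>topspace Z. F' z = \<alpha> g (F z)"
proof (cases "topspace Z = {}")
  case False
  have FX: "F z \<in> topspace X" "F' z \<in> topspace X" if "z \<in> topspace Z" for z
    using F that by (auto simp: continuous_map_def)
  define A where "A h = {z \<in> topspace Z. F' z = \<alpha> h (F z)}" for h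
  have ex: "\<exists>h\<in>carrier G. z \<in> A h" if "z \<in> topspace Z" for z
    using eq[OF that] FX[OF that] quot_eq_iff that by (auto simp: A_def)
  have op: "openin Z (A h)" if h: "h \<in> carrier G" for h
    unfolding openin_subopen[of Z "A h"]
  proof
    fix z assume z: "z \<in> A h"
    then have zZ: "z \<in> topspace Z" by (simp add: A_def)
    obtain U where U: "openin X U" "F z \<in> U" "\<forall>g\<in>carrier G. g \<noteq> \<one> \<longrightarrow> \<alpha> g ` U \<inter> U = {}"
      using separated[OF FX(1)[OF zZ]] by blast
    define W where "W = {z \<in> topspace Z. F z \<in> U} \<inter> {z \<in> topspace Z. F' z \<in> \<alpha> h ` U}"
    have "openin Z W"
      unfolding W_def using F U(1) h
      by (intro openin_Int openin_continuous_map_preimage[of Z X] openin_act_image)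
    moreover have "z \<in> W" using z U(2) by (auto simp: W_def A_def)
    \<comment> \<open>If k is the group element at w, then inverse of h times k moves a point of the
      sheet U into U, which forces k = h.\<close>
    moreover have "W \<subseteq> A h"
    proof
      fix w assume w: "w \<in> W"
      then have wZ: "w \<in> topspace Z" by (simp add: W_def)
      obtain k where k: "k \<in> carrier G" "F' w = \<alpha> k (F w)" using ex[OF wZ] by (auto simp: A_def)
      obtain u where u: "u \<in> U" "F' w = \<alpha> h u" using w by (auto simp: W_def)
      have uX: "u \<in> topspace X" using u U(1) openin_subset by blast
      have "\<alpha> (inv h \<otimes> k) (F w) = u"
        using k(1) h FX[OF wZ] act_mult[of "inv h" k "F w"] act_inv(1)[OF h uX]
        unfolding u(2)[symmetric] k(2)[symmetric] by simp
      then have "\<alpha> (inv h \<otimes> k) ` U \<inter> U \<noteq> {}" using u w by (auto simp: W_def)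
      then have "inv h \<otimes> k = \<one>" using U(3) h k by blast
      then have "k = h" using h k by (metis G.inv_closed G.inv_equality G.inv_inv)
      then show "w \<in> A h" using wZ k by (simp add: A_def)
    qed
    ultimately show "\<exists>T. openin Z T \<and> z \<in> T \<and> T \<subseteq> A h" by blast
  qed
  obtain z where z: "z \<in> topspace Z" using False by blast
  obtain g where g: "g \<in> carrier G" "z \<in> A g" using ex[OF z] by blast
  have "topspace Z - A g = \<Union>(A ` (carrier G - {g}))"
    using ex act_inj g FX by (fastforce simp: A_def)
  then have "openin Z (topspace Z - A g)" using op by auto
  then have "closedin Z (A g)" by (auto simp: closedin_def A_def)
  then have "A g = topspace Z"
    using Z op g unfolding connected_space_clopen_in by blast
  then show ?thesis using g by (auto simp: A_def)
qed auto

definition liftable :: "'z topology \<Rightarrow> ('z \<Rightarrow> 'x set) \<Rightarrow> 'z set \<Rightarrow> bool"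
  where "liftable Z f A \<longleftrightarrow>
    (\<exists>F. continuous_map (subtopology Z A) X F \<and> (\<forall>z\<in>topspace Z \<inter> A. quot (F z) = f z))"

lemma liftable_mono: "liftable Z f A \<Longrightarrow> B \<subseteq> A \<Longrightarrow> liftable Z f B"
  unfolding liftable_def
  by (meson Int_mono continuous_map_from_subtopology_mono order_refl subsetD)

text \<open>On the connected intersection the two lifts differ by one group element. Translating the
  second lift by it makes them agree there, and maps that agree on the overlap of two closed sets
  can be pasted.\<close>

lemma liftable_glue:
  assumes "liftable Z f A" "liftable Z f B" and AB: "connectedin Z (A \<inter> B)"
    and cl: "closedin (subtopology Z (A \<union> B)) (topspace Z \<inter> A)" "closedin (subtopology Z (A \<union> B)) (topspace Z \<inter> B)"
  shows "liftable Z f (A \<union> B)"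
proof -
  obtain F F' where F: "continuous_map (subtopology Z A) X F" "\<And>z. z \<in> topspace Z \<inter> A \<Longrightarrow> quot (F z) = f z"
    and F': "continuous_map (subtopology Z B) X F'" "\<And>z. z \<in> topspace Z \<inter> B \<Longrightarrow> quot (F' z) = f z"
    using assms(1,2) by (auto simp: liftable_def)
  have FX: "z \<in> topspace Z \<inter> A \<Longrightarrow> F z \<in> topspace X" "z \<in> topspace Z \<inter> B \<Longrightarrow> F' z \<in> topspace X" for z
    using F(1) F'(1) by (auto simp: continuous_map_def)
  have "\<exists>g\<in>carrier G. \<forall>z\<in>topspace (subtopology Z (A \<inter> B)). F z = \<alpha> g (F' z)"
  proof (rule unique_lift)
    show "connected_space (subtopology Z (A \<inter> B))" using AB by (simp add: connectedin_def)
    show "continuous_map (subtopology Z (A \<inter> B)) X F'" "continuous_map (subtopology Z (A \<inter> B)) X F"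
      using F(1) F'(1) continuous_map_from_subtopology_mono by blast+
  qed (use F(2) F'(2) in auto)
  then obtain g where g: "g \<in> carrier G" "\<And>z. z \<in> topspace Z \<inter> A \<inter> B \<Longrightarrow> F z = \<alpha> g (F' z)"
    by auto
  define H where "H z = (if z \<in> A then F z else \<alpha> g (F' z))" for z
  have H: "H z = F z" if "z \<in> A" for z using that by (simp add: H_def)
  have H': "H z = \<alpha> g (F' z)" if "z \<in> topspace Z \<inter> B" for z using that g by (auto simp: H_def)
  have cg: "continuous_map (subtopology Z B) X (\<lambda>z. \<alpha> g (F' z))"
    using continuous_map_compose[OF F'(1) continuous_action[OF g(1)]] by (simp add: comp_def)
  have "continuous_map (subtopology Z (A \<union> B)) X H"
    unfolding continuous_map_closedin
  proof (intro conjI allI impI)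
    show "H \<in> topspace (subtopology Z (A \<union> B)) \<rightarrow> topspace X"
      using FX g(1) by (auto simp: H_def)
    fix C assume C: "closedin X C"
    have *: "closedin (subtopology Z (A \<union> B)) {z \<in> topspace Z \<inter> D. K z \<in> C}"
      if K: "continuous_map (subtopology Z D) X K" and D: "D \<subseteq> A \<union> B"
        and c: "closedin (subtopology Z (A \<union> B)) (topspace Z \<inter> D)" for D K
    proof (rule closedin_trans_full[OF _ c])
      have "subtopology (subtopology Z (A \<union> B)) (topspace Z \<inter> D) = subtopology Z D"
        using D by (metis subtopology_subtopology subtopology_restrict inf.absorb_iff2 inf.left_commute inf_commute)
      then show "closedin (subtopology (subtopology Z (A \<union> B)) (topspace Z \<inter> D)) {z \<in> topspace Z \<inter> D. K z \<in> C}"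
        using closedin_continuous_map_preimage[OF K C] by simp
    qed
    have "{z \<in> topspace (subtopology Z (A \<union> B)). H z \<in> C} =
        {z \<in> topspace Z \<inter> A. F z \<in> C} \<union> {z \<in> topspace Z \<inter> B. \<alpha> g (F' z) \<in> C}"
      using H H' by auto
    then show "closedin (subtopology Z (A \<union> B)) {z \<in> topspace (subtopology Z (A \<union> B)). H z \<in> C}"
      using *[OF F(1) _ cl(1)] *[OF cg _ cl(2)] by auto
  qed
  moreover have "quot (H z) = f z" if "z \<in> topspace Z \<inter> (A \<union> B)" for z
    using that F(2) F'(2) FX g(1) by (auto simp: H_def)
  ultimately show ?thesis unfolding liftable_def by blast
qed

text \<open>The orbit map is open and injective on a sheet U, so its inverse there is continuous and
  can be composed with f.\<close>

lemma locally_liftable: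
  assumes f: "continuous_map Z (orbit_space G X \<alpha>) f" and z: "z \<in> topspace Z"
  shows "\<exists>N. openin Z N \<and> z \<in> N \<and> liftable Z f N"
proof -
  have "f z \<in> quot ` topspace X" using f z topspace_quot by (auto simp: continuous_map_def)
  then obtain x where x: "x \<in> topspace X" "f z = quot x" by blast
  obtain U where U: "openin X U" "x \<in> U" "\<forall>g\<in>carrier G. g \<noteq> \<one> \<longrightarrow> \<alpha> g ` U \<inter> U = {}"
    using separated[OF x(1)] by blast
  have UX: "U \<subseteq> topspace X" by (rule openin_subset[OF U(1)])
  have inj: "inj_on quot U"
  proof (rule inj_onI)
    fix u v assume uv: "u \<in> U" "v \<in> U" "quot u = quot v"
    then obtain g where g: "g \<in> carrier G" "v = \<alpha> g u" using quot_eq_iff UX by (metis subsetD)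
    then have "g = \<one>" using U(3) uv by blast
    then show "u = v" using g uv UX by auto
  qed
  define s where "s = inv_into U quot"
  define N where "N = {z \<in> topspace Z. f z \<in> quot ` U}"
  have sU: "s y \<in> U" "quot (s y) = y" if "y \<in> quot ` U" for y
    using that by (auto simp: s_def inv_into_into f_inv_into_f)
  have sq: "s (quot u) = u" if "u \<in> U" for u using that inj by (simp add: s_def)
  have N: "openin Z N"
    unfolding N_def by (rule openin_continuous_map_preimage[OF f openin_quot_image[OF U(1)]])
  moreover have "z \<in> N" using z x U(2) by (auto simp: N_def)
  moreover have "\<forall>z\<in>topspace Z \<inter> N. quot ((s \<circ> f) z) = f z"
    using sU by (simp add: N_def)
  moreover have "continuous_map (subtopology Z N) X (s \<circ> f)"
    unfolding continuous_map_def
  proof (intro conjI allI impI)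
    show "s \<circ> f \<in> topspace (subtopology Z N) \<rightarrow> topspace X"
      using sU UX by (auto simp: N_def)
    fix W assume W: "openin X W"
    have "{z \<in> topspace (subtopology Z N). (s \<circ> f) z \<in> W} = N \<inter> {z \<in> topspace Z. f z \<in> quot ` (U \<inter> W)}"
      using sU sq by (auto simp: N_def)
    moreover have "openin Z {z \<in> topspace Z. f z \<in> quot ` (U \<inter> W)}"
      by (rule openin_continuous_map_preimage[OF f openin_quot_image[OF openin_Int[OF U(1) W]]])
    ultimately show "openin (subtopology Z N) {z \<in> topspace (subtopology Z N). (s \<circ> f) z \<in> W}"
      by (simp only: openin_subtopology_Int2)
  qed
  ultimately show ?thesis
    unfolding liftable_def by metis
qed

end

section \<open>Lifting maps from a standard simplex\<close>

text \<open>The metric is a weighted sum of coordinate distances, and the weights 1, 1/2, 1/4, ...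
  add up to 2.\<close>

lemma dist_fun_le:
  fixes x y :: "nat \<Rightarrow> real"
  assumes "\<And>i. \<bar>x i - y i\<bar> \<le> e"
  shows "dist x y \<le> 2 * e"
proof -
  have s: "summable (\<lambda>n. (1/2)^n * min (dist (x (from_nat n)) (y (from_nat n))) 1)"
    by (rule summable_comparison_test'[of "\<lambda>n. (1/2)^n"]) (auto simp: summable_geometric_iff)
  have "dist x y \<le> suminf (\<lambda>n. (1/2::real)^n * e)"
    unfolding dist_fun_def
  proof (rule suminf_le[OF _ s])
    show "(1/2)^n * min (dist (x (from_nat n)) (y (from_nat n))) 1 \<le> (1/2)^n * e" for n
      using assms[of "from_nat n"] by (intro mult_left_mono) (auto simp: dist_real_def)
  qed (auto intro: summable_mult2)
  also have "\<dots> = 2 * e"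
    using suminf_geometric[of "1/2 :: real"] by (subst suminf_mult2[symmetric]) auto
  finally show ?thesis .
qed

definition segment_closed :: "('i \<Rightarrow> real) set \<Rightarrow> bool"
  where "segment_closed C \<longleftrightarrow>
    (\<forall>x\<in>C. \<forall>y\<in>C. \<forall>u. 0 \<le> u \<longrightarrow> u \<le> 1 \<longrightarrow> (\<lambda>i. (1 - u) * x i + u * y i) \<in> C)"

lemma segment_closed_connectedin:
  assumes "segment_closed C"
  shows "connectedin (powertop_real UNIV) C"
proof -
  define g where "g \<equiv> \<lambda>x y::'a\<Rightarrow>real. \<lambda>u i. (1 - u) * x i + u * y i"
  have "continuous_map (subtopology euclideanreal {0..1}) (powertop_real UNIV) (g x y)" for x y
    unfolding g_def continuous_map_componentwise by (force intro: continuous_intros)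
  moreover have "g x y \<in> {0..1} \<rightarrow> C" "g x y 0 = x" "g x y 1 = y" if "x \<in> C" "y \<in> C" for x y
    using that assms by (auto simp: segment_closed_def g_def)
  ultimately have "path_connectedin (powertop_real UNIV) C"
    unfolding path_connectedin_def path_connected_space_def pathin_def
    by (metis continuous_map_in_subtopology euclidean_product_topology top_greatest topspace_euclidean topspace_euclidean_subtopology)
  then show ?thesis by (rule path_connectedin_imp_connectedin)
qed

lemma segment_closed_slab:
  assumes "segment_closed C"
  shows "segment_closed {x \<in> C. a \<le> x i \<and> x i \<le> b}"
proof -
  have "a \<le> (1 - u) * s + u * t" if "0 \<le> u" "u \<le> 1" "a \<le> s" "a \<le> t" for u s t :: real
    using convex_bound_le[of "-s" "-a" "-t" "1 - u" u] that by simp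
  moreover have "(1 - u) * s + u * t \<le> b" if "0 \<le> u" "u \<le> 1" "s \<le> b" "t \<le> b" for u s t :: real
    using convex_bound_le[of s b t "1 - u" u] that by simp
  ultimately show ?thesis using assms by (auto simp: segment_closed_def)
qed

context covering_action
begin

text \<open>A Lebesgue number shows that sets of small diameter lift. Convex pieces are then
  reassembled with \<open>liftable_glue\<close>, which needs only connected intersections.\<close>

lemma lift_standard_simplex:
  fixes n :: nat
  defines "S \<equiv> subtopology (powertop_real UNIV) (standard_simplex n)"
  assumes f: "continuous_map S (orbit_space G X \<alpha>) f"
  shows "\<exists>F. continuous_map S X F \<and> (\<forall>z\<in>standard_simplex n. quot (F z) = f z)"
proof -
  let ?D = "standard_simplex n"
  have tS: "topspace S = ?D" by (simp add: S_def)
  have S: "S = top_of_set ?D" by (simp add: S_def euclidean_product_topology)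
  have comp: "compact ?D"
    using compactin_standard_simplex[of n] by (simp add: euclidean_product_topology)
  define \<C> where "\<C> = {T. open T \<and> liftable S f (?D \<inter> T)}"
  have "?D \<subseteq> \<Union>\<C>"
  proof
    fix z assume "z \<in> ?D"
    then obtain N where "openin S N" "z \<in> N" "liftable S f N"
      using locally_liftable[OF f] tS by blast
    then show "z \<in> \<Union>\<C>" by (auto simp: \<C>_def S openin_open)
  qed
  then obtain e where e: "0 < e" "\<And>x. x \<in> ?D \<Longrightarrow> \<exists>T\<in>\<C>. ball x e \<subseteq> T"
    using Heine_Borel_lemma[OF comp, of \<C>] by (metis (mono_tags, lifting) \<C>_def mem_Collect_eq)
  \<comment> \<open>Coordinate differences of at most d give distance at most 2 d, which is below
    the Lebesgue number e.\<close>
  define d where "d = e / 3"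
  have d: "0 < d" "2 * d < e" using e(1) by (auto simp: d_def)
  have small: "liftable S f C" if C: "C \<subseteq> ?D" "\<And>x y i. x \<in> C \<Longrightarrow> y \<in> C \<Longrightarrow> \<bar>x i - y i\<bar> \<le> d" for C
  proof (cases "C = {}")
    case True
    then show ?thesis by (auto simp: liftable_def continuous_map_def)
  next
    case False
    then obtain x where x: "x \<in> C" by blast
    then obtain T where T: "T \<in> \<C>" "ball x e \<subseteq> T" using e(2) C(1) by blast
    have "C \<subseteq> ball x e"
    proof
      fix y assume "y \<in> C"
      then have "dist x y \<le> 2 * d" using C(2) x by (intro dist_fun_le) auto
      then show "y \<in> ball x e" using d by simp
    qed
    then show ?thesis
      using T C(1) by (auto simp: \<C>_def intro: liftable_mono)
  qed
  txt \<open>Cut into thin slabs, one coordinate after the other; consecutive slabs meet in a connected set.\<close>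
  have "liftable S f C" if "C \<subseteq> ?D" "segment_closed C" "\<And>x y i. x \<in> C \<Longrightarrow> y \<in> C \<Longrightarrow> m \<le> i \<Longrightarrow> \<bar>x i - y i\<bar> \<le> d" for C m
    using that
  proof (induction m arbitrary: C)
    case 0
    then show ?case using small by simp
  next
    case (Suc m)
    have slab: "liftable S f {x \<in> C. a \<le> x m \<and> x m \<le> a + d}" for a
    proof (rule Suc.IH)
      show "segment_closed {x \<in> C. a \<le> x m \<and> x m \<le> a + d}"
        by (rule segment_closed_slab[OF Suc.prems(2)])
      fix x y i assume "x \<in> {x \<in> C. a \<le> x m \<and> x m \<le> a + d}" "y \<in> {x \<in> C. a \<le> x m \<and> x m \<le> a + d}" "m \<le> i"
      then show "\<bar>x i - y i\<bar> \<le> d"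
        using Suc.prems(3)[of x y i] by (cases "i = m") auto
    qed (use Suc.prems in auto)
    have C01: "0 \<le> x i" "x i \<le> 1" if "x \<in> C" for x i
      using that Suc.prems(1) by (auto simp: standard_simplex_def)
    have cl: "closedin (subtopology S E) {x \<in> E. a \<le> x m \<and> x m \<le> b}" if "E \<subseteq> C" for E a b
    proof -
      have "closedin (powertop_real UNIV) {x. x m \<in> {a..b}}"
        using closedin_continuous_map_preimage[of "powertop_real UNIV" euclideanreal "\<lambda>x. x m" "{a..b}"]
          continuous_map_product_projection[of m UNIV "\<lambda>_. euclideanreal"]
        by (simp del: atLeastAtMost_iff)
      then have "closedin (subtopology (powertop_real UNIV) E) ({x. x m \<in> {a..b}} \<inter> E)"
        by (auto simp: closedin_subtopology)
      moreover have "subtopology S E = subtopology (powertop_real UNIV) E"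
        unfolding S_def subtopology_subtopology using that Suc.prems(1) by (metis inf.absorb2 order_trans)
      moreover have "{x. x m \<in> {a..b}} \<inter> E = {x \<in> E. a \<le> x m \<and> x m \<le> b}" by auto
      ultimately show ?thesis by (simp only:)
    qed
    have slabs: "liftable S f {x \<in> C. 0 \<le> x m \<and> x m \<le> real j * d}" for j
    proof (induction j)
      case 0
      show ?case by (rule liftable_mono[OF slab[of 0]]) (use d in auto)
    next
      case (Suc j)
      let ?A = "{x \<in> C. 0 \<le> x m \<and> x m \<le> real j * d}" and ?B = "{x \<in> C. real j * d \<le> x m \<and> x m \<le> real j * d + d}"
      have un: "{x \<in> C. 0 \<le> x m \<and> x m \<le> real (Suc j) * d} = ?A \<union> ?B"
      proof -
        have "0 \<le> real j * d" using d by simp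
        moreover have "real (Suc j) * d = real j * d + d" by (simp add: algebra_simps)
        moreover have "\<forall>x\<in>C. 0 \<le> x m" using C01 by blast
        ultimately show ?thesis using d by auto
      qed
      \<comment> \<open>The slabs meet in a slice of width 0. It is convex, hence connected, also
        when it is empty.\<close>
      have "?A \<inter> ?B = {x \<in> C. real j * d \<le> x m \<and> x m \<le> real j * d}"
        using d C01 by auto
      then have "connectedin (powertop_real UNIV) (?A \<inter> ?B)"
        using segment_closed_connectedin[OF segment_closed_slab[OF \<open>segment_closed C\<close>]] by simp
      then have con: "connectedin S (?A \<inter> ?B)"
        using \<open>C \<subseteq> ?D\<close> by (auto simp: S_def connectedin_subtopology)
      have top: "topspace S \<inter> E = E" if "E \<subseteq> C" for E using that \<open>C \<subseteq> ?D\<close> tS by auto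
      have sub: "?A \<union> ?B \<subseteq> C" by auto
      have A: "?A = {x \<in> ?A \<union> ?B. 0 \<le> x m \<and> x m \<le> real j * d}"
        and B: "?B = {x \<in> ?A \<union> ?B. real j * d \<le> x m \<and> x m \<le> real j * d + d}" by auto
      have "closedin (subtopology S (?A \<union> ?B)) (topspace S \<inter> ?A)"
           "closedin (subtopology S (?A \<union> ?B)) (topspace S \<inter> ?B)"
        using cl[OF sub, of 0 "real j * d"] cl[OF sub, of "real j * d" "real j * d + d"]
        unfolding A[symmetric] B[symmetric] by (simp_all add: top)
      then show ?case
        unfolding un by (rule liftable_glue[OF Suc slab con])
    qed
    obtain j where "1 \<le> real j * d" using d reals_Archimedean3[of d] by (meson less_imp_le)
    then have "\<forall>x\<in>C. 0 \<le> x m \<and> x m \<le> real j * d" using C01 order_trans by blast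
    then have C: "C = {x \<in> C. 0 \<le> x m \<and> x m \<le> real j * d}" by blast
    show ?case by (subst C) (rule slabs)
  qed
  moreover have "segment_closed ?D" by (auto simp: segment_closed_def convex_standard_simplex)
  \<comment> \<open>Coordinates beyond n vanish on the simplex, so the claim applies to all of it
    with m = n + 1.\<close>
  moreover have "\<bar>x i - y i\<bar> \<le> d" if "x \<in> ?D" "y \<in> ?D" "Suc n \<le> i" for x y i
    using that d by (auto simp: standard_simplex_def)
  ultimately have "liftable S f ?D" by blast
  then show ?thesis
    by (auto simp: liftable_def S_def subtopology_subtopology)
qed

end

section \<open>Singular simplices and cochains of the orbit space\<close>

context covering_action
begin

lemma simplex_act_closed:
  "g \<in> carrier G \<Longrightarrow> singular_simplex n X \<sigma> \<Longrightarrow> singular_simplex n X (simplex_map n (\<alpha> g) \<sigma>)"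
  by (rule singular_simplex_simplex_map[OF _ continuous_action])

lemma singular_simplex_point:
  "singular_simplex n X \<sigma> \<Longrightarrow> x \<in> standard_simplex n \<Longrightarrow> \<sigma> x \<in> topspace X"
  by (auto simp: singular_simplex_def continuous_map_def)

lemma simplex_act_one: "singular_simplex n X \<sigma> \<Longrightarrow> simplex_map n (\<alpha> \<one>) \<sigma> = \<sigma>"
  by (rule simplex_map_id_gen) auto

lemma simplex_act_mult:
  assumes "g \<in> carrier G" "h \<in> carrier G" "singular_simplex n X \<sigma>"
  shows "simplex_map n (\<alpha> (g \<otimes> h)) \<sigma> = simplex_map n (\<alpha> g) (simplex_map n (\<alpha> h) \<sigma>)"
  using assms act_mult singular_simplex_point[OF assms(3)]
  by (auto simp: simplex_map_def intro!: restrict_ext)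

lemma simplex_act_free:
  assumes "g \<in> carrier G" "singular_simplex n X \<sigma>" "simplex_map n (\<alpha> g) \<sigma> = \<sigma>"
  shows "g = \<one>"
proof -
  obtain x where x: "x \<in> standard_simplex n" using nonempty_standard_simplex by blast
  have "\<alpha> g (\<sigma> x) = \<sigma> x" using fun_cong[OF assms(3), of x] x by (simp add: simplex_map_def)
  then show ?thesis using act_eq_one assms(1) singular_simplex_point[OF assms(2) x] by blast
qed

text \<open>Together with \<open>quot_simplex_eq\<close> this identifies the singular simplices of
  the orbit space with the orbits of those upstairs.\<close>

lemma lift_singular_simplex:
  assumes "singular_simplex n (orbit_space G X \<alpha>) \<tau>"
  shows "\<exists>\<sigma>. singular_simplex n X \<sigma> \<and> simplex_map n quot \<sigma> = \<tau>"
proof -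
  obtain F where F: "continuous_map (subtopology (powertop_real UNIV) (standard_simplex n)) X F"
      "\<And>z. z \<in> standard_simplex n \<Longrightarrow> quot (F z) = \<tau> z"
    using lift_standard_simplex[of n \<tau>] assms by (auto simp: singular_simplex_def)
  have "singular_simplex n X (restrict F (standard_simplex n))"
    using F(1) by (auto simp: singular_simplex_def elim: continuous_map_eq)
  moreover have "simplex_map n quot (restrict F (standard_simplex n)) = \<tau>"
    using F(2) assms
    by (intro extensionalityI[of _ "standard_simplex n"]) (auto simp: simplex_map_def singular_simplex_def)
  ultimately show ?thesis by blast
qed

lemma quot_simplex_eq:
  assumes "singular_simplex n X \<sigma>" "singular_simplex n X \<sigma>'" "simplex_map n quot \<sigma> = simplex_map n quot \<sigma>'"
  shows "\<exists>g\<in>carrier G. \<sigma>' = simplex_map n (\<alpha> g) \<sigma>"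
proof -
  let ?S = "subtopology (powertop_real UNIV) (standard_simplex n)"
  have "\<exists>g\<in>carrier G. \<forall>z\<in>topspace ?S. \<sigma>' z = \<alpha> g (\<sigma> z)"
  proof (rule unique_lift)
    show "connected_space ?S" using connectedin_standard_simplex[of n] by (simp add: connectedin_def)
    show "quot (\<sigma> z) = quot (\<sigma>' z)" if "z \<in> topspace ?S" for z
      using fun_cong[OF assms(3), of z] that by (simp add: simplex_map_def)
  qed (use assms in \<open>auto simp: singular_simplex_def\<close>)
  then obtain g where "g \<in> carrier G" "\<And>z. z \<in> standard_simplex n \<Longrightarrow> \<sigma>' z = \<alpha> g (\<sigma> z)"
    by auto
  then show ?thesis
    using assms(2)
    by (intro bexI[of _ g] extensionalityI[of _ "standard_simplex n"]) (auto simp: simplex_map_def singular_simplex_def)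
qed

end

text \<open>Residues are represented by the integers from 0 to p - 1. A cochain is the reduction of
  the integral linear extension of its values on simplices, so integer arithmetic and congruences
  suffice from here on.\<close>

lemma cochain_frag_eval:
  assumes p: "0 < p" and \<phi>: "\<phi> \<in> carrier (cochain_group n X (integer_mod_group p))" and c: "singular_chain n X c"
  shows "\<phi> c = frag_eval (\<lambda>\<sigma>. \<phi> (frag_of \<sigma>)) c mod int p"
proof -
  have hom: "\<phi> \<in> hom (chain_group n X) (integer_mod_group p)"
    using \<phi> by (simp add: carrier_cochain_group)
  have \<phi>0: "\<phi> 0 = 0"
  proof -
    have "group_hom (chain_group n X) (integer_mod_group p) \<phi>"
      using hom by (simp add: group_hom_def group_hom_axioms_def)
    then show ?thesis using group_hom.hom_one by fastforce
  qed
  have add: "\<phi> (a + b) = (\<phi> a + \<phi> b) mod int p" if "singular_chain n X a" "singular_chain n X b" for a b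
    using hom that by (simp add: hom_def)
  have car: "\<phi> a \<in> {0..<int p}" if "singular_chain n X a" for a
    using hom_in_carrier[OF hom, of a] that p by (simp add: carrier_integer_mod_group)
  have "singular_chain n X c \<and> \<phi> c = frag_eval (\<lambda>\<sigma>. \<phi> (frag_of \<sigma>)) c mod int p"
    using c unfolding singular_chain_def
  proof (induction c rule: frag_induction)
    case zero
    show ?case using \<phi>0 by simp
  next
    case (one \<sigma>)
    then show ?case using car[of "frag_of \<sigma>"] by (simp add: singular_chain_of)
  next
    case (diff a b)
    then have ab: "singular_chain n X a" "singular_chain n X b" by (simp_all add: singular_chain_def)
    have "\<phi> a mod int p = (\<phi> (a - b) + \<phi> b) mod int p"
      using add[of "a - b" b] ab by (simp add: singular_chain_diff)
    then have "\<phi> (a - b) mod int p = (\<phi> a - \<phi> b) mod int p"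
      by (metis add_diff_cancel_right' mod_diff_left_eq)
    moreover have "\<phi> (a - b) mod int p = \<phi> (a - b)"
      using car[OF singular_chain_diff[OF ab]] by simp
    ultimately show ?case
      using diff singular_chain_diff[OF ab] by (simp add: frag_eval_diff mod_diff_eq singular_chain_def)
  qed
  then show ?thesis by blast
qed

lemma frag_eval_cochain:
  assumes p: "0 < p"
  shows "(\<lambda>c\<in>singular_chain_set n X. frag_eval u c mod int p) \<in> carrier (cochain_group n X (integer_mod_group p))"
  using p by (auto simp: carrier_cochain_group hom_def carrier_integer_mod_group mult_integer_mod_group
      singular_chain_add frag_eval_add mod_add_eq)

text \<open>An invariant function on simplices upstairs has a well defined value on a simplex of the
  orbit space, taken at any lift. Only a congruence modulo p is demanded of the integer function
  u.\<close>

lemma (in covering_action) coboundary_descent: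
  assumes p: "0 < p" and \<phi>: "\<phi> \<in> carrier (cochain_group (Suc m) (orbit_space G X \<alpha>) (integer_mod_group p))"
    and inv: "\<And>g \<sigma>. g \<in> carrier G \<Longrightarrow> singular_simplex m X \<sigma> \<Longrightarrow> u (simplex_map m (\<alpha> g) \<sigma>) = u \<sigma>"
    and eq: "\<And>\<sigma>. singular_simplex (Suc m) X \<sigma> \<Longrightarrow>
      [\<phi> (frag_of (simplex_map (Suc m) quot \<sigma>)) = frag_eval u (chain_boundary (Suc m) (frag_of \<sigma>))] (mod int p)"
  shows "\<phi> \<in> coboundaries (Suc m) (orbit_space G X \<alpha>) (integer_mod_group p)"
proof -
  let ?Y = "orbit_space G X \<alpha>" and ?A = "integer_mod_group p"
  define v where "v \<tau> = u (SOME \<sigma>. singular_simplex m X \<sigma> \<and> simplex_map m quot \<sigma> = \<tau>)" for \<tau>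
  have v: "v (simplex_map m quot \<sigma>) = u \<sigma>" if \<sigma>: "singular_simplex m X \<sigma>" for \<sigma>
  proof -
    define \<sigma>' where "\<sigma>' = (SOME \<sigma>'. singular_simplex m X \<sigma>' \<and> simplex_map m quot \<sigma>' = simplex_map m quot \<sigma>)"
    have "singular_simplex m X \<sigma>' \<and> simplex_map m quot \<sigma>' = simplex_map m quot \<sigma>"
      unfolding \<sigma>'_def by (rule someI[of _ \<sigma>]) (use \<sigma> in simp)
    then show ?thesis
      using quot_simplex_eq[OF \<sigma>, of \<sigma>'] inv \<sigma> unfolding v_def \<sigma>'_def[symmetric] by metis
  qed
  have vc: "frag_eval v (chain_map m quot c) = frag_eval u c" if "singular_chain m X c" for c
    unfolding chain_map_def frag_eval_extend
    using that v by (intro frag_eval_cong) (auto simp: singular_chain_def)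
  define \<psi> where "\<psi> = (\<lambda>c\<in>singular_chain_set m ?Y. frag_eval v c mod int p)"
  have \<psi>: "\<psi> \<in> carrier (cochain_group m ?Y ?A)" unfolding \<psi>_def by (rule frag_eval_cochain[OF p])
  have "coboundary_map m ?Y \<psi> = \<phi>"
  proof (rule extensionalityI[of _ "singular_chain_set (Suc m) ?Y"])
    show "\<phi> \<in> extensional (singular_chain_set (Suc m) ?Y)"
      using \<phi> by (simp add: carrier_cochain_group)
    fix c assume "c \<in> singular_chain_set (Suc m) ?Y"
    then have c: "singular_chain (Suc m) ?Y c" by simp
    have "[frag_eval v (chain_boundary (Suc m) c) = frag_eval (\<lambda>\<sigma>. \<phi> (frag_of \<sigma>)) c] (mod int p)"
      using c unfolding singular_chain_def
    proof (induction c rule: frag_induction)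
      case (one \<tau>)
      then obtain \<sigma> where \<sigma>: "singular_simplex (Suc m) X \<sigma>" "simplex_map (Suc m) quot \<sigma> = \<tau>"
        using lift_singular_simplex by blast
      have s: "singular_chain (Suc m) X (frag_of \<sigma>)" using \<sigma> by (simp add: singular_chain_of)
      have "chain_boundary (Suc m) (frag_of \<tau>) = chain_map m quot (chain_boundary (Suc m) (frag_of \<sigma>))"
        using chain_boundary_chain_map[OF s, of quot] \<sigma>(2) by simp
      then have "frag_eval v (chain_boundary (Suc m) (frag_of \<tau>)) = frag_eval u (chain_boundary (Suc m) (frag_of \<sigma>))"
        using vc singular_chain_boundary_alt[OF s] by simp
      then show ?case using eq[OF \<sigma>(1)] \<sigma>(2) by (simp add: cong_sym_eq)
    qed (auto simp: chain_boundary_diff frag_eval_diff intro: cong_diff)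
    then show "coboundary_map m ?Y \<psi> c = \<phi> c"
      using c cochain_frag_eval[OF p \<phi> c] singular_chain_boundary_alt[OF c]
      by (simp add: coboundary_map_def \<psi>_def cong_def)
  qed (simp add: coboundary_map_def)
  then show ?thesis using \<psi> by (auto simp: coboundaries_def)
qed

section \<open>Equivariant chain homotopies\<close>

text \<open>One admissible value is chosen per orbit and transported by the group; freeness makes
  the transporting element unique. The multiplicativity of \<open>act'\<close> is demanded on
  admissible values, as for maps induced on chains of the target space.\<close>

lemma (in group) equivariant_choice:
  fixes act :: "'a \<Rightarrow> 'c \<Rightarrow> 'c" and act' :: "'a \<Rightarrow> 'd \<Rightarrow> 'd"
  assumes closed: "\<And>g b. g \<in> carrier G \<Longrightarrow> b \<in> B \<Longrightarrow> act g b \<in> B"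
    and one: "\<And>b. b \<in> B \<Longrightarrow> act \<one> b = b"
    and mult: "\<And>g h b. g \<in> carrier G \<Longrightarrow> h \<in> carrier G \<Longrightarrow> b \<in> B \<Longrightarrow> act (g \<otimes> h) b = act g (act h b)"
    and free: "\<And>g b. g \<in> carrier G \<Longrightarrow> b \<in> B \<Longrightarrow> act g b = b \<Longrightarrow> g = \<one>"
    and ex: "\<And>b. b \<in> B \<Longrightarrow> \<exists>y. P b y"
    and P: "\<And>g b y. g \<in> carrier G \<Longrightarrow> b \<in> B \<Longrightarrow> P b y \<Longrightarrow> P (act g b) (act' g y)"
    and mult': "\<And>g h b y. g \<in> carrier G \<Longrightarrow> h \<in> carrier G \<Longrightarrow> b \<in> B \<Longrightarrow> P b y \<Longrightarrow>
       act' (g \<otimes> h) y = act' g (act' h y)"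
  shows "\<exists>F. \<forall>b\<in>B. P b (F b) \<and> (\<forall>g\<in>carrier G. F (act g b) = act' g (F b))"
proof -
  define orb where "orb b = (\<lambda>g. act g b) ` carrier G" for b
  have orb_act: "orb (act g b) = orb b" if g: "g \<in> carrier G" and b: "b \<in> B" for g b
  proof -
    show ?thesis
      unfolding orb_def
    proof (intro equalityI image_subsetI)
      fix h assume h: "h \<in> carrier G"
      show "act h (act g b) \<in> (\<lambda>g. act g b) ` carrier G"
        using mult[OF h g b] g h by (intro image_eqI[of _ _ "h \<otimes> g"]) auto
      show "act h b \<in> (\<lambda>h. act h (act g b)) ` carrier G"
        using mult[of "h \<otimes> inv g" g b] g h b
        by (intro image_eqI[of _ _ "h \<otimes> inv g"]) (auto simp: m_assoc)
    qed
  qed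
  \<comment> \<open>The representative is chosen from the orbit as a set, so b and its translates
    get the same one.\<close>
  define rep where "rep b = (SOME c. c \<in> orb b)" for b
  have rep: "rep b \<in> orb b" if "b \<in> B" for b
    unfolding rep_def by (rule someI[of _ "act \<one> b"]) (auto simp: orb_def)
  have repB: "rep b \<in> B" if "b \<in> B" for b using rep[OF that] closed that by (auto simp: orb_def)
  have "\<exists>g\<in>carrier G. act g (rep b) = b" if b: "b \<in> B" for b
  proof -
    obtain g where g: "g \<in> carrier G" "rep b = act g b" using rep[OF b] by (auto simp: orb_def)
    then have "act (inv g) (rep b) = b" using mult[of "inv g" g b] b one by simp
    then show ?thesis using g by blast
  qed
  then obtain \<gamma> where \<gamma>: "\<And>b. b \<in> B \<Longrightarrow> \<gamma> b \<in> carrier G" "\<And>b. b \<in> B \<Longrightarrow> act (\<gamma> b) (rep b) = b"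
    by metis
  have \<gamma>_act: "\<gamma> (act g b) = g \<otimes> \<gamma> b" if g: "g \<in> carrier G" and b: "b \<in> B" for g b
  proof -
    let ?h = "\<gamma> (act g b)"
    have h: "?h \<in> carrier G" using \<gamma> closed g b by blast
    have "act ?h (rep b) = act (g \<otimes> \<gamma> b) (rep b)"
      using \<gamma>(2)[OF closed[OF g b]] orb_act[OF g b] mult[OF g \<gamma>(1)[OF b] repB[OF b]] \<gamma>(2)[OF b]
      by (simp add: rep_def)
    then have "act (inv (g \<otimes> \<gamma> b)) (act ?h (rep b)) = rep b"
      using mult[of "inv (g \<otimes> \<gamma> b)" "g \<otimes> \<gamma> b" "rep b"] g \<gamma>(1)[OF b] repB[OF b] one by simp
    then have "act (inv (g \<otimes> \<gamma> b) \<otimes> ?h) (rep b) = rep b"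
      using mult[of "inv (g \<otimes> \<gamma> b)" ?h "rep b"] g \<gamma>(1)[OF b] repB[OF b] h by simp
    then have "inv (g \<otimes> \<gamma> b) \<otimes> ?h = \<one>"
      using free g h \<gamma>(1)[OF b] repB[OF b] by (meson inv_closed m_closed)
    then show ?thesis using g h \<gamma>(1)[OF b] by (metis inv_closed inv_equality inv_inv m_closed)
  qed
  obtain Y where Y: "\<And>b. b \<in> B \<Longrightarrow> P b (Y b)" using ex by metis
  show ?thesis
  proof (intro exI[of _ "\<lambda>b. act' (\<gamma> b) (Y (rep b))"] ballI conjI)
    fix b assume b: "b \<in> B"
    show "P b (act' (\<gamma> b) (Y (rep b)))"
      using P[OF \<gamma>(1)[OF b] repB[OF b] Y[OF repB[OF b]]] \<gamma>(2)[OF b] by simp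
    fix g assume g: "g \<in> carrier G"
    show "act' (\<gamma> (act g b)) (Y (rep (act g b))) = act' g (act' (\<gamma> b) (Y (rep b)))"
      using mult'[OF g \<gamma>(1)[OF b] repB[OF b] Y[OF repB[OF b]]] orb_act[OF g b]
      by (simp add: \<gamma>_act[OF g b] rep_def)
  qed
qed

text \<open>\<open>R n F b y\<close> says that y is admissible at b in degree n after F was chosen
  in degree n - 1; \<open>F0\<close> stands in for degree -1. Admissibility is preserved by the
  group only if F is equivariant, so equivariance is carried through the recursion.\<close>

lemma (in group) equivariant_recursion:
  fixes B :: "nat \<Rightarrow> 'c set" and act :: "nat \<Rightarrow> 'a \<Rightarrow> 'c \<Rightarrow> 'c" and act' :: "nat \<Rightarrow> 'a \<Rightarrow> 'd \<Rightarrow> 'd"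
    and R :: "nat \<Rightarrow> ('c \<Rightarrow> 'd) \<Rightarrow> 'c \<Rightarrow> 'd \<Rightarrow> bool" and F0 :: "'c \<Rightarrow> 'd"
  defines "eqv n F \<equiv> \<forall>b\<in>B n. \<forall>g\<in>carrier G. F (act n g b) = act' n g (F b)"
  assumes closed: "\<And>n g b. g \<in> carrier G \<Longrightarrow> b \<in> B n \<Longrightarrow> act n g b \<in> B n"
    and one: "\<And>n b. b \<in> B n \<Longrightarrow> act n \<one> b = b"
    and mult: "\<And>n g h b. g \<in> carrier G \<Longrightarrow> h \<in> carrier G \<Longrightarrow> b \<in> B n \<Longrightarrow> act n (g \<otimes> h) b = act n g (act n h b)"
    and free: "\<And>n g b. g \<in> carrier G \<Longrightarrow> b \<in> B n \<Longrightarrow> act n g b = b \<Longrightarrow> g = \<one>"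
    and mult': "\<And>n F g h b y. g \<in> carrier G \<Longrightarrow> h \<in> carrier G \<Longrightarrow> b \<in> B n \<Longrightarrow> R n F b y \<Longrightarrow>
       act' n (g \<otimes> h) y = act' n g (act' n h y)"
    and R: "\<And>n F g b y. n = 0 \<or> eqv (n - 1) F \<Longrightarrow> g \<in> carrier G \<Longrightarrow> b \<in> B n \<Longrightarrow> R n F b y \<Longrightarrow>
       R n F (act n g b) (act' n g y)"
    and ex0: "\<And>b. b \<in> B 0 \<Longrightarrow> \<exists>y. R 0 F0 b y"
    and ex: "\<And>n F F' b. (\<And>b. b \<in> B n \<Longrightarrow> R n F' b (F b)) \<Longrightarrow> b \<in> B (Suc n) \<Longrightarrow> \<exists>y. R (Suc n) F b y"
  shows "\<exists>H. (\<forall>n. eqv n (H n)) \<and> (\<forall>b\<in>B 0. R 0 F0 b (H 0 b)) \<and>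
     (\<forall>n. \<forall>b\<in>B (Suc n). R (Suc n) (H n) b (H (Suc n) b))"
proof -
  have step: "\<exists>F. (\<forall>b\<in>B n. R n F' b (F b)) \<and> eqv n F"
    if "n = 0 \<or> eqv (n - 1) F'" and "\<And>b. b \<in> B n \<Longrightarrow> \<exists>y. R n F' b y" for n F'
  proof -
    have "\<exists>F. \<forall>b\<in>B n. R n F' b (F b) \<and> (\<forall>g\<in>carrier G. F (act n g b) = act' n g (F b))"
      by (rule equivariant_choice[OF closed one mult free that(2) R[OF that(1)] mult'])
    then show ?thesis unfolding eqv_def by blast
  qed
  \<comment> \<open>Pairs of the previous and the current function let dependent choice tie
    consecutive degrees together.\<close>
  define P where "P n FF \<longleftrightarrow> (n = 0 \<longrightarrow> fst FF = F0) \<and> eqv n (snd FF) \<and> (\<forall>b\<in>B n. R n (fst FF) b (snd FF b))" for n FF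
  have "\<exists>f. \<forall>n. P n (f n) \<and> fst (f (Suc n)) = snd (f n)"
  proof (rule dependent_nat_choice)
    show "\<exists>x. P 0 x" using step[of 0 F0] ex0 by (auto simp: P_def)
    fix x n assume x: "P n x"
    then have "\<exists>F. (\<forall>b\<in>B (Suc n). R (Suc n) (snd x) b (F b)) \<and> eqv (Suc n) F"
      using ex[of n "fst x" "snd x"] by (intro step) (auto simp: P_def)
    then show "\<exists>y. P (Suc n) y \<and> fst y = snd x" by (auto simp: P_def)
  qed
  then obtain f where f: "\<And>n. P n (f n)" "\<And>n. fst (f (Suc n)) = snd (f n)" by blast
  then show ?thesis
    by (intro exI[of _ "\<lambda>n. snd (f n)"]) (metis P_def)
qed

lemma chain_boundary_expand: "chain_boundary n c = frag_extend (\<lambda>\<tau>. chain_boundary n (frag_of \<tau>)) c"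
  by (induction c rule: frag_induction[OF subset_UNIV]) (auto simp: chain_boundary_diff frag_extend_diff)

lemma chain_boundary_frag_extend:
  "chain_boundary n (frag_extend F c) = frag_extend (\<lambda>\<tau>. chain_boundary n (F \<tau>)) c"
  by (induction c rule: frag_induction[OF subset_UNIV]) (auto simp: chain_boundary_diff frag_extend_diff)

lemma frag_extend_boundary:
  "frag_extend F (chain_boundary n c) = frag_extend (\<lambda>\<tau>. frag_extend F (chain_boundary n (frag_of \<tau>))) c"
  by (subst chain_boundary_expand) (rule frag_extend_frag_extend)

lemma chain_map_frag_extend: "chain_map n g (frag_extend F c) = frag_extend (\<lambda>\<tau>. chain_map n g (F \<tau>)) c"
  by (simp add: chain_map_def frag_extend_frag_extend)

lemma frag_dvd_chain_map: "frag_dvd p c \<Longrightarrow> frag_dvd p (chain_map n g c)"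
  unfolding chain_map_def by (rule frag_dvd_extend_arg)

lemma frag_eval_boundary_1: "frag_eval (\<lambda>_. 1) (chain_boundary (Suc 0) c) = 0"
proof -
  have "frag_eval (\<lambda>_. 1) (chain_boundary (Suc 0) (frag_of \<tau>)) = 0" for \<tau> :: "(nat \<Rightarrow> real) \<Rightarrow> 'a"
    by (simp add: chain_boundary_of frag_eval_diff)
  then show ?thesis
    unfolding chain_boundary_expand[of _ c] frag_eval_extend by (simp add: frag_eval_def)
qed

section \<open>Null homotopies into an acyclic space\<close>

text \<open>Vanishing of reduced homology modulo p, expressed by integral chains; the condition on
  the augmentation reduces degree 0.\<close>

definition mod_acyclic :: "nat \<Rightarrow> 'a topology \<Rightarrow> bool"
  where "mod_acyclic p Y \<longleftrightarrow> (\<forall>n c. singular_chain n Y c \<and> frag_dvd p (chain_boundary n c) \<and>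
    (n = 0 \<longrightarrow> int p dvd frag_eval (\<lambda>_. 1) c) \<longrightarrow>
    (\<exists>d. singular_chain (Suc n) Y d \<and> frag_dvd p (c - chain_boundary (Suc n) d)))"

context covering_action
begin

lemma frag_extend_equivariant:
  assumes "\<And>\<tau>. singular_simplex n X \<tau> \<Longrightarrow> F (simplex_map n (\<alpha> g) \<tau>) = act (F \<tau>)"
    and "act 0 = 0" "\<And>a b. act (a - b) = act a - act b" and c: "singular_chain n X c"
  shows "frag_extend F (chain_map n (\<alpha> g) c) = act (frag_extend F c)"
  using c unfolding singular_chain_def
  by (induction c rule: frag_induction) (auto simp: assms frag_extend_diff chain_map_diff)

text \<open>The comparison theorem for free complexes: D plays the difference of two equivariant
  chain maps modulo p with equal augmentation. The bound N admits maps that commute with boundaries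
  only in a range.\<close>

lemma equivariant_null_homotopy:
  fixes Y :: "'y topology" and \<beta> :: "'g \<Rightarrow> 'y \<Rightarrow> 'y" and D :: "nat \<Rightarrow> ((nat \<Rightarrow> real) \<Rightarrow> 'x) \<Rightarrow> 'y chain"
  assumes acyc: "mod_acyclic p Y"
    and \<beta>: "\<And>g. g \<in> carrier G \<Longrightarrow> continuous_map Y Y (\<beta> g)"
    and \<beta>_mult: "\<And>g h y. g \<in> carrier G \<Longrightarrow> h \<in> carrier G \<Longrightarrow> y \<in> topspace Y \<Longrightarrow> \<beta> (g \<otimes> h) y = \<beta> g (\<beta> h y)"
    and chain: "\<And>n \<sigma>. n \<le> N \<Longrightarrow> singular_simplex n X \<sigma> \<Longrightarrow> singular_chain n Y (D n \<sigma>)"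
    and eqv: "\<And>n \<sigma> g. n \<le> N \<Longrightarrow> singular_simplex n X \<sigma> \<Longrightarrow> g \<in> carrier G \<Longrightarrow>
       D n (simplex_map n (\<alpha> g) \<sigma>) = chain_map n (\<beta> g) (D n \<sigma>)"
    and bd: "\<And>n \<sigma>. Suc n \<le> N \<Longrightarrow> singular_simplex (Suc n) X \<sigma> \<Longrightarrow>
       frag_dvd p (chain_boundary (Suc n) (D (Suc n) \<sigma>) - frag_extend (D n) (chain_boundary (Suc n) (frag_of \<sigma>)))"
    and aug: "\<And>\<sigma>. singular_simplex 0 X \<sigma> \<Longrightarrow> int p dvd frag_eval (\<lambda>_. 1) (D 0 \<sigma>)"
  shows "\<exists>H. \<forall>n\<le>N. \<forall>\<sigma>. singular_simplex n X \<sigma> \<longrightarrow> singular_chain (Suc n) Y (H n \<sigma>) \<and>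
     (\<forall>g\<in>carrier G. H n (simplex_map n (\<alpha> g) \<sigma>) = chain_map (Suc n) (\<beta> g) (H n \<sigma>)) \<and>
     frag_dvd p (D n \<sigma> - frag_extend (H (n - 1)) (chain_boundary n (frag_of \<sigma>)) - chain_boundary (Suc n) (H n \<sigma>))"
proof -
  \<comment> \<open>Above degree N there is nothing to choose, so that the recursion can run through
    all degrees.\<close>
  define B where "B n = (if n \<le> N then singular_simplex_set n X else {})" for n
  define R where "R n F \<sigma> y \<longleftrightarrow> singular_chain (Suc n) Y y \<and>
     frag_dvd p (D n \<sigma> - frag_extend F (chain_boundary n (frag_of \<sigma>)) - chain_boundary (Suc n) y)" for n F \<sigma> y
  have "\<exists>H. (\<forall>n. \<forall>b\<in>B n. \<forall>g\<in>carrier G. H n (simplex_map n (\<alpha> g) b) = chain_map (Suc n) (\<beta> g) (H n b)) \<and>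
     (\<forall>b\<in>B 0. R 0 (\<lambda>_. 0) b (H 0 b)) \<and> (\<forall>n. \<forall>b\<in>B (Suc n). R (Suc n) (H n) b (H (Suc n) b))"
  proof (rule G.equivariant_recursion)
    fix n F and g h b y assume "g \<in> carrier G" "h \<in> carrier G" "b \<in> B n" "R n F b y"
    then have "singular_chain (Suc n) Y y" by (simp add: R_def)
    then have "chain_map (Suc n) (\<beta> (g \<otimes> h)) y = chain_map (Suc n) (\<beta> g \<circ> \<beta> h) y"
      using \<beta>_mult \<open>g \<in> carrier G\<close> \<open>h \<in> carrier G\<close> by (intro chain_map_eq) auto
    then show "chain_map (Suc n) (\<beta> (g \<otimes> h)) y = chain_map (Suc n) (\<beta> g) (chain_map (Suc n) (\<beta> h) y)"
      by (simp add: chain_map_compose)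
  next
    fix n and F :: "((nat \<Rightarrow> real) \<Rightarrow> 'x) \<Rightarrow> 'y chain" and g \<sigma> y
    assume F: "n = 0 \<or> (\<forall>b\<in>B (n - 1). \<forall>g\<in>carrier G. F (simplex_map (n - 1) (\<alpha> g) b) = chain_map (Suc (n - 1)) (\<beta> g) (F b))"
      and g: "g \<in> carrier G" and \<sigma>: "\<sigma> \<in> B n" and y: "R n F \<sigma> y"
    have n: "n \<le> N" and s: "singular_simplex n X \<sigma>" using \<sigma> by (auto simp: B_def split: if_splits)
    have sc: "singular_chain n X (frag_of \<sigma>)" using s by (simp add: singular_chain_of)
    have "frag_extend F (chain_boundary n (frag_of (simplex_map n (\<alpha> g) \<sigma>))) =
        chain_map n (\<beta> g) (frag_extend F (chain_boundary n (frag_of \<sigma>)))"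
    proof (cases n)
      case (Suc m)
      have "chain_boundary n (frag_of (simplex_map n (\<alpha> g) \<sigma>)) = chain_map m (\<alpha> g) (chain_boundary n (frag_of \<sigma>))"
        using chain_boundary_chain_map[OF sc, of "\<alpha> g"] Suc by simp
      moreover have "frag_extend F (chain_map m (\<alpha> g) (chain_boundary n (frag_of \<sigma>))) =
         chain_map n (\<beta> g) (frag_extend F (chain_boundary n (frag_of \<sigma>)))"
      proof (rule frag_extend_equivariant)
        show "F (simplex_map m (\<alpha> g) \<tau>) = chain_map n (\<beta> g) (F \<tau>)" if "singular_simplex m X \<tau>" for \<tau>
          using F g n that Suc by (auto simp: B_def)
        show "singular_chain m X (chain_boundary n (frag_of \<sigma>))"
          using singular_chain_boundary[OF sc] Suc by simp
      qed (simp_all add: chain_map_diff)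
      ultimately show ?thesis by simp
    qed (simp add: chain_boundary_def)
    moreover have "chain_boundary (Suc n) (chain_map (Suc n) (\<beta> g) y) = chain_map n (\<beta> g) (chain_boundary (Suc n) y)"
      using chain_boundary_chain_map[of "Suc n" Y y "\<beta> g"] y by (simp add: R_def)
    ultimately have "D n (simplex_map n (\<alpha> g) \<sigma>) - frag_extend F (chain_boundary n (frag_of (simplex_map n (\<alpha> g) \<sigma>)))
        - chain_boundary (Suc n) (chain_map (Suc n) (\<beta> g) y) =
       chain_map n (\<beta> g) (D n \<sigma> - frag_extend F (chain_boundary n (frag_of \<sigma>)) - chain_boundary (Suc n) y)"
      using eqv[OF n s g] by (simp add: chain_map_diff)
    then show "R n F (simplex_map n (\<alpha> g) \<sigma>) (chain_map (Suc n) (\<beta> g) y)"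
      using y singular_chain_chain_map[OF _ \<beta>[OF g]] by (simp add: R_def frag_dvd_chain_map)
  next
    fix \<sigma> assume "\<sigma> \<in> B 0"
    then have "singular_simplex 0 X \<sigma>" by (simp add: B_def)
    then show "\<exists>y. R 0 (\<lambda>_. 0) \<sigma> y"
      using acyc[unfolded mod_acyclic_def, rule_format, of 0 "D 0 \<sigma>"] aug chain[of 0]
      by (simp add: R_def chain_boundary_def[of 0])
  next
    fix n F F' \<sigma> assume F: "\<And>\<tau>. \<tau> \<in> B n \<Longrightarrow> R n F' \<tau> (F \<tau>)" and \<sigma>: "\<sigma> \<in> B (Suc n)"
    have n: "Suc n \<le> N" and s: "singular_simplex (Suc n) X \<sigma>" using \<sigma> by (auto simp: B_def split: if_splits)
    define b where "b = chain_boundary (Suc n) (frag_of \<sigma>)"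
    have b: "singular_chain n X b" unfolding b_def by (rule singular_chain_boundary_alt) (simp add: s singular_chain_of)
    have bB: "\<tau> \<in> B n" if "\<tau> \<in> Poly_Mapping.keys b" for \<tau>
      using that b n by (auto simp: B_def singular_chain_def)
    have Fb: "singular_chain (Suc n) Y (frag_extend F b)"
      by (rule singular_chain_extend) (use F bB in \<open>auto simp: R_def\<close>)
    have "frag_dvd p (frag_extend (\<lambda>\<tau>. D n \<tau> - frag_extend F' (chain_boundary n (frag_of \<tau>)) - chain_boundary (Suc n) (F \<tau>)) b)"
      by (rule frag_dvd_extend) (use F bB in \<open>auto simp: R_def\<close>)
    moreover have "frag_extend (\<lambda>\<tau>. frag_extend F' (chain_boundary n (frag_of \<tau>))) b = 0"
      using chain_boundary_boundary_alt[of n X "frag_of \<sigma>"] s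
      by (simp add: b_def frag_extend_boundary[symmetric] singular_chain_of)
    ultimately have 1: "frag_dvd p (frag_extend (D n) b - chain_boundary (Suc n) (frag_extend F b))"
      by (simp add: frag_extend_fun_diff chain_boundary_frag_extend)
    \<comment> \<open>By induction the boundary of \<open>frag_extend F b\<close> is congruent to D
      applied to b, and so is the boundary of D at \<sigma>. The difference is a cycle modulo p and
      can be filled.\<close>
    have "frag_dvd p (chain_boundary (Suc n) (D (Suc n) \<sigma> - frag_extend F b))"
      using frag_dvd_add[OF bd[OF n s] 1[unfolded b_def]]
      by (simp add: chain_boundary_diff b_def)
    then obtain d where "singular_chain (Suc (Suc n)) Y d"
      "frag_dvd p (D (Suc n) \<sigma> - frag_extend F b - chain_boundary (Suc (Suc n)) d)"
      using acyc[unfolded mod_acyclic_def, rule_format, of "Suc n" "D (Suc n) \<sigma> - frag_extend F b"]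
        chain[OF n s] Fb singular_chain_diff by blast
    then show "\<exists>y. R (Suc n) F \<sigma> y" by (auto simp: R_def b_def)
  qed (auto simp: B_def simplex_act_closed simplex_act_one simplex_act_mult split: if_splits intro: simplex_act_free)
  then obtain H where H: "\<And>n b g. b \<in> B n \<Longrightarrow> g \<in> carrier G \<Longrightarrow> H n (simplex_map n (\<alpha> g) b) = chain_map (Suc n) (\<beta> g) (H n b)"
     "\<And>b. b \<in> B 0 \<Longrightarrow> R 0 (\<lambda>_. 0) b (H 0 b)" "\<And>n b. b \<in> B (Suc n) \<Longrightarrow> R (Suc n) (H n) b (H (Suc n) b)"
    by blast
  \<comment> \<open>In degree 0 the truncated difference gives H 0 again, which is applied to the
    zero boundary.\<close>
  have "R n (H (n - 1)) b (H n b)" if "b \<in> B n" for n b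
    using H(2,3) that by (cases n) (auto simp: R_def chain_boundary_def)
  then have R': "R n (H (n - 1)) \<sigma> (H n \<sigma>)" if "n \<le> N" "singular_simplex n X \<sigma>" for n \<sigma>
    using that by (simp add: B_def)
  show ?thesis
  proof (intro exI[of _ H] allI impI conjI ballI)
    fix n \<sigma> assume n: "n \<le> N" "singular_simplex n X \<sigma>"
    show "singular_chain (Suc n) Y (H n \<sigma>)"
      "frag_dvd p (D n \<sigma> - frag_extend (H (n - 1)) (chain_boundary n (frag_of \<sigma>)) - chain_boundary (Suc n) (H n \<sigma>))"
      using R'[OF n] unfolding R_def by blast+
    show "H n (simplex_map n (\<alpha> g) \<sigma>) = chain_map (Suc n) (\<beta> g) (H n \<sigma>)" if "g \<in> carrier G" for g
      using H(1) that n by (simp add: B_def)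
  qed
qed

end

section \<open>Equivariant replacement by small simplices\<close>

definition small_simplex :: "'a set set \<Rightarrow> nat \<Rightarrow> ((nat \<Rightarrow> real) \<Rightarrow> 'a) \<Rightarrow> bool"
  where "small_simplex \<C> n \<tau> \<longleftrightarrow> (\<exists>V\<in>\<C>. \<tau> \<in> standard_simplex n \<rightarrow> V)"

definition small_chain :: "'a set set \<Rightarrow> nat \<Rightarrow> 'a chain \<Rightarrow> bool"
  where "small_chain \<C> n c \<longleftrightarrow> Poly_Mapping.keys c \<subseteq> Collect (small_simplex \<C> n)"

lemma small_chain_diff: "small_chain \<C> n a \<Longrightarrow> small_chain \<C> n b \<Longrightarrow> small_chain \<C> n (a - b)"
  unfolding small_chain_def using keys_diff[of a b] by blast

lemma small_chain_extend:
  "(\<And>x. x \<in> Poly_Mapping.keys c \<Longrightarrow> small_chain \<C> n (f x)) \<Longrightarrow> small_chain \<C> n (frag_extend f c)"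
  unfolding small_chain_def using keys_frag_extend[of f c] by blast

text \<open>The chain e is subdivided m times, and the homotopy h between subdivision and identity,
  applied to the boundary of e, is subtracted. The latter is small because h preserves smallness;
  the error is the boundary of - h e.\<close>

lemma small_modification_exists:
  assumes \<C>: "\<And>U. U \<in> \<C> \<Longrightarrow> openin X U" "topspace X \<subseteq> \<Union>\<C>"
    and e: "singular_chain n X e" and small: "small_chain \<C> (n - 1) (chain_boundary n e)"
  shows "\<exists>r d. singular_chain n X r \<and> small_chain \<C> n r \<and> singular_chain (Suc n) X d \<and> e - r = chain_boundary (Suc n) d"
proof -
  obtain m where m: "\<And>f. f \<in> Poly_Mapping.keys ((singular_subdivision n ^^ m) e) \<Longrightarrow> \<exists>V\<in>\<C>. f \<in> standard_simplex n \<rightarrow> V"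
    using sufficient_iterated_singular_subdivision_exists[OF \<C> e] by (metis order_refl)
  obtain h where h0: "\<And>p. h p 0 = (0 :: 'a chain)" and hd: "\<And>p c1 c2. h p (c1 - c2) = h p c1 - h p c2"
    and hc: "\<And>p X c. singular_chain p X c \<Longrightarrow> singular_chain (Suc p) X (h p c)"
    and hh: "\<And>p X c. singular_chain p X c \<Longrightarrow>
        chain_boundary (Suc p) (h p c) + h (p - Suc 0) (chain_boundary p c) = (singular_subdivision p ^^ m) c - c"
    using chain_homotopic_iterated_singular_subdivision[of m] by blast
  \<comment> \<open>The homotopy is available for every space, in particular for the subspace V that
    contains the simplex, so it stays inside V.\<close>
  have hsmall: "small_chain \<C> (Suc k) (h k c)" if "singular_chain k X c" "small_chain \<C> k c" for k c
  proof -
    have "Poly_Mapping.keys c \<subseteq> singular_simplex_set k X \<inter> Collect (small_simplex \<C> k)"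
      using that by (auto simp: singular_chain_def small_chain_def)
    then show ?thesis
    proof (induction c rule: frag_induction)
      case (one \<tau>)
      then obtain V where V: "V \<in> \<C>" "\<tau> \<in> standard_simplex k \<rightarrow> V" "singular_simplex k X \<tau>"
        by (auto simp: small_simplex_def)
      then have "singular_chain k (subtopology X V) (frag_of \<tau>)"
        by (auto simp: singular_chain_of singular_simplex_subtopology)
      from hc[OF this] have "f \<in> standard_simplex (Suc k) \<rightarrow> V" if "f \<in> Poly_Mapping.keys (h k (frag_of \<tau>))" for f
        using that by (fastforce simp: singular_chain_def singular_simplex_subtopology)
      then show ?case using V(1) unfolding small_chain_def small_simplex_def by blast
    qed (auto simp: h0 hd small_chain_diff, simp add: small_chain_def)
  qed
  define s where "s = h (n - 1) (chain_boundary n e)"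
  define d where "d = - h n e"
  have s: "singular_chain n X s \<and> small_chain \<C> n s"
  proof (cases n)
    case 0
    then show ?thesis by (simp add: s_def chain_boundary_def h0 small_chain_def)
  next
    case (Suc k)
    then show ?thesis
      using hc hsmall small singular_chain_boundary[OF e] by (simp add: s_def)
  qed
  have "e - ((singular_subdivision n ^^ m) e - s) = chain_boundary (Suc n) d"
    using hh[OF e] by (simp add: s_def d_def chain_boundary_minus algebra_simps)
  moreover have "singular_chain n X ((singular_subdivision n ^^ m) e)"
    by (induction m) (simp_all add: e singular_chain_singular_subdivision)
  moreover have "small_chain \<C> n ((singular_subdivision n ^^ m) e)"
    using m by (auto simp: small_chain_def small_simplex_def)
  moreover have "singular_chain (Suc n) X d" using hc[OF e] by (simp add: d_def singular_chain_minus)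
  ultimately show ?thesis using s small_chain_diff singular_chain_diff by blast
qed

context covering_action
begin

text \<open>No fixed number of subdivisions makes all singular simplices small. The replacement is
  therefore built simplex by simplex, relative to what was done on the boundary, along with a
  homotopy to the identity.\<close>

lemma equivariant_small_chains:
  assumes \<C>: "\<And>U. U \<in> \<C> \<Longrightarrow> openin X U" "topspace X \<subseteq> \<Union>\<C>"
    and \<C>_act: "\<And>g U. g \<in> carrier G \<Longrightarrow> U \<in> \<C> \<Longrightarrow> \<exists>U'\<in>\<C>. \<alpha> g ` U \<subseteq> U'"
  shows "\<exists>\<rho>. (\<forall>n \<sigma>. singular_simplex n X \<sigma> \<longrightarrow> singular_chain n X (\<rho> n \<sigma>) \<and> small_chain \<C> n (\<rho> n \<sigma>) \<and>
      (\<forall>g\<in>carrier G. \<rho> n (simplex_map n (\<alpha> g) \<sigma>) = chain_map n (\<alpha> g) (\<rho> n \<sigma>))) \<and>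
    (\<forall>n \<sigma>. singular_simplex (Suc n) X \<sigma> \<longrightarrow>
      chain_boundary (Suc n) (\<rho> (Suc n) \<sigma>) = frag_extend (\<rho> n) (chain_boundary (Suc n) (frag_of \<sigma>))) \<and>
    (\<forall>\<sigma>. singular_simplex 0 X \<sigma> \<longrightarrow> frag_eval (\<lambda>_. 1) (\<rho> 0 \<sigma>) = 1)"
proof -
  define B where "B n = singular_simplex_set n X" for n
  \<comment> \<open>A value is a pair: the small replacement and the homotopy joining the simplex to
    it. Only the homotopy of the previous degree enters the condition.\<close>
  define R where "R n F \<sigma> y \<longleftrightarrow> singular_chain n X (fst y) \<and> small_chain \<C> n (fst y) \<and> singular_chain (Suc n) X (snd y) \<and>
     frag_of \<sigma> - frag_extend (snd \<circ> F) (chain_boundary n (frag_of \<sigma>)) - fst y = chain_boundary (Suc n) (snd y)"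
    for n and F :: "((nat \<Rightarrow> real) \<Rightarrow> 'x) \<Rightarrow> 'x chain \<times> 'x chain" and \<sigma> y
  define act where "act n g y = (chain_map n (\<alpha> g) (fst y), chain_map (Suc n) (\<alpha> g) (snd y))" for n g y
  \<comment> \<open>After subtraction of the homotopy on the faces, the simplex has the small
    replacement of its boundary as boundary. This meets the hypothesis of
    \<open>small_modification_exists\<close> and later gives the chain map property.\<close>
  have boundary: "chain_boundary (Suc n) (frag_of \<sigma> - frag_extend (snd \<circ> F) (chain_boundary (Suc n) (frag_of \<sigma>)))
      = frag_extend (fst \<circ> F) (chain_boundary (Suc n) (frag_of \<sigma>))"
    if F: "\<And>\<tau>. \<tau> \<in> B n \<Longrightarrow> R n F' \<tau> (F \<tau>)" and s: "singular_simplex (Suc n) X \<sigma>" for n F F' \<sigma>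
  proof -
    define b where "b = chain_boundary (Suc n) (frag_of \<sigma>)"
    have b: "singular_chain n X b" unfolding b_def by (rule singular_chain_boundary_alt) (simp add: s singular_chain_of)
    have bB: "\<tau> \<in> B n" if "\<tau> \<in> Poly_Mapping.keys b" for \<tau>
      using that b by (auto simp: B_def singular_chain_def)
    have "chain_boundary (Suc n) (frag_extend (snd \<circ> F) b) =
       frag_extend (\<lambda>\<tau>. frag_of \<tau> - frag_extend (snd \<circ> F') (chain_boundary n (frag_of \<tau>)) - fst (F \<tau>)) b"
      unfolding chain_boundary_frag_extend
      by (rule frag_extend_eq) (use F bB in \<open>auto simp: R_def\<close>)
    also have "\<dots> = b - frag_extend (snd \<circ> F') (chain_boundary n b) - frag_extend (fst \<circ> F) b"
      by (simp add: frag_extend_fun_diff frag_extend_id frag_extend_boundary[symmetric] comp_def)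
    also have "chain_boundary n b = 0"
      using chain_boundary_boundary_alt[of n X "frag_of \<sigma>"] s by (simp add: b_def singular_chain_of)
    finally show ?thesis by (simp add: chain_boundary_diff b_def comp_def)
  qed
  have "\<exists>H. (\<forall>n. \<forall>b\<in>B n. \<forall>g\<in>carrier G. H n (simplex_map n (\<alpha> g) b) = act n g (H n b)) \<and>
     (\<forall>b\<in>B 0. R 0 (\<lambda>_. (0, 0)) b (H 0 b)) \<and> (\<forall>n. \<forall>b\<in>B (Suc n). R (Suc n) (H n) b (H (Suc n) b))"
  proof (rule G.equivariant_recursion)
    fix n F and g h b y assume "g \<in> carrier G" "h \<in> carrier G" "b \<in> B n" "R n F b y"
    moreover have "chain_map k (\<alpha> (g \<otimes> h)) c = chain_map k (\<alpha> g) (chain_map k (\<alpha> h) c)"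
      if "singular_chain k X c" for k c
      using that act_mult \<open>g \<in> carrier G\<close> \<open>h \<in> carrier G\<close>
      by (subst chain_map_eq[where g = "\<alpha> g \<circ> \<alpha> h"]) (auto simp: chain_map_compose)
    ultimately show "act n (g \<otimes> h) y = act n g (act n h y)" by (simp add: act_def R_def)
  next
    fix n and F :: "((nat \<Rightarrow> real) \<Rightarrow> 'x) \<Rightarrow> 'x chain \<times> 'x chain" and g \<sigma> y
    assume F: "n = 0 \<or> (\<forall>b\<in>B (n - 1). \<forall>g\<in>carrier G. F (simplex_map (n - 1) (\<alpha> g) b) = act (n - 1) g (F b))"
      and g: "g \<in> carrier G" and \<sigma>: "\<sigma> \<in> B n" and y: "R n F \<sigma> y"
    have s: "singular_simplex n X \<sigma>" using \<sigma> by (simp add: B_def)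
    have sc: "singular_chain n X (frag_of \<sigma>)" using s by (simp add: singular_chain_of)
    have 1: "frag_extend (snd \<circ> F) (chain_boundary n (frag_of (simplex_map n (\<alpha> g) \<sigma>))) =
        chain_map n (\<alpha> g) (frag_extend (snd \<circ> F) (chain_boundary n (frag_of \<sigma>)))"
    proof (cases n)
      case (Suc m)
      have "chain_boundary n (frag_of (simplex_map n (\<alpha> g) \<sigma>)) = chain_map m (\<alpha> g) (chain_boundary n (frag_of \<sigma>))"
        using chain_boundary_chain_map[OF sc, of "\<alpha> g"] Suc by simp
      moreover have "frag_extend (snd \<circ> F) (chain_map m (\<alpha> g) (chain_boundary n (frag_of \<sigma>))) =
         chain_map n (\<alpha> g) (frag_extend (snd \<circ> F) (chain_boundary n (frag_of \<sigma>)))"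
      proof (rule frag_extend_equivariant)
        show "(snd \<circ> F) (simplex_map m (\<alpha> g) \<tau>) = chain_map n (\<alpha> g) ((snd \<circ> F) \<tau>)" if "singular_simplex m X \<tau>" for \<tau>
          using F g that Suc by (auto simp: B_def act_def)
        show "singular_chain m X (chain_boundary n (frag_of \<sigma>))"
          using singular_chain_boundary[OF sc] Suc by simp
      qed (simp_all add: chain_map_diff)
      ultimately show ?thesis by simp
    qed (simp add: chain_boundary_def)
    have 2: "chain_boundary (Suc n) (chain_map (Suc n) (\<alpha> g) (snd y)) = chain_map n (\<alpha> g) (chain_boundary (Suc n) (snd y))"
      using chain_boundary_chain_map[of "Suc n" X "snd y" "\<alpha> g"] y by (simp add: R_def)
    have 3: "frag_of (simplex_map n (\<alpha> g) \<sigma>) - chain_map n (\<alpha> g) (frag_extend (snd \<circ> F) (chain_boundary n (frag_of \<sigma>)))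
        - chain_map n (\<alpha> g) (fst y) = chain_map n (\<alpha> g) (chain_boundary (Suc n) (snd y))"
      using y[unfolded R_def, THEN conjunct2, THEN conjunct2, THEN conjunct2, symmetric] by (simp add: chain_map_diff)
    have 4: "small_chain \<C> n (chain_map n (\<alpha> g) (fst y))"
      unfolding chain_map_def
    proof (rule small_chain_extend)
      fix \<tau> assume "\<tau> \<in> Poly_Mapping.keys (fst y)"
      then obtain V where "V \<in> \<C>" "\<tau> \<in> standard_simplex n \<rightarrow> V"
        using y unfolding R_def small_chain_def small_simplex_def by blast
      then have "simplex_map n (\<alpha> g) \<tau> \<in> standard_simplex n \<rightarrow> \<alpha> g ` V"
        by (auto simp: simplex_map_def)
      moreover obtain U' where "U' \<in> \<C>" "\<alpha> g ` V \<subseteq> U'"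
        using \<C>_act[OF g \<open>V \<in> \<C>\<close>] by blast
      ultimately have "small_simplex \<C> n (simplex_map n (\<alpha> g) \<tau>)"
        unfolding small_simplex_def by (intro bexI[of _ U']) auto
      then show "small_chain \<C> n ((frag_of \<circ> simplex_map n (\<alpha> g)) \<tau>)"
        by (simp add: small_chain_def)
    qed
    show "R n F (simplex_map n (\<alpha> g) \<sigma>) (act n g y)"
      using y 4 singular_chain_chain_map[OF _ continuous_action[OF g]]
      unfolding R_def act_def fst_conv snd_conv 1 2 3 by simp
  next
    fix \<sigma> assume "\<sigma> \<in> B 0"
    then have "singular_chain 0 X (frag_of \<sigma>)" by (simp add: B_def singular_chain_of)
    then show "\<exists>y. R 0 (\<lambda>_. (0, 0)) \<sigma> y"
      using small_modification_exists[OF \<C>, of 0 "frag_of \<sigma>"]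
      by (simp add: R_def chain_boundary_def[of 0] small_chain_def)
  next
    fix n F F' \<sigma> assume F: "\<And>\<tau>. \<tau> \<in> B n \<Longrightarrow> R n F' \<tau> (F \<tau>)" and \<sigma>: "\<sigma> \<in> B (Suc n)"
    have s: "singular_simplex (Suc n) X \<sigma>" using \<sigma> by (simp add: B_def)
    define b where "b = chain_boundary (Suc n) (frag_of \<sigma>)"
    have b: "singular_chain n X b" unfolding b_def by (rule singular_chain_boundary_alt) (simp add: s singular_chain_of)
    have bB: "\<tau> \<in> B n" if "\<tau> \<in> Poly_Mapping.keys b" for \<tau>
      using that b by (auto simp: B_def singular_chain_def)
    have 1: "singular_chain (Suc n) X (frag_of \<sigma> - frag_extend (snd \<circ> F) b)"
      by (intro singular_chain_diff singular_chain_extend) (use F bB s in \<open>auto simp: R_def singular_chain_of\<close>)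
    have 2: "small_chain \<C> n (chain_boundary (Suc n) (frag_of \<sigma> - frag_extend (snd \<circ> F) b))"
    proof -
      have "chain_boundary (Suc n) (frag_of \<sigma> - frag_extend (snd \<circ> F) b) = frag_extend (fst \<circ> F) b"
        unfolding b_def by (rule boundary[of n F' F, OF _ s]) (rule F)
      moreover have "small_chain \<C> n (frag_extend (fst \<circ> F) b)"
        by (rule small_chain_extend) (use F bB in \<open>auto simp: R_def\<close>)
      ultimately show ?thesis by simp
    qed
    show "\<exists>y. R (Suc n) F \<sigma> y"
      using small_modification_exists[OF \<C> 1] 2 by (simp add: R_def b_def)
  qed (auto simp: B_def simplex_act_closed simplex_act_one simplex_act_mult intro: simplex_act_free)
  then obtain H where H: "\<And>n b g. b \<in> B n \<Longrightarrow> g \<in> carrier G \<Longrightarrow> H n (simplex_map n (\<alpha> g) b) = act n g (H n b)"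
     "\<And>b. b \<in> B 0 \<Longrightarrow> R 0 (\<lambda>_. (0, 0)) b (H 0 b)" "\<And>n b. b \<in> B (Suc n) \<Longrightarrow> R (Suc n) (H n) b (H (Suc n) b)"
    by blast
  have HR: "\<exists>F. R n F b (H n b)" if "b \<in> B n" for n b
    using H(2)[of b] H(3)[of b] that by (cases n) blast+
  have RH: "\<exists>F'. \<forall>b\<in>B n. R n F' b (H n b)" for n
    using H(2) H(3)[of _ "n - 1"] by (cases n) fastforce+
  show ?thesis
  proof (intro exI[of _ "\<lambda>n \<sigma>. fst (H n \<sigma>)"] conjI allI impI ballI)
    fix n \<sigma> assume "singular_simplex n X \<sigma>"
    then have \<sigma>: "\<sigma> \<in> B n" by (simp add: B_def)
    show "singular_chain n X (fst (H n \<sigma>))" "small_chain \<C> n (fst (H n \<sigma>))"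
      using HR[OF \<sigma>] by (auto simp: R_def)
    show "fst (H n (simplex_map n (\<alpha> g) \<sigma>)) = chain_map n (\<alpha> g) (fst (H n \<sigma>))" if "g \<in> carrier G" for g
      using H(1)[OF \<sigma> that] by (simp add: act_def)
  next
    fix n \<sigma> assume s: "singular_simplex (Suc n) X \<sigma>"
    let ?H = "H (Suc n) \<sigma>"
    have R: "R (Suc n) (H n) \<sigma> ?H" using H(3) s by (simp add: B_def)
    obtain F' where F': "\<And>b. b \<in> B n \<Longrightarrow> R n F' b (H n b)" using RH by blast
    have "fst ?H = frag_of \<sigma> - frag_extend (snd \<circ> H n) (chain_boundary (Suc n) (frag_of \<sigma>)) - chain_boundary (Suc (Suc n)) (snd ?H)"
      using R by (simp add: R_def algebra_simps)
    moreover have "chain_boundary (Suc n) (chain_boundary (Suc (Suc n)) (snd ?H)) = 0"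
      using R chain_boundary_boundary_alt[of "Suc n" X "snd ?H"] by (simp add: R_def)
    ultimately have "chain_boundary (Suc n) (fst ?H) = frag_extend (fst \<circ> H n) (chain_boundary (Suc n) (frag_of \<sigma>))"
      using boundary[OF F' s] by (simp add: chain_boundary_diff)
    then show "chain_boundary (Suc n) (fst ?H) = frag_extend (\<lambda>\<sigma>. fst (H n \<sigma>)) (chain_boundary (Suc n) (frag_of \<sigma>))"
      by (simp add: comp_def)
  next
    fix \<sigma> assume "singular_simplex 0 X \<sigma>"
    then have "R 0 (\<lambda>_. (0, 0)) \<sigma> (H 0 \<sigma>)" using H(2) by (simp add: B_def)
    \<comment> \<open>In degree 0 a vertex is changed by a boundary only, so the augmentation stays
      1.\<close>
    then have "fst (H 0 \<sigma>) = frag_of \<sigma> - chain_boundary (Suc 0) (snd (H 0 \<sigma>))"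
      by (simp add: R_def chain_boundary_def[of 0] algebra_simps)
    then show "frag_eval (\<lambda>_. 1) (fst (H 0 \<sigma>)) = 1"
      by (simp add: frag_eval_diff frag_eval_boundary_1)
  qed
qed

end

section \<open>Geometric realizations and the Milnor join\<close>

lemma openin_powertop_real: "openin (powertop_real UNIV) U \<longleftrightarrow> open U"
  by (simp add: euclidean_product_topology)

lemma closedin_powertop_real: "closedin (powertop_real UNIV) U \<longleftrightarrow> closed U"
  by (simp add: euclidean_product_topology)

lemma geometric_simplex_support: "x \<in> geometric_simplex \<sigma> \<Longrightarrow> x v \<noteq> 0 \<Longrightarrow> v \<in> \<sigma>"
  unfolding geometric_simplex_def by blast

lemma closed_geometric_simplex:
  assumes "finite \<sigma>"
  shows "closed (geometric_simplex \<sigma>)"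
proof -
  have "closed {x :: 'a \<Rightarrow> real. 0 \<le> x v}" for v
    by (intro closed_Collect_le) auto
  moreover have "closed {x :: 'a \<Rightarrow> real. x v = 0}" for v
    by (intro closed_Collect_eq) auto
  moreover have "closed {x :: 'a \<Rightarrow> real. (\<Sum>v\<in>\<sigma>. x v) = 1}"
    by (intro closed_Collect_eq continuous_intros) auto
  moreover have "geometric_simplex \<sigma> = (\<Inter>v. {x. 0 \<le> x v}) \<inter> (\<Inter>v\<in>-\<sigma>. {x. x v = 0}) \<inter> {x. (\<Sum>v\<in>\<sigma>. x v) = 1}"
    by (auto simp: geometric_simplex_def)
  ultimately show ?thesis by (simp add: closed_INT closed_Int)
qed

lemma geometric_simplex_mono:
  assumes "\<sigma> \<subseteq> \<tau>" "finite \<tau>"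
  shows "geometric_simplex \<sigma> \<subseteq> geometric_simplex \<tau>"
proof
  fix x assume x: "x \<in> geometric_simplex \<sigma>"
  then have "(\<Sum>v\<in>\<tau>. x v) = (\<Sum>v\<in>\<sigma>. x v)"
    using assms by (intro sum.mono_neutral_right) (auto simp: geometric_simplex_def)
  then show "x \<in> geometric_simplex \<tau>" using x assms by (auto simp: geometric_simplex_def)
qed

lemma continuous_map_from_realization:
  assumes f: "\<And>\<sigma>. \<sigma> \<in> K \<Longrightarrow> continuous_map (subtopology (powertop_real UNIV) (geometric_simplex \<sigma>)) Y f"
  shows "continuous_map (geometric_realization K) Y f"
  unfolding continuous_map_def
proof (intro conjI allI impI)
  show "f \<in> topspace (geometric_realization K) \<rightarrow> topspace Y"
    using f by (fastforce simp: topspace_geometric_realization continuous_map_def)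
  fix U assume U: "openin Y U"
  have "{x \<in> topspace (geometric_realization K). f x \<in> U} \<inter> geometric_simplex \<sigma> =
     {x \<in> topspace (subtopology (powertop_real UNIV) (geometric_simplex \<sigma>)). f x \<in> U}" if "\<sigma> \<in> K" for \<sigma>
    using that by (auto simp: topspace_geometric_realization)
  then show "openin (geometric_realization K) {x \<in> topspace (geometric_realization K). f x \<in> U}"
    unfolding openin_geometric_realization
    using openin_continuous_map_preimage[OF f U] by (auto simp: topspace_geometric_realization)
qed

lemma continuous_map_realization_id:
  "continuous_map (geometric_realization K) (powertop_real UNIV) (\<lambda>x. x)"
  by (rule continuous_map_from_realization) (rule continuous_map_from_subtopology[OF continuous_map_id[unfolded id_def]])

lemma continuous_map_realization_coord:
  "continuous_map (geometric_realization K) euclideanreal (\<lambda>x. x v)"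
  using continuous_map_compose[OF continuous_map_realization_id continuous_map_product_projection[of v UNIV "\<lambda>_. euclideanreal"]]
  by (simp add: comp_def)

text \<open>The weak topology may be finer than the product topology, but a closed set meets
  finitely many closed simplices in a set closed in the product topology. Maps into a finite
  subcomplex can thus be checked coordinatewise.\<close>

lemma continuous_map_into_realization:
  assumes f: "continuous_map Z (powertop_real UNIV) f" and K': "finite K'" "K' \<subseteq> K" "\<And>\<sigma>. \<sigma> \<in> K' \<Longrightarrow> finite \<sigma>"
    and fin: "\<And>z. z \<in> topspace Z \<Longrightarrow> f z \<in> (\<Union>\<sigma>\<in>K'. geometric_simplex \<sigma>)"
  shows "continuous_map Z (geometric_realization K) f"
  unfolding continuous_map_closedin
proof (intro conjI allI impI)
  show "f \<in> topspace Z \<rightarrow> topspace (geometric_realization K)"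
    using fin K'(2) by (fastforce simp: topspace_geometric_realization)
  fix C assume C: "closedin (geometric_realization K) C"
  have "closed (C \<inter> geometric_simplex \<sigma>)" if "\<sigma> \<in> K'" for \<sigma>
  proof -
    have \<sigma>: "\<sigma> \<in> K" "finite \<sigma>" using that K' by auto
    have "openin (geometric_realization K) (topspace (geometric_realization K) - C)" using C by (simp add: closedin_def)
    then have "openin (subtopology (powertop_real UNIV) (geometric_simplex \<sigma>))
        ((topspace (geometric_realization K) - C) \<inter> geometric_simplex \<sigma>)"
      unfolding openin_geometric_realization using \<sigma> by blast
    moreover have "(topspace (geometric_realization K) - C) \<inter> geometric_simplex \<sigma> =
        geometric_simplex \<sigma> - C \<inter> geometric_simplex \<sigma>"
      using \<sigma> by (auto simp: topspace_geometric_realization)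
    ultimately have "closedin (subtopology (powertop_real UNIV) (geometric_simplex \<sigma>)) (C \<inter> geometric_simplex \<sigma>)"
      by (simp add: closedin_def)
    then show ?thesis
      using closed_geometric_simplex[OF \<sigma>(2)]
      by (metis closedin_powertop_real closedin_trans_full)
  qed
  then have "closedin (powertop_real UNIV) (\<Union>\<sigma>\<in>K'. C \<inter> geometric_simplex \<sigma>)"
    unfolding closedin_powertop_real using K'(1) by blast
  from closedin_continuous_map_preimage[OF f this]
  show "closedin Z {x \<in> topspace Z. f x \<in> C}"
    by (rule back_subst[of "closedin Z"]) (use fin in blast)
qed

lemma continuous_map_realization_map:
  assumes fin: "\<And>\<sigma>. \<sigma> \<in> K \<Longrightarrow> finite \<sigma>" and f: "\<And>\<sigma>. \<sigma> \<in> K \<Longrightarrow> f ` \<sigma> \<in> L"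
  shows "continuous_map (geometric_realization K) (geometric_realization L) (realization_map K f)"
proof (rule continuous_map_from_realization)
  fix \<sigma> assume \<sigma>: "\<sigma> \<in> K"
  show "continuous_map (subtopology (powertop_real UNIV) (geometric_simplex \<sigma>)) (geometric_realization L) (realization_map K f)"
  proof (rule continuous_map_into_realization[where K' = "{f ` \<sigma>}"])
    have "continuous_map (subtopology (powertop_real UNIV) (geometric_simplex \<sigma>)) (powertop_real UNIV)
         (\<lambda>x w. \<Sum>v | v \<in> \<sigma> \<and> f v = w. x v)"
      unfolding continuous_map_componentwise_UNIV
      using fin[OF \<sigma>] by (intro allI continuous_map_sum continuous_map_from_subtopology)
        (auto intro: continuous_map_product_projection)
    then show "continuous_map (subtopology (powertop_real UNIV) (geometric_simplex \<sigma>)) (powertop_real UNIV) (realization_map K f)"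
      by (rule continuous_map_eq) (simp add: realization_map_on_simplex[OF \<sigma> fin[OF \<sigma>]])
  qed (use realization_map_in_simplex[OF \<sigma> fin[OF \<sigma>]] fin[OF \<sigma>] f[OF \<sigma>] in auto)
qed

section \<open>Linear singular simplices\<close>

definition vertex_point :: "'v \<Rightarrow> 'v \<Rightarrow> real"
  where "vertex_point v w = (if w = v then 1 else 0)"

definition affine_simplex :: "'v list \<Rightarrow> (nat \<Rightarrow> real) \<Rightarrow> 'v \<Rightarrow> real"
  where "affine_simplex w = oriented_simplex (length w - 1) (\<lambda>l. vertex_point (w ! l))"

lemma affine_simplex_in_simplex:
  assumes "w \<noteq> []" "x \<in> standard_simplex (length w - 1)"
  shows "affine_simplex w x \<in> geometric_simplex (set w)"
proof -
  have len: "{..length w - Suc 0} = {..<length w}" using assms(1) by (cases w) (auto simp: lessThan_Suc_atMost)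
  have x: "affine_simplex w x v = (\<Sum>j<length w. vertex_point (w ! j) v * x j)" for v
    using assms(2) by (simp add: affine_simplex_def oriented_simplex_def len)
  have pos: "0 \<le> x j" for j using assms(2) by (auto simp: standard_simplex_def)
  have "(\<Sum>v\<in>set w. affine_simplex w x v) = (\<Sum>j<length w. \<Sum>v\<in>set w. vertex_point (w ! j) v * x j)"
    unfolding x by (rule sum.swap)
  also have "\<dots> = (\<Sum>j<length w. x j)"
    by (rule sum.cong) (simp_all add: vertex_point_def if_distrib[of "\<lambda>u. u * _"] cong: if_cong)
  also have "\<dots> = 1" using assms(2) by (simp add: standard_simplex_def len)
  finally have "(\<Sum>v\<in>set w. affine_simplex w x v) = 1" .
  moreover have "0 \<le> affine_simplex w x v" for v
    unfolding x using pos by (intro sum_nonneg) (simp add: vertex_point_def)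
  moreover have "affine_simplex w x v = 0" if "v \<notin> set w" for v
    unfolding x using that by (intro sum.neutral) (auto simp: vertex_point_def)
  ultimately show ?thesis by (simp add: geometric_simplex_def)
qed

lemma singular_simplex_affine:
  assumes "w \<noteq> []" "set w \<subseteq> \<sigma>" "\<sigma> \<in> K" "finite \<sigma>"
  shows "singular_simplex (length w - 1) (geometric_realization K) (affine_simplex w)"
  unfolding singular_simplex_def
proof
  let ?S = "subtopology (powertop_real UNIV) (standard_simplex (length w - 1))"
  show "continuous_map ?S (geometric_realization K) (affine_simplex w)"
  proof (rule continuous_map_into_realization[where K' = "{\<sigma>}"])
    have "continuous_map ?S (powertop_real UNIV) (\<lambda>x i. \<Sum>j\<le>length w - 1. vertex_point (w ! j) i * x j)"
      unfolding continuous_map_componentwise_UNIV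
      by (force intro: continuous_intros continuous_map_from_subtopology continuous_map_product_projection)
    then show "continuous_map ?S (powertop_real UNIV) (affine_simplex w)"
      by (rule continuous_map_eq) (simp add: affine_simplex_def oriented_simplex_def)
    show "affine_simplex w z \<in> (\<Union>\<sigma>\<in>{\<sigma>}. geometric_simplex \<sigma>)" if "z \<in> topspace ?S" for z
      using affine_simplex_in_simplex[OF assms(1), of z] geometric_simplex_mono[OF assms(2,4)] that by auto
  qed (use assms in auto)
  show "affine_simplex w \<in> extensional (standard_simplex (length w - 1))"
    by (simp add: affine_simplex_def oriented_simplex_def)
qed

lemma singular_face_affine:
  assumes "length w = Suc (Suc n)" "k \<le> Suc n"
  shows "singular_face (Suc n) k (affine_simplex w) = affine_simplex (take k w @ drop (Suc k) w)"
proof -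
  have "singular_face (Suc n) k (affine_simplex w) =
     oriented_simplex n (\<lambda>j. if j < k then vertex_point (w ! j) else vertex_point (w ! Suc j))"
    using assms singular_face_oriented_simplex[of "Suc n" k] by (simp add: affine_simplex_def)
  also have "\<dots> = affine_simplex (take k w @ drop (Suc k) w)"
    using assms by (simp add: affine_simplex_def oriented_simplex_eq nth_append)
  finally show ?thesis .
qed

text \<open>Stated for any family S compatible with faces, as it serves for linear and for graph
  simplices. Words have at least two letters because the singular boundary of a vertex is 0, whereas
  \<open>list_boundary\<close> is augmented.\<close>

lemma chain_boundary_of_lists:
  assumes "\<And>k. k \<le> Suc n \<Longrightarrow> singular_face (Suc n) k (S w) = S (take k w @ drop (Suc k) w)"
    and "length w = Suc (Suc n)"
  shows "chain_boundary (Suc n) (frag_of (S w)) = frag_extend (frag_of \<circ> S) (list_boundary w)"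
proof -
  have "frag_extend (frag_of \<circ> S) (list_boundary w) =
     (\<Sum>k<length w. frag_cmul ((-1) ^ k) (frag_of (S (take k w @ drop (Suc k) w))))"
    unfolding list_boundary_sum by (subst frag_extend_sum) (auto simp: frag_extend_cmul)
  also have "\<dots> = (\<Sum>k\<le>Suc n. frag_cmul ((-1) ^ k) (frag_of (singular_face (Suc n) k (S w))))"
    using assms by (intro sum.cong) auto
  finally show ?thesis by (simp add: chain_boundary_of)
qed

lemma chain_boundary_affine:
  assumes "length w = Suc (Suc n)"
  shows "chain_boundary (Suc n) (frag_of (affine_simplex w)) = frag_extend (frag_of \<circ> affine_simplex) (list_boundary w)"
  by (rule chain_boundary_of_lists[OF singular_face_affine[OF assms] assms])

lemma simplex_map_affine:
  assumes w: "w \<noteq> []" "set w \<subseteq> \<sigma>" "\<sigma> \<in> K" "finite \<sigma>"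
  shows "simplex_map (length w - 1) (realization_map K f) (affine_simplex w) = affine_simplex (map f w)"
proof (rule extensionalityI[of _ "standard_simplex (length w - 1)"])
  fix x assume x: "x \<in> standard_simplex (length w - 1)"
  have len: "{..length w - Suc 0} = {..<length w}" using assms(1) by (cases w) (auto simp: lessThan_Suc_atMost)
  have "affine_simplex w x \<in> geometric_simplex \<sigma>"
    using affine_simplex_in_simplex[OF w(1) x] geometric_simplex_mono[OF w(2,4)] by blast
  then have "realization_map K f (affine_simplex w x) = (\<lambda>u. \<Sum>v | v \<in> \<sigma> \<and> f v = u. affine_simplex w x v)"
    by (rule realization_map_on_simplex[OF w(3,4)])
  also have "\<dots> = affine_simplex (map f w) x"
  proof
    fix u
    have "(\<Sum>v | v \<in> \<sigma> \<and> f v = u. affine_simplex w x v) =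
      (\<Sum>v | v \<in> \<sigma> \<and> f v = u. \<Sum>j<length w. vertex_point (w ! j) v * x j)"
      using x by (simp add: affine_simplex_def oriented_simplex_def len)
    also have "\<dots> = (\<Sum>j<length w. \<Sum>v | v \<in> \<sigma> \<and> f v = u. vertex_point (w ! j) v * x j)"
      by (rule sum.swap)
    also have "\<dots> = (\<Sum>j<length w. vertex_point (f (w ! j)) u * x j)"
    proof (rule sum.cong)
      fix j assume "j \<in> {..<length w}"
      then have "w ! j \<in> \<sigma>" using w(2) by auto
      then show "(\<Sum>v | v \<in> \<sigma> \<and> f v = u. vertex_point (w ! j) v * x j) = vertex_point (f (w ! j)) u * x j"
        using w(4) by (auto simp: vertex_point_def if_distrib[of "\<lambda>u. u * _"] cong: if_cong)
    qed simp
    also have "\<dots> = affine_simplex (map f w) x u"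
      using x by (simp add: affine_simplex_def oriented_simplex_def len)
    finally show "(\<Sum>v | v \<in> \<sigma> \<and> f v = u. affine_simplex w x v) = affine_simplex (map f w) x u" .
  qed
  finally show "simplex_map (length w - 1) (realization_map K f) (affine_simplex w) x = affine_simplex (map f w) x"
    using x by (simp add: simplex_map_def)
qed (simp_all add: simplex_map_def affine_simplex_def oriented_simplex_def)

section \<open>The Milnor join: free action and acyclicity\<close>

lemma finite_EG_complex: "\<sigma> \<in> EG_complex G \<Longrightarrow> finite \<sigma>"
  by (simp add: EG_complex_def)

lemma in_EG:
  "x \<in> topspace (EG G) \<longleftrightarrow> (\<exists>\<sigma>\<in>EG_complex G. x \<in> geometric_simplex \<sigma>)"
  by (auto simp: EG_def topspace_geometric_realization)

lemma (in group) EG_translate_simplex: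
  assumes "g \<in> carrier G" "\<sigma> \<in> EG_complex G"
  shows "(\<lambda>(i, h). (i, g \<otimes> h)) ` \<sigma> \<in> EG_complex G"
proof -
  have "(\<lambda>(i, h). (i, g \<otimes> h)) ` \<sigma> \<subseteq> UNIV \<times> carrier G"
    using assms by (auto simp: EG_complex_def)
  moreover have "inj_on (fst \<circ> (\<lambda>(i, h). (i, g \<otimes> h))) \<sigma>"
    using assms by (simp add: EG_complex_def inj_on_def case_prod_unfold)
  ultimately show ?thesis using assms by (simp add: EG_complex_def inj_on_imageI)
qed

lemma (in group) continuous_map_EG_action:
  "g \<in> carrier G \<Longrightarrow> continuous_map (EG G) (EG G) (EG_action G g)"
  unfolding EG_def EG_action_def
  by (rule continuous_map_realization_map) (auto simp: finite_EG_complex EG_translate_simplex)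

lemma (in group) EG_action_apply:
  assumes g: "g \<in> carrier G" "h \<in> carrier G" and x: "x \<in> topspace (EG G)"
  shows "EG_action G g x (i, h) = x (i, inv g \<otimes> h)"
proof -
  obtain \<sigma> where \<sigma>: "\<sigma> \<in> EG_complex G" "x \<in> geometric_simplex \<sigma>" using x in_EG by blast
  have "{v \<in> \<sigma>. (case v of (i, h) \<Rightarrow> (i, g \<otimes> h)) = (i, h)} = (if (i, inv g \<otimes> h) \<in> \<sigma> then {(i, inv g \<otimes> h)} else {})"
    using g \<sigma>(1) inv_solve_left by (auto simp: EG_complex_def m_assoc[symmetric])
  then show ?thesis
    using \<sigma> by (auto simp: EG_action_def realization_map_on_simplex[OF \<sigma>(1) finite_EG_complex[OF \<sigma>(1)] \<sigma>(2)]
        geometric_simplex_def)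
qed

lemma geometric_simplex_nonzero:
  assumes "x \<in> geometric_simplex \<sigma>"
  shows "\<exists>v\<in>\<sigma>. 0 < x v"
proof (rule ccontr)
  assume "\<not> ?thesis"
  then have "(\<Sum>v\<in>\<sigma>. x v) \<le> 0" by (intro sum_nonpos) force
  then show False using assms by (simp add: geometric_simplex_def)
qed

text \<open>For a vertex v = (i, h) in the support of x take the points with positive coordinate at
  v. If y and its translate by g are both in this set, then y has two vertices (i, h) and (i, inv g
  h), but a simplex has only one vertex with first coordinate i.\<close>

lemma EG_separated:
  fixes G (structure)
  assumes G: "group G" and x: "x \<in> topspace (EG G)"
  shows "\<exists>v. 0 < x v \<and> openin (EG G) {y \<in> topspace (EG G). 0 < y v} \<and>
    (\<forall>g\<in>carrier G. \<forall>y\<in>topspace (EG G). 0 < y v \<longrightarrow> 0 < EG_action G g y v \<longrightarrow> g = \<one>)"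
proof -
  interpret group G by fact
  obtain \<sigma> where \<sigma>: "\<sigma> \<in> EG_complex G" "x \<in> geometric_simplex \<sigma>" using x in_EG by blast
  obtain v where v: "v \<in> \<sigma>" "0 < x v" using geometric_simplex_nonzero[OF \<sigma>(2)] by blast
  obtain i h where ih: "v = (i, h)" by fastforce
  have h: "h \<in> carrier G" using v \<sigma> ih by (auto simp: EG_complex_def)
  have "openin (EG G) {y \<in> topspace (EG G). y v \<in> {0<..}}"
    using continuous_map_realization_coord[of "EG_complex G" v]
    by (intro openin_continuous_map_preimage[of _ euclideanreal]) (auto simp: EG_def)
  moreover have "g = \<one>" if g: "g \<in> carrier G" and y: "y \<in> topspace (EG G)" "0 < y v" "0 < EG_action G g y v" for g y
  proof -
    obtain \<tau> where \<tau>: "\<tau> \<in> EG_complex G" "y \<in> geometric_simplex \<tau>" using y in_EG by blast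
    have "(i, h) \<in> \<tau>" "(i, inv g \<otimes> h) \<in> \<tau>"
      using y EG_action_apply[OF g h y(1), of i] ih by (auto intro: geometric_simplex_support[OF \<tau>(2)])
    moreover have "inj_on fst \<tau>" using \<tau>(1) by (simp add: EG_complex_def)
    ultimately have "h = inv g \<otimes> h" using inj_onD[of fst \<tau> "(i, h)" "(i, inv g \<otimes> h)"] by simp
    then show ?thesis using g h by (metis inv_closed inv_one inv_inv r_cancel_one')
  qed
  ultimately show ?thesis using v by (intro exI[of _ v]) simp
qed

lemma covering_action_EG:
  fixes G (structure)
  assumes G: "group G"
  shows "covering_action G (EG G) (EG_action G)"
proof -
  interpret group G by fact
  interpret E: group_action G "topspace (EG G)" "EG_action G" by (rule group_action_EG[OF G])
  show ?thesis
  proof unfold_locales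
    show "continuous_map (EG G) (EG G) (EG_action G g)" if "g \<in> carrier G" for g
      by (rule continuous_map_EG_action[OF that])
    fix x assume x: "x \<in> topspace (EG G)"
    obtain v where v: "0 < x v" "openin (EG G) {y \<in> topspace (EG G). 0 < y v}"
      "\<forall>g\<in>carrier G. \<forall>y\<in>topspace (EG G). 0 < y v \<longrightarrow> 0 < EG_action G g y v \<longrightarrow> g = \<one>"
      using EG_separated[OF G x] by blast
    show "\<exists>U. openin (EG G) U \<and> x \<in> U \<and> (\<forall>g\<in>carrier G. g \<noteq> \<one> \<longrightarrow> EG_action G g ` U \<inter> U = {})"
    proof (intro exI[of _ "{y \<in> topspace (EG G). 0 < y v}"] conjI ballI impI)
      show "EG_action G g ` {y \<in> topspace (EG G). 0 < y v} \<inter> {y \<in> topspace (EG G). 0 < y v} = {}"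
        if "g \<in> carrier G" "g \<noteq> \<one>" for g
        using v(3) that by blast
    qed (use v(1,2) x in auto)
  qed
qed

lemma EG_bounded:
  assumes K: "compactin (EG G) K"
  shows "\<exists>N. \<forall>x\<in>K. \<forall>i\<ge>N. \<forall>h. x (i, h) = 0"
proof (rule ccontr)
  assume "\<not> ?thesis"
  then have "\<forall>N. \<exists>x\<in>K. \<exists>i\<ge>N. \<exists>h. x (i, h) \<noteq> 0" by blast
  then obtain x where x: "\<And>N. x N \<in> K" "\<And>N. \<exists>i\<ge>N. \<exists>h. x N (i, h) \<noteq> 0" by metis
  txt \<open>A closed simplex contains only finitely many \<open>x k\<close>, so the \<open>U j\<close> are open and exhaust \<open>EG\<close>.\<close>
  define U where "U j = topspace (EG G) - x ` {j..}" for j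
  have bounded: "\<exists>b. \<forall>k. x k \<in> geometric_simplex \<sigma> \<longrightarrow> k \<le> b" if \<sigma>: "\<sigma> \<in> EG_complex G" for \<sigma>
  proof -
    have "k \<le> Max (fst ` \<sigma>)" if k: "x k \<in> geometric_simplex \<sigma>" for k
    proof -
      obtain i h where ih: "k \<le> i" "x k (i, h) \<noteq> 0" using x(2) by blast
      then have "i \<in> fst ` \<sigma>" using k by (force simp: geometric_simplex_def)
      then have "i \<le> Max (fst ` \<sigma>)" using finite_EG_complex[OF \<sigma>] by simp
      then show ?thesis using ih by simp
    qed
    then show ?thesis by blast
  qed
  have "openin (EG G) (U j)" for j
    unfolding EG_def openin_geometric_realization
  proof (intro conjI ballI)
    show "U j \<subseteq> (\<Union>\<sigma>\<in>EG_complex G. geometric_simplex \<sigma>)" using in_EG by (fastforce simp: U_def)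
    fix \<sigma> assume \<sigma>: "\<sigma> \<in> EG_complex G"
    obtain b where b: "\<And>k. x k \<in> geometric_simplex \<sigma> \<Longrightarrow> k \<le> b" using bounded[OF \<sigma>] by blast
    have "x ` {j..} \<inter> geometric_simplex \<sigma> \<subseteq> x ` {..b}" using b by auto
    then have "finite (x ` {j..} \<inter> geometric_simplex \<sigma>)" using finite_subset by blast
    then have "closedin (powertop_real UNIV) (x ` {j..} \<inter> geometric_simplex \<sigma>)"
      by (intro closedin_Hausdorff_finite) (auto simp: Hausdorff_space_product_topology)
    then have "open (- (x ` {j..} \<inter> geometric_simplex \<sigma>))" by (simp only: closedin_powertop_real open_Compl)
    moreover have "U j \<inter> geometric_simplex \<sigma> = - (x ` {j..} \<inter> geometric_simplex \<sigma>) \<inter> geometric_simplex \<sigma>"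
      using \<sigma> in_EG by (auto simp: U_def)
    ultimately show "openin (subtopology (powertop_real UNIV) (geometric_simplex \<sigma>)) (U j \<inter> geometric_simplex \<sigma>)"
      unfolding openin_subtopology openin_powertop_real by blast
  qed
  moreover have "K \<subseteq> \<Union>(range U)"
  proof
    fix y assume "y \<in> K"
    then have y: "y \<in> topspace (EG G)" using K compactin_subset_topspace by blast
    then obtain \<sigma> where \<sigma>: "\<sigma> \<in> EG_complex G" "y \<in> geometric_simplex \<sigma>" using in_EG by blast
    obtain b where b: "\<And>k. x k \<in> geometric_simplex \<sigma> \<Longrightarrow> k \<le> b" using bounded[OF \<sigma>(1)] by blast
    have "y \<in> U (Suc b)" using b \<sigma>(2) y by (fastforce simp: U_def)
    then show "y \<in> \<Union>(range U)" by blast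
  qed
  ultimately obtain \<F> where \<F>: "finite \<F>" "\<F> \<subseteq> range U" "K \<subseteq> \<Union>\<F>"
    using K unfolding compactin_def by (metis (no_types, lifting) imageE)
  then obtain J where J: "finite J" "\<F> = U ` J" using finite_subset_image by metis
  define m where "m = Max (insert 0 J)"
  have "U j \<subseteq> U m" if "j \<in> J" for j using that J(1) by (auto simp: U_def m_def)
  then have "x m \<in> U m" using \<F>(3) J x(1)[of m] by blast
  then show False by (auto simp: U_def)
qed

definition EG_stage :: "('g, 'h) monoid_scheme \<Rightarrow> nat \<Rightarrow> (nat \<times> 'g \<Rightarrow> real) set"
  where "EG_stage G N = {x \<in> topspace (EG G). \<forall>i\<ge>N. \<forall>h. x (i, h) = 0}"

lemma singular_chain_EG_stage:
  assumes c: "singular_chain n (EG G) c"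
  shows "\<exists>N. singular_chain n (subtopology (EG G) (EG_stage G N)) c"
proof -
  have "\<exists>N. \<forall>x\<in>\<sigma> ` standard_simplex n. \<forall>i\<ge>N. \<forall>h. x (i, h) = 0" if "\<sigma> \<in> Poly_Mapping.keys c" for \<sigma>
  proof (rule EG_bounded)
    have "continuous_map (subtopology (powertop_real UNIV) (standard_simplex n)) (EG G) \<sigma>"
      using c that by (auto simp: singular_chain_def singular_simplex_def)
    moreover have "compactin (subtopology (powertop_real UNIV) (standard_simplex n)) (standard_simplex n)"
      by (simp add: compactin_subtopology compactin_standard_simplex)
    ultimately show "compactin (EG G) (\<sigma> ` standard_simplex n)" by (rule image_compactin[rotated])
  qed
  then obtain N where N: "\<And>\<sigma> x i h. \<sigma> \<in> Poly_Mapping.keys c \<Longrightarrow> x \<in> \<sigma> ` standard_simplex n \<Longrightarrow> N \<sigma> \<le> i \<Longrightarrow> x (i, h) = 0"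
    by metis
  define M where "M = Max (insert 0 (N ` Poly_Mapping.keys c))"
  have M: "N \<sigma> \<le> M" if "\<sigma> \<in> Poly_Mapping.keys c" for \<sigma>
    using that by (simp add: M_def)
  have "\<sigma> ` standard_simplex n \<subseteq> EG_stage G M" if \<sigma>: "\<sigma> \<in> Poly_Mapping.keys c" for \<sigma>
  proof
    fix x assume x: "x \<in> \<sigma> ` standard_simplex n"
    have "singular_simplex n (EG G) \<sigma>" using c \<sigma> by (auto simp: singular_chain_def)
    then have "x \<in> topspace (EG G)" using x by (auto simp: singular_simplex_def continuous_map_def)
    then show "x \<in> EG_stage G M" using N[OF \<sigma> x] M[OF \<sigma>] by (auto simp: EG_stage_def)
  qed
  then show ?thesis
    using c by (intro exI[of _ M]) (auto simp: singular_chain_def singular_simplex_subtopology)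
qed

lemma homotopic_EG_stage:
  assumes G: "group G" "finite (carrier G)"
  shows "homotopic_with (\<lambda>_. True) (subtopology (EG G) (EG_stage G N)) (EG G) id (\<lambda>_. vertex_point (N, \<one>\<^bsub>G\<^esub>))"
proof -
  interpret group G by fact
  let ?v = "(N, \<one>\<^bsub>G\<^esub>)" and ?S = "subtopology (EG G) (EG_stage G N)"
  define K where "K = {\<sigma> \<in> EG_complex G. \<sigma> \<subseteq> {..N} \<times> carrier G}"
  define h where "h = (\<lambda>(t, x) v. (1 - t) * x v + t * vertex_point ?v v)"
  have "K \<subseteq> Pow ({..N} \<times> carrier G)" by (auto simp: K_def)
  then have K: "finite K" by (rule finite_subset) (simp add: G(2))
  have hK: "h (t, x) \<in> (\<Union>\<sigma>\<in>K. geometric_simplex \<sigma>)" if t: "0 \<le> t" "t \<le> 1" and x: "x \<in> EG_stage G N" for t x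
  proof -
    obtain \<sigma> where \<sigma>: "\<sigma> \<in> EG_complex G" "x \<in> geometric_simplex \<sigma>" using x unfolding EG_stage_def in_EG by blast
    define \<tau> where "\<tau> = \<sigma> \<inter> ({..<N} \<times> carrier G)"
    have fin: "finite \<tau>" using finite_EG_complex[OF \<sigma>(1)] by (simp add: \<tau>_def)
    have nt: "?v \<notin> \<tau>" by (simp add: \<tau>_def)
    have zero: "x v = 0" if "v \<notin> \<tau>" for v
    proof (cases "v \<in> \<sigma>")
      case True
      then have "fst v \<ge> N" using that \<sigma>(1) by (cases v) (auto simp: \<tau>_def EG_complex_def)
      then show ?thesis using x by (cases v) (auto simp: EG_stage_def)
    qed (use geometric_simplex_support[OF \<sigma>(2)] in blast)
    have "(\<Sum>v\<in>\<tau>. x v) = (\<Sum>v\<in>\<sigma>. x v)"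
      using zero finite_EG_complex[OF \<sigma>(1)] by (intro sum.mono_neutral_left) (auto simp: \<tau>_def)
    then have sum1: "(\<Sum>v\<in>\<tau>. x v) = 1" using \<sigma>(2) by (simp add: geometric_simplex_def)
    have "insert ?v \<tau> \<in> K"
      using \<sigma>(1) by (auto simp: K_def EG_complex_def \<tau>_def inj_on_def)
    moreover have "h (t, x) \<in> geometric_simplex (insert ?v \<tau>)"
    proof -
      have "(\<Sum>v\<in>insert ?v \<tau>. h (t, x) v) = t + (\<Sum>v\<in>\<tau>. (1 - t) * x v)"
        using fin nt zero[OF nt] by (simp add: h_def vertex_point_def) (rule sum.cong, auto)
      then have "(\<Sum>v\<in>insert ?v \<tau>. h (t, x) v) = 1"
        using sum1 by (simp add: sum_distrib_left[symmetric])
      moreover have "0 \<le> h (t, x) v" for v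
      proof -
        have "0 \<le> x v" using \<sigma>(2) unfolding geometric_simplex_def by blast
        then show ?thesis using t by (simp add: h_def vertex_point_def)
      qed
      moreover have "h (t, x) v = 0" if "v \<notin> insert ?v \<tau>" for v
        using that zero by (simp add: h_def vertex_point_def)
      ultimately show ?thesis by (simp add: geometric_simplex_def)
    qed
    ultimately show ?thesis by blast
  qed
  have "continuous_map (prod_topology (top_of_set {0..1::real}) ?S) (EG G) h"
    unfolding EG_def
  proof (rule continuous_map_into_realization[where K' = K])
    let ?P = "prod_topology (top_of_set {0..1::real}) (subtopology (geometric_realization (EG_complex G)) (EG_stage G N))"
    have t: "continuous_map ?P euclideanreal fst"
      by (metis continuous_map_fst continuous_map_into_fulltopology)
    have x: "continuous_map ?P euclideanreal (\<lambda>z. snd z v)" for v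
      using continuous_map_compose[OF continuous_map_snd continuous_map_from_subtopology[OF continuous_map_realization_coord[of _ v]]]
      by (simp add: comp_def)
    have "continuous_map ?P euclideanreal (\<lambda>z. (1 - fst z) * snd z v + fst z * vertex_point ?v v)" for v
      by (intro continuous_map_add continuous_map_real_mult continuous_map_diff t x) auto
    then show "continuous_map ?P (powertop_real UNIV) h"
      unfolding continuous_map_componentwise_UNIV by (simp add: h_def case_prod_unfold)
    show "h z \<in> (\<Union>\<sigma>\<in>K. geometric_simplex \<sigma>)" if "z \<in> topspace ?P" for z
      using that hK[of "fst z" "snd z"] by (auto simp: EG_def)
  qed (use K finite_EG_complex in \<open>auto simp: K_def\<close>)
  then show ?thesis
    unfolding homotopic_with_def by (intro exI[of _ h]) (auto simp: h_def)
qed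

lemma chain_map_const:
  "chain_map n (\<lambda>_. a) c = frag_cmul (frag_eval (\<lambda>_. 1) c) (frag_of (restrict (\<lambda>_. a) (standard_simplex n)))"
proof -
  have s: "simplex_map n (\<lambda>_. a) \<sigma> = restrict (\<lambda>_. a) (standard_simplex n)" for \<sigma> :: "(nat \<Rightarrow> real) \<Rightarrow> 'b"
    by (auto simp: simplex_map_def)
  show ?thesis
    by (induction c rule: frag_induction[OF subset_UNIV])
      (simp_all add: s chain_map_diff frag_eval_diff frag_cmul_diff_distrib restrict_def)
qed

text \<open>A chain has compact support and so lies in a stage, whose inclusion is homotopic to a
  constant. The constant image bounds: in degree 0 by its zero augmentation, in higher degrees as a
  cycle in a one-point space.\<close>

lemma EG_acyclic:
  assumes G: "group G" "finite (carrier G)" and c: "singular_chain n (EG G) c"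
    and z: "chain_boundary n c = 0" "n = 0 \<Longrightarrow> frag_eval (\<lambda>_. 1) c = 0"
  shows "\<exists>d. singular_chain (Suc n) (EG G) d \<and> chain_boundary (Suc n) d = c"
proof -
  interpret group G by fact
  obtain N where N: "singular_chain n (subtopology (EG G) (EG_stage G N)) c"
    using singular_chain_EG_stage[OF c] by blast
  define a where "a = vertex_point (N, \<one>\<^bsub>G\<^esub>)"
  have a: "a \<in> topspace (EG G)"
  proof -
    have "{(N, \<one>\<^bsub>G\<^esub>)} \<in> EG_complex G" by (simp add: EG_complex_def)
    moreover have "a \<in> geometric_simplex {(N, \<one>\<^bsub>G\<^esub>)}" by (auto simp: a_def vertex_point_def geometric_simplex_def)
    ultimately show ?thesis using in_EG by blast
  qed
  have "homologous_rel n (EG G) {} (chain_map n id c) (chain_map n (\<lambda>_. a) c)"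
  proof (rule homotopic_imp_homologous_rel_chain_maps)
    show "homotopic_with (\<lambda>h. h \<in> {} \<rightarrow> {}) (subtopology (EG G) (EG_stage G N)) (EG G) id (\<lambda>_. a)"
      using homotopic_EG_stage[OF G] by (simp add: a_def)
    show "singular_relcycle n (subtopology (EG G) (EG_stage G N)) {} c"
      using N z by (simp add: singular_cycle)
  qed
  then have "singular_relboundary n (EG G) {} (c - chain_map n (\<lambda>_. a) c)"
    using chain_map_ident[OF c] by (simp add: homologous_rel_def)
  moreover have "singular_relboundary n (EG G) {} (chain_map n (\<lambda>_. a) c)"
  proof (cases "n = 0")
    case True
    then show ?thesis using z(2) by (simp add: chain_map_const)
  next
    case False
    let ?A = "subtopology (EG G) {a}"
    have "continuous_map (EG G) ?A (\<lambda>_. a)" using a by (simp add: continuous_map_in_subtopology)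
    then have "singular_chain n ?A (chain_map n (\<lambda>_. a) c)" by (rule singular_chain_chain_map[OF c])
    moreover have "chain_boundary n (chain_map n (\<lambda>_. a) c) = 0"
      using chain_boundary_chain_map[OF c, of "\<lambda>_. a"] z(1) by simp
    ultimately have "singular_relcycle n ?A {} (chain_map n (\<lambda>_. a) c)" by (simp add: singular_cycle)
    then have "singular_relboundary n ?A {} (chain_map n (\<lambda>_. a) c)"
      using singular_boundary_eq_cycle_singleton[of ?A a n] a False by auto
    then obtain d where "singular_chain (Suc n) ?A d" "chain_boundary (Suc n) d = chain_map n (\<lambda>_. a) c"
      by (auto simp: singular_boundary)
    then show ?thesis by (auto simp: singular_boundary singular_chain_subtopology)
  qed
  ultimately have "singular_relboundary n (EG G) {} (c - chain_map n (\<lambda>_. a) c + chain_map n (\<lambda>_. a) c)"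
    by (rule singular_relboundary_add)
  then show ?thesis by (simp add: singular_boundary)
qed

text \<open>If the boundary of c is p e, then e is a cycle, since chains have no torsion, and bounds
  some e'. Then c - p e' is an integral cycle and can be filled. In degree 0 a multiple of a vertex
  plays e', to make the augmentation vanish.\<close>

lemma mod_acyclic_EG:
  assumes G: "group G" "finite (carrier G)" and p: "0 < p"
  shows "mod_acyclic p (EG G)"
  unfolding mod_acyclic_def
proof (intro allI impI, elim conjE)
  fix n c assume c: "singular_chain n (EG G) c" "frag_dvd p (chain_boundary n c)"
    and aug: "n = 0 \<longrightarrow> int p dvd frag_eval (\<lambda>_. 1) c"
  obtain e where e: "chain_boundary n c = frag_cmul (int p) e" using c(2) by (auto simp: frag_dvd_def)
  have "\<exists>e'. singular_chain n (EG G) e' \<and> chain_boundary n e' = e \<and> (n = 0 \<longrightarrow> int p * frag_eval (\<lambda>_. 1) e' = frag_eval (\<lambda>_. 1) c)"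
  proof (cases n)
    case 0
    interpret group G by fact
    have "{(0::nat, \<one>\<^bsub>G\<^esub>)} \<in> EG_complex G" by (simp add: EG_complex_def)
    then have "singular_simplex 0 (EG G) (affine_simplex [(0, \<one>\<^bsub>G\<^esub>)])"
      using singular_simplex_affine[of "[(0::nat, \<one>\<^bsub>G\<^esub>)]" "{(0::nat, \<one>\<^bsub>G\<^esub>)}" "EG_complex G"] by (simp add: EG_def)
    moreover obtain k where "frag_eval (\<lambda>_. 1) c = int p * k" using aug 0 by (auto elim: dvdE)
    moreover have "e = 0" using e 0 p by (simp add: chain_boundary_def)
    ultimately show ?thesis
      using 0 by (intro exI[of _ "frag_cmul k (frag_of (affine_simplex [(0, \<one>\<^bsub>G\<^esub>)]))"])
        (auto simp: singular_chain_cmul singular_chain_of frag_eval_cmul chain_boundary_def[of 0])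
  next
    case (Suc m)
    have ec: "singular_chain m (EG G) e"
      using singular_chain_boundary[OF c(1)] Suc p unfolding e by (auto simp: singular_chain_def)
    have "chain_boundary m (chain_boundary (Suc m) c) = 0"
      using chain_boundary_boundary_alt c(1) Suc by blast
    then have "chain_boundary m e = 0" using e Suc p by (simp add: chain_boundary_cmul)
    moreover have "frag_eval (\<lambda>_. 1) e = 0" if "m = 0"
      using frag_eval_boundary_1[of c] e Suc that p by (simp add: frag_eval_cmul)
    ultimately show ?thesis using EG_acyclic[OF G ec] Suc by auto
  qed
  then obtain e' where e': "singular_chain n (EG G) e'" "chain_boundary n e' = e"
    "n = 0 \<longrightarrow> int p * frag_eval (\<lambda>_. 1) e' = frag_eval (\<lambda>_. 1) c" by blast
  have "\<exists>d. singular_chain (Suc n) (EG G) d \<and> chain_boundary (Suc n) d = c - frag_cmul (int p) e'"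
    by (rule EG_acyclic[OF G]) (use e' c e in \<open>auto simp: singular_chain_diff singular_chain_cmul chain_boundary_diff
        chain_boundary_cmul frag_eval_diff frag_eval_cmul\<close>)
  then obtain d where d: "singular_chain (Suc n) (EG G) d" "chain_boundary (Suc n) d = c - frag_cmul (int p) e'"
    by blast
  have "frag_dvd p (c - chain_boundary (Suc n) d)" unfolding d(2) frag_dvd_def by (intro exI[of _ e']) simp
  then show "\<exists>d. singular_chain (Suc n) (EG G) d \<and> frag_dvd p (c - chain_boundary (Suc n) d)"
    using d(1) by blast
qed

section \<open>The chessboard complex\<close>

definition rotation :: "nat \<Rightarrow> nat \<Rightarrow> nat"
  where "rotation p = cycle_of_list [1..<Suc p]"

lemma mult_cyclic_perm_group [simp]: "g \<otimes>\<^bsub>cyclic_perm_group p\<^esub> h = g \<circ> h"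
  by (simp add: cyclic_perm_group_def sym_group_def)

lemma one_cyclic_perm_group [simp]: "\<one>\<^bsub>cyclic_perm_group p\<^esub> = id"
  by (simp add: cyclic_perm_group_def sym_group_def)

lemma rotation_closed: "rotation p \<in> carrier (cyclic_perm_group p)"
proof -
  have "rotation p permutes set [1..<Suc p]" unfolding rotation_def by (rule cycle_permutes)
  moreover have "set [1..<Suc p] = {1..p}" by auto
  ultimately have "rotation p permutes {1..p}" by (simp only:)
  then have "rotation p \<in> carrier (sym_group p)" by (simp only: sym_group_carrier)
  then show ?thesis
    unfolding cyclic_perm_group_def carrier_subgroup_generated rotation_def[symmetric]
    by (intro generate.incl) simp
qed

lemma rotation_power_closed: "(rotation p ^^ n) \<in> carrier (cyclic_perm_group p)"
proof (induction n)
  case 0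
  show ?case using group.is_monoid[OF group_cyclic_perm_group, THEN monoid.one_closed, of p] by (simp add: id_def)
next
  case (Suc n)
  have "rotation p \<otimes>\<^bsub>cyclic_perm_group p\<^esub> (rotation p ^^ n) \<in> carrier (cyclic_perm_group p)"
    by (intro monoid.m_closed group.is_monoid group_cyclic_perm_group rotation_closed Suc)
  then show ?case by (simp only: mult_cyclic_perm_group funpow.simps)
qed

lemma rotation_power_one:
  assumes "n < p"
  shows "(rotation p ^^ n) 1 = Suc n"
proof -
  have "map (rotation p ^^ n) [1..<Suc p] = rotate n [1..<Suc p]"
    unfolding rotation_def by (rule cyclic_rotation) simp
  then have "map (rotation p ^^ n) [1..<Suc p] ! 0 = rotate n [1..<Suc p] ! 0" by simp
  then show ?thesis using assms by (simp add: nth_rotate del: upt_Suc)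
qed

lemma cyclic_perm_group_commute:
  assumes "g \<in> carrier (cyclic_perm_group p)"
  shows "g \<circ> rotation p = rotation p \<circ> g"
proof -
  interpret group "cyclic_perm_group p" by (rule group_cyclic_perm_group)
  interpret S: group "sym_group p" by (rule sym_group_is_group)
  have rot: "rotation p \<in> carrier (sym_group p)"
    using rotation_closed S.carrier_subgroup_generated_subset unfolding cyclic_perm_group_def by blast
  have "g \<in> generate (sym_group p) {rotation p}"
    using assms rot unfolding cyclic_perm_group_def carrier_subgroup_generated rotation_def[symmetric] by simp
  then show ?thesis
  proof (induction rule: generate.induct)
    case (inv h)
    then show ?case
      using S.l_inv[OF rot] S.r_inv[OF rot] by (simp add: sym_group_def)
  next
    case (eng g h)
    have "(g \<circ> h) \<circ> rotation p = g \<circ> (h \<circ> rotation p)" by (rule comp_assoc)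
    also have "\<dots> = (g \<circ> rotation p) \<circ> h" unfolding eng.IH(2) by (rule comp_assoc[symmetric])
    also have "\<dots> = rotation p \<circ> (g \<circ> h)" unfolding eng.IH(1) by (rule comp_assoc)
    finally show ?case by (simp only: sym_group_def monoid.simps)
  qed (auto simp: sym_group_def)
qed

text \<open>The cyclic group acts simply transitively on the columns: an element commutes with the
  rotation, so its value at 1 fixes it. This identifies columns with group elements.\<close>

lemma evaluation_bij_betw:
  assumes "0 < p"
  shows "bij_betw (\<lambda>g. g 1) (carrier (cyclic_perm_group p)) {1..p}"
  unfolding bij_betw_def
proof
  have pow: "g ((rotation p ^^ n) x) = (rotation p ^^ n) (g x)" if "g \<in> carrier (cyclic_perm_group p)" for g n x
  proof -
    have "g (rotation p y) = rotation p (g y)" for y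
      using fun_cong[OF cyclic_perm_group_commute[OF that], of y] by (simp only: comp_apply)
    then show ?thesis by (induction n) (simp_all only: funpow.simps comp_apply id_apply)
  qed
  show "inj_on (\<lambda>g. g 1) (carrier (cyclic_perm_group p))"
  proof (rule inj_onI, rule ext)
    fix g h j assume gh: "g \<in> carrier (cyclic_perm_group p)" "h \<in> carrier (cyclic_perm_group p)" "g 1 = h 1"
    show "g j = h j"
    proof (cases "j \<in> {1..p}")
      case True
      then have "j - 1 < p" "Suc (j - 1) = j" by auto
      then have "j = (rotation p ^^ (j - 1)) 1" using rotation_power_one[of "j - 1" p] by simp
      then show ?thesis using pow[OF gh(1), of "j - 1" 1] pow[OF gh(2), of "j - 1" 1] gh(3) by simp
    next
      case False
      show ?thesis
        unfolding permutes_not_in[OF cyclic_perm_group_permutes[OF gh(1)] False]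
          permutes_not_in[OF cyclic_perm_group_permutes[OF gh(2)] False] ..
    qed
  qed
  show "(\<lambda>g. g 1) ` carrier (cyclic_perm_group p) = {1..p}"
  proof (intro equalityI subsetI)
    fix j assume "j \<in> {1..p}"
    then have "j - 1 < p" "Suc (j - 1) = j" by auto
    then show "j \<in> (\<lambda>g. g 1) ` carrier (cyclic_perm_group p)"
      using rotation_power_one[of "j - 1" p] rotation_power_closed by (intro image_eqI[of _ _ "rotation p ^^ (j - 1)"]) auto
  qed (use assms cyclic_perm_group_permutes permutes_in_image in fastforce)
qed

section \<open>Words of labels of singular simplices\<close>

text \<open>The labelling \<gamma> need not be continuous, as only the vertices of \<sigma> are
  read. Any equivariant labelling thus yields an equivariant map from singular chains to chains of
  words.\<close>

definition simplex_letters :: "('a \<Rightarrow> 'v) \<Rightarrow> nat \<Rightarrow> ((nat \<Rightarrow> real) \<Rightarrow> 'a) \<Rightarrow> 'v list"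
  where "simplex_letters \<gamma> n \<sigma> = map (\<lambda>l. \<gamma> (\<sigma> (vertex_point l))) [0..<Suc n]"

lemma vertex_point_in_standard_simplex: "l \<le> n \<Longrightarrow> vertex_point l \<in> standard_simplex n"
  using basis_in_standard_simplex[of l n] by (simp add: vertex_point_def[abs_def])

lemma length_simplex_letters [simp]: "length (simplex_letters \<gamma> n \<sigma>) = Suc n"
  by (simp add: simplex_letters_def)

lemma simplex_letters_face:
  assumes "k \<le> Suc n"
  shows "simplex_letters \<gamma> n (singular_face (Suc n) k \<sigma>) =
    take k (simplex_letters \<gamma> (Suc n) \<sigma>) @ drop (Suc k) (simplex_letters \<gamma> (Suc n) \<sigma>)"
proof (rule nth_equalityI)
  fix l assume "l < length (simplex_letters \<gamma> n (singular_face (Suc n) k \<sigma>))"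
  then have l: "l \<le> n" by simp
  have "simplical_face k (vertex_point l) = vertex_point (if l < k then l else Suc l)"
    by (auto simp: simplical_face_def vertex_point_def fun_eq_iff)
  then show "simplex_letters \<gamma> n (singular_face (Suc n) k \<sigma>) ! l =
     (take k (simplex_letters \<gamma> (Suc n) \<sigma>) @ drop (Suc k) (simplex_letters \<gamma> (Suc n) \<sigma>)) ! l"
    using l assms vertex_point_in_standard_simplex[OF l]
    by (auto simp: simplex_letters_def singular_face_def nth_append simp del: upt_Suc)
qed (use assms in simp)

lemma list_boundary_simplex_letters:
  "list_boundary (simplex_letters \<gamma> (Suc n) \<sigma>) =
    frag_extend (frag_of \<circ> simplex_letters \<gamma> n) (chain_boundary (Suc n) (frag_of \<sigma>))"
proof -
  have "frag_extend (frag_of \<circ> simplex_letters \<gamma> n) (chain_boundary (Suc n) (frag_of \<sigma>)) =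
     (\<Sum>k\<le>Suc n. frag_cmul ((-1) ^ k) (frag_of (simplex_letters \<gamma> n (singular_face (Suc n) k \<sigma>))))"
    by (simp only: chain_boundary_of nat.distinct if_False frag_extend_sum finite_atMost)
      (simp add: frag_extend_cmul)
  also have "\<dots> = list_boundary (simplex_letters \<gamma> (Suc n) \<sigma>)"
    unfolding list_boundary_sum using simplex_letters_face[of _ n \<gamma> \<sigma>]
    by (intro sum.cong) (auto simp del: sum.atMost_Suc)
  finally show ?thesis by simp
qed

lemma simplex_letters_map:
  assumes "\<And>l. l \<le> n \<Longrightarrow> \<gamma> (f (\<sigma> (vertex_point l))) = a (\<gamma> (\<sigma> (vertex_point l)))"
  shows "simplex_letters \<gamma> n (simplex_map n f \<sigma>) = map a (simplex_letters \<gamma> n \<sigma>)"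
  using assms vertex_point_in_standard_simplex
  by (auto simp: simplex_letters_def simplex_map_def simp del: upt_Suc)

lemma set_simplex_letters:
  assumes "singular_simplex n X \<sigma>" "\<And>x. x \<in> topspace X \<Longrightarrow> \<gamma> x \<in> V"
  shows "set (simplex_letters \<gamma> n \<sigma>) \<subseteq> V"
proof -
  have "\<sigma> (vertex_point l) \<in> topspace X" if "l \<le> n" for l
    using assms(1) vertex_point_in_standard_simplex[OF that] by (auto simp: singular_simplex_def continuous_map_def)
  then show ?thesis using assms(2) by (auto simp: simplex_letters_def simp del: upt_Suc)
qed

text \<open>Separating neighbourhoods come from the factor EG; nothing about fixed points in X has
  to be known.\<close>

lemma covering_action_borel:
  assumes G: "group G" and \<alpha>: "group_action G (topspace X) \<alpha>"
    and cont: "\<And>g. g \<in> carrier G \<Longrightarrow> continuous_map X X (\<alpha> g)"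
  shows "covering_action G (prod_topology (EG G) X) (diagonal_action G X \<alpha>)"
proof -
  interpret group G by fact
  interpret group_action G "topspace (prod_topology (EG G) X)" "diagonal_action G X \<alpha>"
    by (rule group_action_diagonal[OF G \<alpha>])
  show ?thesis
  proof unfold_locales
    fix g assume g: "g \<in> carrier G"
    have "continuous_map (prod_topology (EG G) X) (prod_topology (EG G) X) (\<lambda>z. (EG_action G g (fst z), \<alpha> g (snd z)))"
      using continuous_map_compose[OF continuous_map_fst continuous_map_EG_action[OF g]]
        continuous_map_compose[OF continuous_map_snd cont[OF g]]
      by (intro continuous_map_pairedI) (simp_all add: comp_def)
    then show "continuous_map (prod_topology (EG G) X) (prod_topology (EG G) X) (diagonal_action G X \<alpha> g)"
      by (rule continuous_map_eq) (auto simp: diagonal_action_def)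
  next
    fix z assume z: "z \<in> topspace (prod_topology (EG G) X)"
    then have e: "fst z \<in> topspace (EG G)" by auto
    obtain v where v: "0 < fst z v" "openin (EG G) {y \<in> topspace (EG G). 0 < y v}"
      "\<forall>g\<in>carrier G. \<forall>y\<in>topspace (EG G). 0 < y v \<longrightarrow> 0 < EG_action G g y v \<longrightarrow> g = \<one>\<^bsub>G\<^esub>"
      using EG_separated[OF G e] by blast
    define U where "U = {z \<in> topspace (prod_topology (EG G) X). fst z \<in> {y \<in> topspace (EG G). 0 < y v}}"
    have "openin (prod_topology (EG G) X) U"
      unfolding U_def by (rule openin_continuous_map_preimage[OF continuous_map_fst v(2)])
    moreover have "z \<in> U" using z v(1) e by (simp add: U_def)
    moreover have "diagonal_action G X \<alpha> g ` U \<inter> U = {}" if "g \<in> carrier G" "g \<noteq> \<one>\<^bsub>G\<^esub>" for g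
    proof -
      have "g = \<one>\<^bsub>G\<^esub>" if y: "y \<in> U" "diagonal_action G X \<alpha> g y \<in> U" for y
      proof -
        have "fst y \<in> topspace (EG G)" "0 < fst y v" "0 < EG_action G g (fst y) v"
          using y by (auto simp: U_def diagonal_action_def)
        then show ?thesis using v(3) \<open>g \<in> carrier G\<close> by blast
      qed
      then show ?thesis using that(2) by blast
    qed
    ultimately show "\<exists>U. openin (prod_topology (EG G) X) U \<and> z \<in> U \<and>
        (\<forall>g\<in>carrier G. g \<noteq> \<one>\<^bsub>G\<^esub> \<longrightarrow> diagonal_action G X \<alpha> g ` U \<inter> U = {})"
      by blast
  qed
qed

section \<open>Points of the chessboard complex\<close>

lemma finite_chessboard_complex: "\<sigma> \<in> chessboard_complex k p \<Longrightarrow> finite \<sigma>"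
  using finite_subset[of \<sigma> "{1..k} \<times> {1..p}"] by (auto simp: chessboard_complex_def)

lemma chessboard_translate_simplex:
  assumes "g permutes {1..p}" "\<sigma> \<in> chessboard_complex k p"
  shows "(\<lambda>(i, j). (i, g j)) ` \<sigma> \<in> chessboard_complex k p"
proof -
  have "(\<lambda>(i, j). (i, g j)) ` \<sigma> \<subseteq> {1..k} \<times> {1..p}"
    using assms permutes_in_image[OF assms(1)] unfolding chessboard_complex_def by fastforce
  moreover have "inj_on (fst \<circ> (\<lambda>(i, j). (i, g j))) \<sigma>" "inj_on (snd \<circ> (\<lambda>(i, j). (i, g j))) \<sigma>"
    using assms(2) inj_eq[OF permutes_inj[OF assms(1)]]
    by (auto simp: chessboard_complex_def inj_on_def case_prod_unfold)
  ultimately show ?thesis by (simp add: chessboard_complex_def inj_on_imageI)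
qed

lemma continuous_map_chessboard_action:
  assumes "g \<in> carrier (cyclic_perm_group p)"
  shows "continuous_map (chessboard_space k p) (chessboard_space k p) (chessboard_action k p g)"
  unfolding chessboard_space_def chessboard_action_def
  by (rule continuous_map_realization_map)
    (use finite_chessboard_complex chessboard_translate_simplex[OF cyclic_perm_group_permutes[OF assms]] in auto)

lemma chessboard_action_apply:
  assumes g: "g \<in> carrier (cyclic_perm_group p)" and x: "x \<in> topspace (chessboard_space k p)"
  shows "chessboard_action k p g x (i, g j) = x (i, j)"
proof -
  obtain \<sigma> where \<sigma>: "\<sigma> \<in> chessboard_complex k p" "x \<in> geometric_simplex \<sigma>"
    using x by (auto simp: chessboard_space_def topspace_geometric_realization)
  have "{v \<in> \<sigma>. (case v of (i, j) \<Rightarrow> (i, g j)) = (i, g j)} = (if (i, j) \<in> \<sigma> then {(i, j)} else {})"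
    using inj_eq[OF permutes_inj[OF cyclic_perm_group_permutes[OF g]]] by auto
  then show ?thesis
    using geometric_simplex_support[OF \<sigma>(2), of "(i, j)"]
    by (auto simp: chessboard_action_def realization_map_on_simplex[OF \<sigma>(1) finite_chessboard_complex[OF \<sigma>(1)] \<sigma>(2)])
qed

text \<open>Distinct columns bound the number of vertices of a simplex by p, so the largest
  barycentric coordinate is at least 1/p.\<close>

lemma chessboard_large_coordinate:
  assumes p: "0 < p" and x: "x \<in> topspace (chessboard_space k p)"
  shows "\<exists>v\<in>{1..k} \<times> {1..p}. 1 / real p \<le> x v"
proof (rule ccontr)
  assume neg: "\<not> ?thesis"
  obtain \<sigma> where \<sigma>: "\<sigma> \<in> chessboard_complex k p" "x \<in> geometric_simplex \<sigma>"
    using x by (auto simp: chessboard_space_def topspace_geometric_realization)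
  have "card \<sigma> \<le> card {1..p}"
    using \<sigma>(1) by (intro card_inj_on_le[of snd]) (auto simp: chessboard_complex_def)
  have "\<sigma> \<noteq> {}" using \<sigma>(2) by (auto simp: geometric_simplex_def)
  then have "(\<Sum>v\<in>\<sigma>. x v) < (\<Sum>v\<in>\<sigma>. 1 / real p)"
    using neg \<sigma>(1) finite_chessboard_complex[OF \<sigma>(1)]
    by (intro sum_strict_mono) (auto simp: chessboard_complex_def subset_iff not_le)
  also have "\<dots> \<le> 1" using \<open>card \<sigma> \<le> card {1..p}\<close> p by (simp add: divide_simps)
  finally show False using \<sigma>(2) by (simp add: geometric_simplex_def)
qed

lemma singular_simplex_pair:
  assumes "singular_simplex n X \<sigma>" "singular_simplex n Y \<tau>"
  shows "singular_simplex n (prod_topology X Y) (\<lambda>x\<in>standard_simplex n. (\<sigma> x, \<tau> x))"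
  unfolding singular_simplex_def
proof
  have "continuous_map (subtopology (powertop_real UNIV) (standard_simplex n)) (prod_topology X Y) (\<lambda>x. (\<sigma> x, \<tau> x))"
    using assms by (auto simp: singular_simplex_def intro: continuous_map_pairedI)
  then show "continuous_map (subtopology (powertop_real UNIV) (standard_simplex n)) (prod_topology X Y)
      (\<lambda>x\<in>standard_simplex n. (\<sigma> x, \<tau> x))"
    by (rule continuous_map_eq) simp
qed simp

section \<open>Graph simplices in the product with EG\<close>

text \<open>The chessboard complex sits in the Milnor join as the simplices on the first \<open>k\<close> rows whose
  group elements are distinct; this is its graph in the product.\<close>

definition graph_simplex :: "(nat \<times> (nat \<Rightarrow> nat)) list \<Rightarrow> (nat \<Rightarrow> real) \<Rightarrow>
    (nat \<times> (nat \<Rightarrow> nat) \<Rightarrow> real) \<times> (nat \<times> nat \<Rightarrow> real)"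
  where "graph_simplex w = (\<lambda>x\<in>standard_simplex (length w - 1).
    (affine_simplex w x, affine_simplex (map (apsnd (\<lambda>g. g 1)) w) x))"

lemma singular_face_graph:
  assumes "length w = Suc (Suc n)" "k \<le> Suc n"
  shows "singular_face (Suc n) k (graph_simplex w) = graph_simplex (take k w @ drop (Suc k) w)"
proof (rule extensionalityI[of _ "standard_simplex n"])
  fix x assume x: "x \<in> standard_simplex n"
  have face: "affine_simplex u (simplical_face k x) = affine_simplex (take k u @ drop (Suc k) u) x"
    if "length u = Suc (Suc n)" for u :: "'v list"
    using fun_cong[OF singular_face_affine[OF that assms(2)], of x] x by (simp add: singular_face_def)
  have "simplical_face k x \<in> standard_simplex (Suc n)"
    using simplical_face_in_standard_simplex[of "Suc n" k x] assms x by simp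
  then show "singular_face (Suc n) k (graph_simplex w) x = graph_simplex (take k w @ drop (Suc k) w) x"
    using x assms face[of w] face[of "map (apsnd (\<lambda>g. g 1)) w"]
    by (simp add: singular_face_def graph_simplex_def take_map drop_map)
qed (use assms in \<open>simp_all add: singular_face_def graph_simplex_def\<close>)

lemma chain_boundary_graph:
  assumes "length w = Suc (Suc n)"
  shows "chain_boundary (Suc n) (frag_of (graph_simplex w)) = frag_extend (frag_of \<circ> graph_simplex) (list_boundary w)"
  by (rule chain_boundary_of_lists[OF singular_face_graph[OF assms] assms])

lemma EG_simplexI:
  assumes "distinct (map fst w)" "snd ` set w \<subseteq> carrier G"
  shows "set w \<in> EG_complex G"
  using assms by (auto simp: EG_complex_def distinct_map)

text \<open>The rows from 1 to p - 1 exist in the chessboard because of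
  \<open>p - 1 \<le> k\<close>.\<close>

lemma chessboard_simplexI:
  assumes "0 < p" "p - 1 \<le> k" "distinct (map fst w)" "distinct (map snd w)"
    "fst ` set w \<subseteq> {1..<p}" "snd ` set w \<subseteq> carrier (cyclic_perm_group p)"
  shows "set (map (apsnd (\<lambda>g. g 1)) w) \<in> chessboard_complex k p"
proof -
  note e = evaluation_bij_betw[OF assms(1), unfolded bij_betw_def]
  have "(i, g 1) \<in> {1..k} \<times> {1..p}" if "(i, g) \<in> set w" for i g
    using that assms(2,5,6) e by force
  then have "set (map (apsnd (\<lambda>g. g 1)) w) \<subseteq> {1..k} \<times> {1..p}" by auto
  moreover have "distinct (map fst (map (apsnd (\<lambda>g. g 1)) w))" using assms(3) by (simp add: comp_def)
  then have "inj_on fst (set (map (apsnd (\<lambda>g. g 1)) w))" using distinct_map by blast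
  moreover have "inj_on (\<lambda>g. g 1) (set (map snd w))"
    using e assms(6) by (auto intro: inj_on_subset)
  then have "distinct (map (\<lambda>g. g 1) (map snd w))" using assms(4) by (simp only: distinct_map)
  then have "distinct (map snd (map (apsnd (\<lambda>g. g 1)) w))" by (simp add: comp_def)
  then have "inj_on snd (set (map (apsnd (\<lambda>g. g 1)) w))" using distinct_map by blast
  ultimately show ?thesis by (simp add: chessboard_complex_def)
qed

lemma singular_simplex_graph:
  assumes "0 < p" "p - 1 \<le> k" "w \<noteq> []" "distinct (map fst w)" "distinct (map snd w)"
    "fst ` set w \<subseteq> {1..<p}" "snd ` set w \<subseteq> carrier (cyclic_perm_group p)"
  shows "singular_simplex (length w - 1) (prod_topology (EG (cyclic_perm_group p)) (chessboard_space k p)) (graph_simplex w)"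
proof -
  have "singular_simplex (length w - 1) (EG (cyclic_perm_group p)) (affine_simplex w)"
    unfolding EG_def by (rule singular_simplex_affine[OF assms(3) order_refl EG_simplexI]) (use assms in auto)
  moreover have "singular_simplex (length w - 1) (chessboard_space k p) (affine_simplex (map (apsnd (\<lambda>g. g 1)) w))"
    using singular_simplex_affine[OF _ order_refl chessboard_simplexI[OF assms(1,2,4-7)]] assms(3)
    by (simp add: chessboard_space_def)
  ultimately show ?thesis
    using singular_simplex_pair[of "length w - 1" _ "affine_simplex w" _ "affine_simplex (map (apsnd (\<lambda>g. g 1)) w)"]
    by (simp add: graph_simplex_def)
qed

lemma simplex_map_EG_affine:
  assumes "group G" "w \<noteq> []" "distinct (map fst w)" "snd ` set w \<subseteq> carrier G"
  shows "simplex_map (length w - 1) (EG_action G g) (affine_simplex w) = affine_simplex (map (apsnd ((\<otimes>\<^bsub>G\<^esub>) g)) w)"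
proof -
  have eq: "(\<lambda>(i, h). (i, g \<otimes>\<^bsub>G\<^esub> h)) = apsnd ((\<otimes>\<^bsub>G\<^esub>) g)" by (auto simp: fun_eq_iff)
  show ?thesis
    unfolding EG_action_def eq
    by (rule simplex_map_affine[OF assms(2) order_refl EG_simplexI[OF assms(3,4)]]) simp
qed

lemma simplex_map_graph:
  assumes "0 < p" "p - 1 \<le> k" "w \<noteq> []" "distinct (map fst w)" "distinct (map snd w)"
    "fst ` set w \<subseteq> {1..<p}" "snd ` set w \<subseteq> carrier (cyclic_perm_group p)" and g: "g \<in> carrier (cyclic_perm_group p)"
  shows "simplex_map (length w - 1) (diagonal_action (cyclic_perm_group p) (chessboard_space k p) (chessboard_action k p) g)
    (graph_simplex w) = graph_simplex (map (apsnd ((\<otimes>\<^bsub>cyclic_perm_group p\<^esub>) g)) w)"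
proof (rule extensionalityI[of _ "standard_simplex (length w - 1)"])
  let ?G = "cyclic_perm_group p" and ?X = "chessboard_space k p" and ?w = "map (apsnd (\<lambda>g. g 1)) w"
  fix x assume x: "x \<in> standard_simplex (length w - 1)"
  have "graph_simplex w x \<in> topspace (prod_topology (EG ?G) ?X)"
    using singular_simplex_graph[OF assms(1-7)] x by (auto simp: singular_simplex_def continuous_map_def)
  moreover have "EG_action ?G g (affine_simplex w x) = affine_simplex (map (apsnd ((\<otimes>\<^bsub>?G\<^esub>) g)) w) x"
    using fun_cong[OF simplex_map_EG_affine[OF group_cyclic_perm_group assms(3,4,7), of g], of x] x
    by (simp add: simplex_map_def)
  moreover have "chessboard_action k p g (affine_simplex ?w x) = affine_simplex (map (\<lambda>(i, j). (i, g j)) ?w) x"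
    using fun_cong[OF simplex_map_affine[OF _ order_refl chessboard_simplexI[OF assms(1,2,4-7)]], of "\<lambda>(i, j). (i, g j)" x] x assms(3)
    by (simp add: simplex_map_def chessboard_action_def)
  moreover have "map (\<lambda>(i, j). (i, g j)) ?w = map (apsnd (\<lambda>g. g 1)) (map (apsnd ((\<otimes>\<^bsub>?G\<^esub>) g)) w)"
    by auto
  ultimately show "simplex_map (length w - 1) (diagonal_action ?G ?X (chessboard_action k p) g) (graph_simplex w) x =
      graph_simplex (map (apsnd ((\<otimes>\<^bsub>?G\<^esub>) g)) w) x"
    using x by (simp add: simplex_map_def graph_simplex_def diagonal_action_def del: map_map map_eq_conv)
qed (simp_all add: simplex_map_def graph_simplex_def)

section \<open>The index\<close>

lemma cochain_chain_map_eval: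
  assumes p: "0 < p" and \<phi>: "\<phi> \<in> carrier (cochain_group n Y (integer_mod_group p))"
    and f: "continuous_map Z Y f" and c: "singular_chain n Z c"
  shows "[\<phi> (chain_map n f c) = frag_eval (\<lambda>\<tau>. \<phi> (frag_of (simplex_map n f \<tau>))) c] (mod int p)"
  using cochain_frag_eval[OF p \<phi> singular_chain_chain_map[OF c f]]
  by (simp add: chain_map_def frag_eval_extend cong_def)

text \<open>A cocycle kills boundaries; here this becomes divisibility by p, which removes the
  boundary term of a homotopy.\<close>

lemma cocycle_eval_boundary:
  assumes p: "0 < p" and \<phi>: "\<phi> \<in> cocycles n Y (integer_mod_group p)"
    and f: "continuous_map Z Y f" and d: "singular_chain (Suc n) Z d"
  shows "int p dvd frag_eval (\<lambda>\<tau>. \<phi> (frag_of (simplex_map n f \<tau>))) (chain_boundary (Suc n) d)"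
proof -
  have \<phi>c: "\<phi> \<in> carrier (cochain_group n Y (integer_mod_group p))" using \<phi> by (simp add: cocycles_def kernel_def)
  have fd: "singular_chain (Suc n) Y (chain_map (Suc n) f d)" by (rule singular_chain_chain_map[OF d f])
  have "coboundary_map n Y \<phi> = \<one>\<^bsub>cochain_group (Suc n) Y (integer_mod_group p)\<^esub>"
    using \<phi> by (simp add: cocycles_def kernel_def)
  then have "coboundary_map n Y \<phi> (chain_map (Suc n) f d) = 0"
    using fd by (simp add: one_cochain_group)
  then have "\<phi> (chain_map n f (chain_boundary (Suc n) d)) = 0"
    using fd chain_boundary_chain_map[OF d, of f] by (simp add: coboundary_map_def)
  then show ?thesis
    using cochain_chain_map_eval[OF p \<phi>c f singular_chain_boundary_alt[OF d]]
    by (metis cong_0_iff cong_sym)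
qed

lemma simplex_map_comp: "simplex_map n g (simplex_map n f \<sigma>) = simplex_map n (g \<circ> f) \<sigma>"
  by (auto simp: simplex_map_def)

lemma chain_map_comp: "chain_map n g (chain_map n f c) = chain_map n (g \<circ> f) c"
  by (simp add: chain_map_compose)

lemma (in covering_action) simplex_map_quot_act:
  assumes "g \<in> carrier G" "singular_simplex n X \<sigma>"
  shows "simplex_map n quot (simplex_map n (\<alpha> g) \<sigma>) = simplex_map n quot \<sigma>"
  unfolding simplex_map_comp using assms by (intro simplex_map_eq[OF assms(2)]) simp

lemma (in covering_action) frag_eval_quot_act:
  assumes "g \<in> carrier G" "singular_chain n X c"
  shows "frag_eval (\<lambda>\<tau>. w (simplex_map n quot \<tau>)) (chain_map n (\<alpha> g) c) = frag_eval (\<lambda>\<tau>. w (simplex_map n quot \<tau>)) c"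
  unfolding chain_map_def frag_eval_extend
  using assms by (intro frag_eval_cong) (auto simp: simplex_map_quot_act singular_chain_def)

locale chessboard =
  fixes p k :: nat
  assumes prime_p: "prime p" and odd_p: "odd p" and k_ge: "p - 1 \<le> k" and k_le: "k \<le> 2 * p - 2"
begin

abbreviation "G \<equiv> cyclic_perm_group p"
abbreviation "X \<equiv> chessboard_space k p"
abbreviation "Z \<equiv> prod_topology (EG G) X"
abbreviation "act \<equiv> diagonal_action G X (chessboard_action k p)"
abbreviation "borel \<equiv> borel_construction G X (chessboard_action k p)"
abbreviation "A \<equiv> integer_mod_group p"

lemma p_ge_3: "3 \<le> p"
  using prime_ge_2_nat[OF prime_p] odd_p by (cases "p = 2") auto

lemma p_pos: "0 < p" using p_ge_3 by simp

sublocale E: covering_action "cyclic_perm_group p" "EG (cyclic_perm_group p)" "EG_action (cyclic_perm_group p)"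
  by (rule covering_action_EG[OF group_cyclic_perm_group])

sublocale Z: covering_action "cyclic_perm_group p" "prod_topology (EG (cyclic_perm_group p)) (chessboard_space k p)"
    "diagonal_action (cyclic_perm_group p) (chessboard_space k p) (chessboard_action k p)"
  by (rule covering_action_borel[OF group_cyclic_perm_group group_action_chessboard continuous_map_chessboard_action])

lemma evaluation: "bij_betw (\<lambda>g. g 1) (carrier G) {1..p}"
  by (rule evaluation_bij_betw[OF p_pos])

lemma finite_G: "finite (carrier G)" and card_G: "card (carrier G) = p"
  using evaluation bij_betw_finite bij_betw_same_card by fastforce+

lemma acyclic_E: "mod_acyclic p (EG G)"
  by (rule mod_acyclic_EG[OF group_cyclic_perm_group finite_G p_pos])

lemma translation_bij: "g \<in> carrier G \<Longrightarrow> bij_betw ((\<otimes>\<^bsub>G\<^esub>) g) (carrier G) (carrier G)"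
  by (rule bij_betwI[where g = "(\<otimes>\<^bsub>G\<^esub>) (inv\<^bsub>G\<^esub> g)"]) (auto simp del: mult_cyclic_perm_group one_cyclic_perm_group simp: E.G.m_assoc[symmetric])

lemma fst_act: "z \<in> topspace Z \<Longrightarrow> fst (act g z) = EG_action G g (fst z)"
  by (auto simp: diagonal_action_def)

lemma snd_act: "z \<in> topspace Z \<Longrightarrow> snd (act g z) = chessboard_action k p g (snd z)"
  by (auto simp: diagonal_action_def)

lemma chain_map_fst_act:
  assumes "singular_chain n Z c"
  shows "chain_map n fst (chain_map n (act g) c) = chain_map n (EG_action G g) (chain_map n fst c)"
  unfolding chain_map_comp by (rule chain_map_eq[OF assms]) (simp add: fst_act)

lemma projection_simplex:
  assumes "singular_simplex n Z \<tau>"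
  shows "simplex_map n borel_projection (simplex_map n Z.quot \<tau>) = simplex_map n E.quot (simplex_map n fst \<tau>)"
  unfolding simplex_map_comp
  by (rule simplex_map_eq[OF assms]) (auto simp: borel_projection_orbit)

lemma pullback_eval:
  assumes "singular_simplex n Z \<tau>"
  shows "cochain_pullback n borel borel_projection \<phi> (frag_of (simplex_map n Z.quot \<tau>)) =
     \<phi> (frag_of (simplex_map n E.quot (simplex_map n fst \<tau>)))"
proof -
  have "singular_simplex n borel (simplex_map n Z.quot \<tau>)"
    using singular_simplex_simplex_map[OF assms Z.continuous_map_quot] by (simp add: borel_construction_def)
  then show ?thesis by (simp add: cochain_pullback_def singular_chain_of projection_simplex[OF assms])
qed

section \<open>The chain level section in low degrees\<close>

text \<open>L spreads the word of labels over the first p - 1 rows and realises the result as graph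
  simplices. Followed by the projection it has augmentation (p - 1)!, so it differs from that
  multiple of the identity by an equivariant homotopy.\<close>

lemma section_homotopy:
  "\<exists>H L. \<forall>n \<sigma>. n \<le> p - 2 \<longrightarrow> singular_simplex n (EG G) \<sigma> \<longrightarrow>
     singular_chain n Z (L n \<sigma>) \<and> singular_chain (Suc n) (EG G) (H n \<sigma>) \<and>
     (\<forall>g\<in>carrier G. L n (simplex_map n (EG_action G g) \<sigma>) = chain_map n (act g) (L n \<sigma>) \<and>
        H n (simplex_map n (EG_action G g) \<sigma>) = chain_map (Suc n) (EG_action G g) (H n \<sigma>)) \<and>
     chain_boundary n (L n \<sigma>) = frag_extend (L (n - 1)) (chain_boundary n (frag_of \<sigma>)) \<and>
     frag_dvd p (frag_cmul (fact (p - 1)) (frag_of \<sigma>) - chain_map n fst (L n \<sigma>)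
       - frag_extend (H (n - 1)) (chain_boundary n (frag_of \<sigma>)) - chain_boundary (Suc n) (H n \<sigma>))"
proof -
  \<comment> \<open>As EG is free, its points can be labelled equivariantly by group
    elements.\<close>
  have "\<exists>\<gamma>. \<forall>x\<in>topspace (EG G). \<gamma> x \<in> carrier G \<and> (\<forall>g\<in>carrier G. \<gamma> (EG_action G g x) = g \<otimes>\<^bsub>G\<^esub> \<gamma> x)"
    by (rule E.G.equivariant_choice)
      (use E.act_mult E.act_eq_one in \<open>auto simp: E.G.m_assoc simp del: mult_cyclic_perm_group one_cyclic_perm_group\<close>)
  then obtain \<gamma> where \<gamma>: "\<And>x. x \<in> topspace (EG G) \<Longrightarrow> \<gamma> x \<in> carrier G"
    "\<And>g x. g \<in> carrier G \<Longrightarrow> x \<in> topspace (EG G) \<Longrightarrow> \<gamma> (EG_action G g x) = g \<otimes>\<^bsub>G\<^esub> \<gamma> x" by metis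
  define R where "R = [1..<p]"
  have R: "length R = p - 1" "distinct R" "set R = {1..<p}" by (auto simp: R_def)
  define lt where "lt = simplex_letters \<gamma>"
  have lt: "set (lt n \<sigma>) \<subseteq> carrier G" if "singular_simplex n (EG G) \<sigma>" for n \<sigma>
    unfolding lt_def by (rule set_simplex_letters[OF that \<gamma>(1)])
  define L where "L n \<sigma> = frag_extend (frag_of \<circ> graph_simplex) (rows_chain R (lt n \<sigma>))" for n \<sigma>
  have keys: "length w = Suc n \<and> distinct (map fst w) \<and> distinct (map snd w) \<and> fst ` set w \<subseteq> {1..<p} \<and> snd ` set w \<subseteq> carrier G"
    if \<sigma>: "singular_simplex n (EG G) \<sigma>" and w: "w \<in> Poly_Mapping.keys (rows_chain R (lt n \<sigma>))" for n \<sigma> w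
  proof -
    \<comment> \<open>Only words without repetition have a nonzero lift, so the columns of a lift
      are distinct, as the chessboard requires.\<close>
    have d: "distinct (lt n \<sigma>)"
      using w alternating_not_distinct[OF alternating_rows_chain, of "lt n \<sigma>" R] by (metis empty_iff keys_zero)
    note k = keys_row_sum[OF keys_rows_chain[OF w]]
    have "snd ` set w \<subseteq> carrier G" using k lt[OF \<sigma>] unfolding set_map by blast
    then show ?thesis using k d R by (simp add: lt_def)
  qed
  have Lc: "singular_chain n Z (L n \<sigma>)" if \<sigma>: "singular_simplex n (EG G) \<sigma>" for n \<sigma>
    unfolding L_def
  proof (rule singular_chain_extend)
    fix w assume w: "w \<in> Poly_Mapping.keys (rows_chain R (lt n \<sigma>))"
    note kw = keys[OF \<sigma> w]
    have "w \<noteq> []" using kw by auto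
    have "singular_simplex (length w - 1) Z (graph_simplex w)"
      by (rule singular_simplex_graph[OF p_pos k_ge \<open>w \<noteq> []\<close>]) (use kw in auto)
    then show "singular_chain n Z ((frag_of \<circ> graph_simplex) w)" using kw by (simp add: singular_chain_of)
  qed
  have Lact: "L n (simplex_map n (EG_action G g) \<sigma>) = chain_map n (act g) (L n \<sigma>)"
    if g: "g \<in> carrier G" and \<sigma>: "singular_simplex n (EG G) \<sigma>" for n g \<sigma>
  proof -
    have "lt n (simplex_map n (EG_action G g) \<sigma>) = map ((\<otimes>\<^bsub>G\<^esub>) g) (lt n \<sigma>)"
      unfolding lt_def
      by (rule simplex_letters_map) (use \<gamma>(2)[OF g] E.singular_simplex_point[OF \<sigma> vertex_point_in_standard_simplex] in blast)
    then have "L n (simplex_map n (EG_action G g) \<sigma>) =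
        frag_extend (\<lambda>w. frag_of (graph_simplex (map (apsnd ((\<otimes>\<^bsub>G\<^esub>) g)) w))) (rows_chain R (lt n \<sigma>))"
      by (simp add: L_def rows_chain_map frag_extend_frag_extend del: mult_cyclic_perm_group)
    also have "\<dots> = frag_extend (\<lambda>w. chain_map n (act g) (frag_of (graph_simplex w))) (rows_chain R (lt n \<sigma>))"
    proof (rule frag_extend_eq)
      fix w assume w: "w \<in> Poly_Mapping.keys (rows_chain R (lt n \<sigma>))"
      note kw = keys[OF \<sigma> w]
      have "w \<noteq> []" using kw by auto
      have "simplex_map (length w - 1) (act g) (graph_simplex w) = graph_simplex (map (apsnd ((\<otimes>\<^bsub>G\<^esub>) g)) w)"
        by (rule simplex_map_graph[OF p_pos k_ge \<open>w \<noteq> []\<close> _ _ _ _ g]) (use kw in auto)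
      then show "frag_of (graph_simplex (map (apsnd ((\<otimes>\<^bsub>G\<^esub>) g)) w)) = chain_map n (act g) (frag_of (graph_simplex w))"
        using kw by (simp del: mult_cyclic_perm_group)
    qed
    finally show ?thesis by (simp add: L_def chain_map_frag_extend)
  qed
  have Lbd: "chain_boundary (Suc n) (L (Suc n) \<sigma>) = frag_extend (L n) (chain_boundary (Suc n) (frag_of \<sigma>))"
    if n: "Suc n \<le> p - 2" and \<sigma>: "singular_simplex (Suc n) (EG G) \<sigma>" for n \<sigma>
  proof -
    have "chain_boundary (Suc n) (L (Suc n) \<sigma>) =
        frag_extend (\<lambda>w. frag_extend (frag_of \<circ> graph_simplex) (list_boundary w)) (rows_chain R (lt (Suc n) \<sigma>))"
      unfolding L_def chain_boundary_frag_extend comp_apply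
      by (rule frag_extend_eq) (use keys[OF \<sigma>] in \<open>simp add: chain_boundary_graph comp_def\<close>)
    also have "\<dots> = frag_extend (frag_of \<circ> graph_simplex) (list_chain_boundary (rows_chain R (lt (Suc n) \<sigma>)))"
      by (rule frag_extend_frag_extend[symmetric])
    \<comment> \<open>The word has n + 2 letters, which is at most p - 1 precisely in the range of
      dimensions assumed.\<close>
    also have "list_chain_boundary (rows_chain R (lt (Suc n) \<sigma>)) = frag_extend (rows_chain R) (list_boundary (lt (Suc n) \<sigma>))"
      by (rule rows_chain_boundary) (use n R in \<open>simp add: lt_def\<close>)
    also have "list_boundary (lt (Suc n) \<sigma>) = frag_extend (frag_of \<circ> lt n) (chain_boundary (Suc n) (frag_of \<sigma>))"
      unfolding lt_def by (rule list_boundary_simplex_letters)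
    finally show ?thesis by (simp add: L_def[abs_def] frag_extend_frag_extend comp_def)
  qed
  define D where "D n \<sigma> = frag_cmul (fact (p - 1)) (frag_of \<sigma>) - chain_map n fst (L n \<sigma>)" for n \<sigma>
  have "\<exists>H. \<forall>n\<le>p - 2. \<forall>\<sigma>. singular_simplex n (EG G) \<sigma> \<longrightarrow> singular_chain (Suc n) (EG G) (H n \<sigma>) \<and>
     (\<forall>g\<in>carrier G. H n (simplex_map n (EG_action G g) \<sigma>) = chain_map (Suc n) (EG_action G g) (H n \<sigma>)) \<and>
     frag_dvd p (D n \<sigma> - frag_extend (H (n - 1)) (chain_boundary n (frag_of \<sigma>)) - chain_boundary (Suc n) (H n \<sigma>))"
  proof (rule E.equivariant_null_homotopy[OF acyclic_E E.continuous_action E.act_mult])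
    show "singular_chain n (EG G) (D n \<sigma>)" if "singular_simplex n (EG G) \<sigma>" for n \<sigma>
      unfolding D_def
      by (intro singular_chain_diff singular_chain_cmul singular_chain_chain_map[OF Lc[OF that] continuous_map_fst])
        (simp add: that singular_chain_of)
    show "D n (simplex_map n (EG_action G g) \<sigma>) = chain_map n (EG_action G g) (D n \<sigma>)"
      if "singular_simplex n (EG G) \<sigma>" "g \<in> carrier G" for n \<sigma> g
      unfolding D_def by (simp add: that Lact chain_map_diff chain_map_fst_act[OF Lc[OF that(1)]])
    show "frag_dvd p (chain_boundary (Suc n) (D (Suc n) \<sigma>) - frag_extend (D n) (chain_boundary (Suc n) (frag_of \<sigma>)))"
      if "Suc n \<le> p - 2" "singular_simplex (Suc n) (EG G) \<sigma>" for n \<sigma>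
    proof -
      have "chain_boundary (Suc n) (chain_map (Suc n) fst (L (Suc n) \<sigma>)) =
          frag_extend (\<lambda>\<tau>. chain_map n fst (L n \<tau>)) (chain_boundary (Suc n) (frag_of \<sigma>))"
        using chain_boundary_chain_map[OF Lc[OF that(2)], of fst] by (simp add: Lbd[OF that] chain_map_frag_extend)
      then have "chain_boundary (Suc n) (D (Suc n) \<sigma>) = frag_extend (D n) (chain_boundary (Suc n) (frag_of \<sigma>))"
        by (simp add: D_def[abs_def] chain_boundary_diff chain_boundary_cmul frag_extend_fun_diff frag_extend_fun_cmul frag_extend_id)
      then show ?thesis by simp
    qed
    show "int p dvd frag_eval (\<lambda>_. 1) (D 0 \<sigma>)" if "singular_simplex 0 (EG G) \<sigma>" for \<sigma>
    proof -
      have "R \<noteq> []" using R(1) p_ge_3 by auto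
      have "lt 0 \<sigma> = [\<gamma> (\<sigma> (vertex_point 0))]" by (simp add: lt_def simplex_letters_def)
      then have "frag_eval (\<lambda>_. 1) (chain_map 0 fst (L 0 \<sigma>)) = fact (p - 1)"
        using frag_eval_rows_chain_single[OF \<open>R \<noteq> []\<close>] R(1)
        by (simp add: L_def chain_map_def frag_eval_extend)
      then show ?thesis by (simp add: D_def frag_eval_diff frag_eval_cmul)
    qed
  qed
  then obtain H where H: "\<And>n \<sigma>. n \<le> p - 2 \<Longrightarrow> singular_simplex n (EG G) \<sigma> \<Longrightarrow> singular_chain (Suc n) (EG G) (H n \<sigma>) \<and>
     (\<forall>g\<in>carrier G. H n (simplex_map n (EG_action G g) \<sigma>) = chain_map (Suc n) (EG_action G g) (H n \<sigma>)) \<and>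
     frag_dvd p (D n \<sigma> - frag_extend (H (n - 1)) (chain_boundary n (frag_of \<sigma>)) - chain_boundary (Suc n) (H n \<sigma>))"
    by blast
  show ?thesis
  proof (intro exI[of _ H] exI[of _ L] allI impI)
    fix n \<sigma> assume n: "n \<le> p - 2" and \<sigma>: "singular_simplex n (EG G) \<sigma>"
    have "chain_boundary n (L n \<sigma>) = frag_extend (L (n - 1)) (chain_boundary n (frag_of \<sigma>))"
      using Lbd n \<sigma> by (cases n) (auto simp: chain_boundary_def[of 0])
    then show "singular_chain n Z (L n \<sigma>) \<and> singular_chain (Suc n) (EG G) (H n \<sigma>) \<and>
     (\<forall>g\<in>carrier G. L n (simplex_map n (EG_action G g) \<sigma>) = chain_map n (act g) (L n \<sigma>) \<and>
        H n (simplex_map n (EG_action G g) \<sigma>) = chain_map (Suc n) (EG_action G g) (H n \<sigma>)) \<and>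
     chain_boundary n (L n \<sigma>) = frag_extend (L (n - 1)) (chain_boundary n (frag_of \<sigma>)) \<and>
     frag_dvd p (frag_cmul (fact (p - 1)) (frag_of \<sigma>) - chain_map n fst (L n \<sigma>)
       - frag_extend (H (n - 1)) (chain_boundary n (frag_of \<sigma>)) - chain_boundary (Suc n) (H n \<sigma>))"
      using H[OF n \<sigma>] Lc[OF \<sigma>] Lact[OF _ \<sigma>] unfolding D_def by blast
  qed
qed

section \<open>Truncating the projection in high degrees\<close>

text \<open>An open set containing all points over the simplex s. Labels are vertices with
  coordinate at least 1/p, so the label of a point of the star is a vertex of s.\<close>

definition star :: "(nat \<times> nat) set \<Rightarrow> ((nat \<times> (nat \<Rightarrow> nat) \<Rightarrow> real) \<times> (nat \<times> nat \<Rightarrow> real)) set"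
  where "star s = {z \<in> topspace Z. \<forall>v\<in>{1..k} \<times> {1..p} - s. snd z v < 1 / real p}"

lemma openin_star: "openin Z (star s)"
proof -
  have "openin Z {z \<in> topspace Z. snd z v \<in> {..<1 / real p}}" for v
    using continuous_map_compose[OF continuous_map_snd continuous_map_realization_coord, of "EG G" _ v]
    by (intro openin_continuous_map_preimage[of _ euclideanreal]) (auto simp: chessboard_space_def comp_def)
  then have "openin Z ((\<Inter>v\<in>{1..k} \<times> {1..p} - s. {z \<in> topspace Z. snd z v \<in> {..<1 / real p}}) \<inter> topspace Z)"
    by (intro openin_INT) simp_all
  then show ?thesis by (rule back_subst[of "openin Z"]) (auto simp: star_def)
qed

lemma star_cover: "topspace Z \<subseteq> \<Union>(star ` chessboard_complex k p)"
proof
  fix z assume z: "z \<in> topspace Z"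
  then have "snd z \<in> topspace X" by auto
  then obtain s where s: "s \<in> chessboard_complex k p" "snd z \<in> geometric_simplex s"
    by (auto simp: chessboard_space_def topspace_geometric_realization)
  have "snd z v = 0" if "v \<notin> s" for v using geometric_simplex_support[OF s(2)] that by blast
  then have "z \<in> star s" using z p_pos by (auto simp: star_def)
  then show "z \<in> \<Union>(star ` chessboard_complex k p)" using s(1) by blast
qed

lemma star_act:
  assumes g: "g \<in> carrier G" and U: "U \<in> star ` chessboard_complex k p"
  shows "\<exists>U'\<in>star ` chessboard_complex k p. act g ` U \<subseteq> U'"
proof -
  obtain s where s: "s \<in> chessboard_complex k p" "U = star s" using U by blast
  let ?s = "(\<lambda>(i, j). (i, g j)) ` s"
  note P = cyclic_perm_group_permutes[OF g]
  have "act g z \<in> star ?s" if z: "z \<in> star s" for z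
  proof -
    have zZ: "z \<in> topspace Z" using z by (simp add: star_def)
    then have x: "snd z \<in> topspace X" by auto
    have "snd (act g z) v < 1 / real p" if v: "v \<in> {1..k} \<times> {1..p} - ?s" for v
    proof -
      obtain i j where ij: "v = (i, g j)" using surj_pair[of v] permutes_surj[OF P] by (metis surjD)
      have "(i, j) \<in> {1..k} \<times> {1..p} - s"
        using v permutes_in_image[OF P] unfolding ij by force
      then have "snd z (i, j) < 1 / real p" using z by (simp add: star_def)
      then show ?thesis unfolding ij snd_act[OF zZ] chessboard_action_apply[OF g x] .
    qed
    then show ?thesis using Z.act_closed[OF g zZ] unfolding star_def by blast
  qed
  then show ?thesis using chessboard_translate_simplex[OF P s(1)] s(2) by blast
qed

text \<open>Each point is labelled by a vertex carrying at least 1/p of its weight, with the column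
  written as a group element. The condition is invariant, so the choice can be made
  equivariant.\<close>

lemma letter_choice:
  "\<exists>\<gamma>. \<forall>z\<in>topspace Z. (\<gamma> z \<in> {1..k} \<times> carrier G \<and> 1 / real p \<le> snd z (fst (\<gamma> z), snd (\<gamma> z) 1)) \<and>
     (\<forall>g\<in>carrier G. \<gamma> (act g z) = apsnd ((\<otimes>\<^bsub>G\<^esub>) g) (\<gamma> z))"
proof (rule E.G.equivariant_choice)
  fix z assume z: "z \<in> topspace Z"
  then have "snd z \<in> topspace X" by auto
  from chessboard_large_coordinate[OF p_pos this]
  obtain i j where ij: "i \<in> {1..k}" "j \<in> {1..p}" "1 / real p \<le> snd z (i, j)" by blast
  obtain h where "h \<in> carrier G" "j = h 1" using ij(2) evaluation unfolding bij_betw_def by blast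
  then show "\<exists>y. y \<in> {1..k} \<times> carrier G \<and> 1 / real p \<le> snd z (fst y, snd y 1)"
    using ij by (intro exI[of _ "(i, h)"]) simp
next
  fix g z and y :: "nat \<times> (nat \<Rightarrow> nat)"
  assume g: "g \<in> carrier G" and z: "z \<in> topspace Z"
    and y: "y \<in> {1..k} \<times> carrier G \<and> 1 / real p \<le> snd z (fst y, snd y 1)"
  have x: "snd z \<in> topspace X" using z by auto
  have "g \<otimes>\<^bsub>G\<^esub> snd y \<in> carrier G" using g y by (intro E.G.m_closed) auto
  moreover have "snd (act g z) (fst y, (g \<otimes>\<^bsub>G\<^esub> snd y) 1) = snd z (fst y, snd y 1)"
    unfolding snd_act[OF z] using chessboard_action_apply[OF g x] by simp
  ultimately show "apsnd ((\<otimes>\<^bsub>G\<^esub>) g) y \<in> {1..k} \<times> carrier G \<and>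
      1 / real p \<le> snd (act g z) (fst (apsnd ((\<otimes>\<^bsub>G\<^esub>) g) y), snd (apsnd ((\<otimes>\<^bsub>G\<^esub>) g) y) 1)"
    using y by (auto simp del: mult_cyclic_perm_group)
next
  fix g h :: "nat \<Rightarrow> nat" and y :: "nat \<times> (nat \<Rightarrow> nat)"
  show "apsnd ((\<otimes>\<^bsub>G\<^esub>) (g \<otimes>\<^bsub>G\<^esub> h)) y = apsnd ((\<otimes>\<^bsub>G\<^esub>) g) (apsnd ((\<otimes>\<^bsub>G\<^esub>) h) y)"
    by (cases y) (simp add: comp_assoc)
qed (use Z.act_closed Z.act_one Z.act_mult Z.act_eq_one in \<open>simp_all del: mult_cyclic_perm_group one_cyclic_perm_group\<close>)

text \<open>The truncated map T respects boundaries modulo p on small simplices only, so it is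
  applied after the replacement \<rho>. From degree p - 1 on T is 0 and disappears from the homotopy
  formula. Equivariance of H is recorded in all degrees, as degree p - 2 enters the formula in
  degree p - 1.\<close>

lemma projection_homotopy:
  "\<exists>H. \<forall>n\<le>N. \<forall>\<sigma>. singular_simplex n Z \<sigma> \<longrightarrow> singular_chain (Suc n) (EG G) (H n \<sigma>) \<and>
     (\<forall>g\<in>carrier G. H n (simplex_map n (act g) \<sigma>) = chain_map (Suc n) (EG_action G g) (H n \<sigma>)) \<and>
     (p - 1 \<le> n \<longrightarrow> frag_dvd p (frag_cmul (fact (p - 1)) (frag_of (simplex_map n fst \<sigma>))
       - frag_extend (H (n - 1)) (chain_boundary n (frag_of \<sigma>)) - chain_boundary (Suc n) (H n \<sigma>)))"
proof -
  obtain \<gamma> where \<gamma>: "\<And>z. z \<in> topspace Z \<Longrightarrow> \<gamma> z \<in> {1..k} \<times> carrier G"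
     "\<And>z. z \<in> topspace Z \<Longrightarrow> 1 / real p \<le> snd z (fst (\<gamma> z), snd (\<gamma> z) 1)"
     "\<And>g z. g \<in> carrier G \<Longrightarrow> z \<in> topspace Z \<Longrightarrow> \<gamma> (act g z) = apsnd ((\<otimes>\<^bsub>G\<^esub>) g) (\<gamma> z)"
    using letter_choice by metis
  obtain h :: "nat set \<Rightarrow> int" where h: "\<And>S. S \<subseteq> {1..k} \<Longrightarrow> card S = p \<Longrightarrow> [(\<Sum>r\<in>S. h (S - {r})) = 1] (mod int p)"
    using facet_weights_exist[OF prime_p k_le] by blast
  define \<C> where "\<C> = star ` chessboard_complex k p"
  have \<C>: "\<And>U. U \<in> \<C> \<Longrightarrow> openin Z U" using openin_star by (auto simp: \<C>_def)
  obtain \<rho> where \<rho>0: "\<forall>n \<sigma>. singular_simplex n Z \<sigma> \<longrightarrow> singular_chain n Z (\<rho> n \<sigma>) \<and> small_chain \<C> n (\<rho> n \<sigma>) \<and>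
      (\<forall>g\<in>carrier G. \<rho> n (simplex_map n (act g) \<sigma>) = chain_map n (act g) (\<rho> n \<sigma>))"
    "\<forall>n \<sigma>. singular_simplex (Suc n) Z \<sigma> \<longrightarrow>
      chain_boundary (Suc n) (\<rho> (Suc n) \<sigma>) = frag_extend (\<rho> n) (chain_boundary (Suc n) (frag_of \<sigma>))"
    "\<forall>\<sigma>. singular_simplex 0 Z \<sigma> \<longrightarrow> frag_eval (\<lambda>_. 1) (\<rho> 0 \<sigma>) = 1"
    using Z.equivariant_small_chains[OF \<C> star_cover[folded \<C>_def] star_act[folded \<C>_def]] by blast
  have \<rho>: "\<And>n \<sigma>. singular_simplex n Z \<sigma> \<Longrightarrow> singular_chain n Z (\<rho> n \<sigma>)"
      "\<And>n \<sigma>. singular_simplex n Z \<sigma> \<Longrightarrow> small_chain \<C> n (\<rho> n \<sigma>)"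
      "\<And>n \<sigma> g. singular_simplex n Z \<sigma> \<Longrightarrow> g \<in> carrier G \<Longrightarrow> \<rho> n (simplex_map n (act g) \<sigma>) = chain_map n (act g) (\<rho> n \<sigma>)"
      "\<And>n \<sigma>. singular_simplex (Suc n) Z \<sigma> \<Longrightarrow>
        chain_boundary (Suc n) (\<rho> (Suc n) \<sigma>) = frag_extend (\<rho> n) (chain_boundary (Suc n) (frag_of \<sigma>))"
      "\<And>\<sigma>. singular_simplex 0 Z \<sigma> \<Longrightarrow> frag_eval (\<lambda>_. 1) (\<rho> 0 \<sigma>) = 1"
    by (blast dest: \<rho>0[rule_format])+
  define R where "R = [1..<p]"
  have R: "length R = p - 1" "distinct R" "set R = {1..<p}" by (auto simp: R_def)
  have cR: "card (carrier G) = Suc (length R)" using card_G R(1) p_pos by simp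
  define lt where "lt = simplex_letters \<gamma>"
  define tc where "tc = truncated_chain R (carrier G) h"
  have lt: "set (lt n \<sigma>) \<subseteq> {1..k} \<times> carrier G" if "singular_simplex n Z \<sigma>" for n \<sigma>
    unfolding lt_def by (rule set_simplex_letters[OF that \<gamma>(1)])
  have lt2: "set (map snd (lt n \<sigma>)) \<subseteq> carrier G" if "singular_simplex n Z \<sigma>" for n \<sigma>
    using lt[OF that] by auto
  have keys: "length w = Suc n \<and> snd ` set w \<subseteq> carrier G \<and> distinct (map fst w)"
    if \<sigma>: "singular_simplex n Z \<sigma>" and w: "w \<in> Poly_Mapping.keys (tc (lt n \<sigma>))" for n \<sigma> w
    using keys_truncated_chain[OF w[unfolded tc_def] lt2[OF \<sigma>] cR R(2)] by (simp add: lt_def)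
  define T where "T n \<sigma> = frag_extend (frag_of \<circ> affine_simplex) (tc (lt n \<sigma>))" for n \<sigma>
  have Tc: "singular_chain n (EG G) (T n \<sigma>)" if \<sigma>: "singular_simplex n Z \<sigma>" for n \<sigma>
    unfolding T_def
  proof (rule singular_chain_extend)
    fix w assume w: "w \<in> Poly_Mapping.keys (tc (lt n \<sigma>))"
    note kw = keys[OF \<sigma> w]
    have "w \<noteq> []" using kw by auto
    have "singular_simplex (length w - 1) (EG G) (affine_simplex w)"
      unfolding EG_def by (rule singular_simplex_affine[OF \<open>w \<noteq> []\<close> order_refl EG_simplexI]) (use kw in auto)
    then show "singular_chain n (EG G) ((frag_of \<circ> affine_simplex) w)" using kw by (simp add: singular_chain_of)
  qed
  have Tact: "T n (simplex_map n (act g) \<sigma>) = chain_map n (EG_action G g) (T n \<sigma>)"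
    if g: "g \<in> carrier G" and \<sigma>: "singular_simplex n Z \<sigma>" for n g \<sigma>
  proof -
    have "lt n (simplex_map n (act g) \<sigma>) = map (apsnd ((\<otimes>\<^bsub>G\<^esub>) g)) (lt n \<sigma>)"
      unfolding lt_def
      by (rule simplex_letters_map) (use \<gamma>(3)[OF g] Z.singular_simplex_point[OF \<sigma> vertex_point_in_standard_simplex] in blast)
    then have "T n (simplex_map n (act g) \<sigma>) =
        frag_extend (\<lambda>w. frag_of (affine_simplex (map (apsnd ((\<otimes>\<^bsub>G\<^esub>) g)) w))) (tc (lt n \<sigma>))"
      by (simp add: T_def tc_def truncated_chain_map[OF translation_bij[OF g] lt2[OF \<sigma>] cR] frag_extend_frag_extend del: mult_cyclic_perm_group)
    also have "\<dots> = frag_extend (\<lambda>w. chain_map n (EG_action G g) (frag_of (affine_simplex w))) (tc (lt n \<sigma>))"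
    proof (rule frag_extend_eq)
      fix w assume w: "w \<in> Poly_Mapping.keys (tc (lt n \<sigma>))"
      note kw = keys[OF \<sigma> w]
      have "w \<noteq> []" using kw by auto
      have "simplex_map (length w - 1) (EG_action G g) (affine_simplex w) = affine_simplex (map (apsnd ((\<otimes>\<^bsub>G\<^esub>) g)) w)"
        by (rule simplex_map_EG_affine[OF group_cyclic_perm_group \<open>w \<noteq> []\<close>]) (use kw in auto)
      then show "frag_of (affine_simplex (map (apsnd ((\<otimes>\<^bsub>G\<^esub>) g)) w)) = chain_map n (EG_action G g) (frag_of (affine_simplex w))"
        using kw by (simp del: mult_cyclic_perm_group)
    qed
    finally show ?thesis by (simp add: T_def chain_map_frag_extend)
  qed
  \<comment> \<open>Short words obey the chain map property exactly, long ones give 0 on both sides,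
    and words of length p are where the weights act.\<close>
  have Tbd: "frag_dvd p (chain_boundary (Suc n) (T (Suc n) \<tau>) - frag_extend (T n) (chain_boundary (Suc n) (frag_of \<tau>)))"
    if \<tau>: "singular_simplex (Suc n) Z \<tau>" and small: "small_simplex \<C> (Suc n) \<tau>" for n \<tau>
  proof -
    let ?t = "lt (Suc n) \<tau>"
    have len: "length ?t = Suc (Suc n)" by (simp add: lt_def)
    have "chain_boundary (Suc n) (T (Suc n) \<tau>) =
        frag_extend (\<lambda>w. frag_extend (frag_of \<circ> affine_simplex) (list_boundary w)) (tc ?t)"
      unfolding T_def chain_boundary_frag_extend comp_apply
      by (rule frag_extend_eq) (use keys[OF \<tau>] in \<open>simp add: chain_boundary_affine comp_def\<close>)
    then have 1: "chain_boundary (Suc n) (T (Suc n) \<tau>) =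
        frag_extend (frag_of \<circ> affine_simplex) (list_chain_boundary (tc ?t))"
      by (simp add: frag_extend_frag_extend)
    have "list_boundary ?t = frag_extend (frag_of \<circ> lt n) (chain_boundary (Suc n) (frag_of \<tau>))"
      unfolding lt_def by (rule list_boundary_simplex_letters)
    then have 2: "frag_extend (T n) (chain_boundary (Suc n) (frag_of \<tau>)) =
        frag_extend (frag_of \<circ> affine_simplex) (frag_extend tc (list_boundary ?t))"
      by (simp add: T_def[abs_def] frag_extend_frag_extend)
    have "frag_dvd p (list_chain_boundary (tc ?t) - frag_extend tc (list_boundary ?t))"
    proof -
      consider "length ?t \<le> length R" | "length ?t = Suc (length R)" | "Suc (length R) < length ?t" by linarith
      then show ?thesis
      proof cases
        case 1
        then show ?thesis unfolding tc_def by (simp add: truncated_chain_boundary)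
      next
        case 2
        obtain s where s: "s \<in> chessboard_complex k p" "\<tau> \<in> standard_simplex (Suc n) \<rightarrow> star s"
          using small by (auto simp: small_simplex_def \<C>_def)
        \<comment> \<open>Points of the star of s have coordinates below 1/p outside s, so the label
          must lie in s.\<close>
        have ts: "(i, g 1) \<in> s" if ig: "(i, g) \<in> set ?t" for i g
        proof -
          obtain l where l: "l \<le> Suc n" "(i, g) = \<gamma> (\<tau> (vertex_point l))"
            using ig unfolding lt_def simplex_letters_def set_map set_upt
            by (auto simp: less_Suc_eq_le simp del: upt_Suc)
          let ?z = "\<tau> (vertex_point l)"
          have z: "?z \<in> star s" using s(2) vertex_point_in_standard_simplex[OF l(1)] by blast
          then have zZ: "?z \<in> topspace Z" by (simp add: star_def)
          have g: "i \<in> {1..k}" "g \<in> carrier G" using \<gamma>(1)[OF zZ] unfolding l(2)[symmetric] by auto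
          then have "(i, g 1) \<in> {1..k} \<times> {1..p}" using evaluation unfolding bij_betw_def by blast
          moreover have "1 / real p \<le> snd ?z (i, g 1)" using \<gamma>(2)[OF zZ] unfolding l(2)[symmetric] by simp
          ultimately show ?thesis using z unfolding star_def by (metis (mono_tags, lifting) DiffI mem_Collect_eq not_le)
        qed
        have inj: "inj_on (\<lambda>g. g 1) (carrier G)" using evaluation by (simp add: bij_betw_def)
        \<comment> \<open>All labels lie in one chessboard simplex, where a common row or a common
          column means the same vertex. Distinct labels therefore have distinct rows and
          letters.\<close>
        have eq: "v = v'" if v: "v \<in> set ?t" "v' \<in> set ?t" "fst v = fst v' \<or> snd v = snd v'" for v v'
        proof -
          obtain i g i' g' where vv: "v = (i, g)" "v' = (i', g')" by fastforce
          have m: "(i, g 1) \<in> s" "(i', g' 1) \<in> s" using ts v vv by blast+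
          have c: "g \<in> carrier G" "g' \<in> carrier G" using lt[OF \<tau>] v vv by auto
          have "i = i' \<Longrightarrow> g 1 = g' 1" "g 1 = g' 1 \<Longrightarrow> i = i'"
            using m s(1) by (force simp: chessboard_complex_def inj_on_def)+
          then show ?thesis using v(3) vv inj_onD[OF inj _ c] by auto
        qed
        have "frag_dvd p (frag_extend (truncated_chain R (carrier G) h) (list_boundary ?t))"
        proof (rule truncated_chain_top[OF 2 lt2[OF \<tau>] cR])
          assume d: "distinct ?t"
          then show d2: "distinct (map fst ?t) \<and> distinct (map snd ?t)"
            using eq by (auto simp: distinct_map inj_on_def)
          have "fst ` set ?t \<subseteq> {1..k}" using lt[OF \<tau>] by auto
          moreover have "card (fst ` set ?t) = p"
            using distinct_card[of "map fst ?t"] d2 2 R(1) p_pos by simp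
          ultimately show "[(\<Sum>r\<in>fst ` set ?t. h (fst ` set ?t - {r})) = 1] (mod int p)" by (rule h)
        qed
        moreover have "tc ?t = 0" using 2 by (simp add: tc_def truncated_chain_def)
        ultimately show ?thesis by (simp add: tc_def frag_dvd_minus)
      next
        case 3
        then have "tc ?t = 0" by (simp add: tc_def truncated_chain_def)
        moreover have "frag_extend tc (list_boundary ?t) = 0"
          using 3 length_list_boundary by (intro frag_extend_eq_0) (fastforce simp: tc_def truncated_chain_def)
        ultimately show ?thesis by simp
      qed
    qed
    then show ?thesis unfolding 1 2 frag_extend_diff[symmetric] by (rule frag_dvd_extend_arg)
  qed
  define D where "D n \<sigma> = frag_cmul (fact (p - 1)) (frag_of (simplex_map n fst \<sigma>)) - frag_extend (T n) (\<rho> n \<sigma>)" for n \<sigma>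
  have rho_keys: "singular_simplex n Z \<tau>" "small_simplex \<C> n \<tau>"
    if "singular_simplex n Z \<sigma>" "\<tau> \<in> Poly_Mapping.keys (\<rho> n \<sigma>)" for n \<sigma> \<tau>
    using \<rho>(1,2)[OF that(1)] that(2) by (auto simp: singular_chain_def small_chain_def)
  have "\<exists>H. \<forall>n\<le>N. \<forall>\<sigma>. singular_simplex n Z \<sigma> \<longrightarrow> singular_chain (Suc n) (EG G) (H n \<sigma>) \<and>
     (\<forall>g\<in>carrier G. H n (simplex_map n (act g) \<sigma>) = chain_map (Suc n) (EG_action G g) (H n \<sigma>)) \<and>
     frag_dvd p (D n \<sigma> - frag_extend (H (n - 1)) (chain_boundary n (frag_of \<sigma>)) - chain_boundary (Suc n) (H n \<sigma>))"
  proof (rule Z.equivariant_null_homotopy[OF acyclic_E E.continuous_action E.act_mult])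
    show "singular_chain n (EG G) (D n \<sigma>)" if \<sigma>: "singular_simplex n Z \<sigma>" for n \<sigma>
      unfolding D_def
      by (intro singular_chain_diff singular_chain_cmul singular_chain_extend Tc rho_keys[OF \<sigma>])
        (simp_all add: singular_chain_of singular_simplex_simplex_map[OF \<sigma> continuous_map_fst])
    show "D n (simplex_map n (act g) \<sigma>) = chain_map n (EG_action G g) (D n \<sigma>)"
      if \<sigma>: "singular_simplex n Z \<sigma>" and g: "g \<in> carrier G" for n \<sigma> g
    proof -
      have "frag_extend (T n) (chain_map n (act g) (\<rho> n \<sigma>)) = chain_map n (EG_action G g) (frag_extend (T n) (\<rho> n \<sigma>))"
        by (rule Z.frag_extend_equivariant) (simp_all add: Tact[OF g] chain_map_diff \<rho>(1)[OF \<sigma>])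
      moreover have "simplex_map n fst (simplex_map n (act g) \<sigma>) = simplex_map n (EG_action G g) (simplex_map n fst \<sigma>)"
        unfolding simplex_map_comp by (rule simplex_map_eq[OF \<sigma>]) (simp add: fst_act)
      ultimately show ?thesis by (simp add: D_def \<rho>(3)[OF \<sigma> g] chain_map_diff)
    qed
    show "frag_dvd p (chain_boundary (Suc n) (D (Suc n) \<sigma>) - frag_extend (D n) (chain_boundary (Suc n) (frag_of \<sigma>)))"
      if \<sigma>: "singular_simplex (Suc n) Z \<sigma>" for n \<sigma>
    proof -
      have sc: "singular_chain (Suc n) Z (frag_of \<sigma>)" using \<sigma> by (simp add: singular_chain_of)
      let ?b = "chain_boundary (Suc n) (frag_of \<sigma>)"
      have "frag_dvd p (frag_extend (\<lambda>\<tau>. chain_boundary (Suc n) (T (Suc n) \<tau>) - frag_extend (T n) (chain_boundary (Suc n) (frag_of \<tau>))) (\<rho> (Suc n) \<sigma>))"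
        by (rule frag_dvd_extend) (rule Tbd[OF rho_keys[OF \<sigma>]])
      moreover have "frag_extend (\<lambda>\<tau>. frag_extend (T n) (chain_boundary (Suc n) (frag_of \<tau>))) (\<rho> (Suc n) \<sigma>) =
          frag_extend (\<lambda>\<tau>. frag_extend (T n) (\<rho> n \<tau>)) ?b"
        unfolding frag_extend_boundary[symmetric] \<rho>(4)[OF \<sigma>] frag_extend_frag_extend ..
      ultimately have 1: "frag_dvd p (chain_boundary (Suc n) (frag_extend (T (Suc n)) (\<rho> (Suc n) \<sigma>)) - frag_extend (\<lambda>\<tau>. frag_extend (T n) (\<rho> n \<tau>)) ?b)"
        by (simp add: frag_extend_fun_diff chain_boundary_frag_extend)
      have "chain_boundary (Suc n) (frag_of (simplex_map (Suc n) fst \<sigma>)) = frag_extend (\<lambda>\<tau>. frag_of (simplex_map n fst \<tau>)) ?b"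
        using chain_boundary_chain_map[OF sc, of fst] by (simp add: chain_map_def comp_def)
      then have "chain_boundary (Suc n) (D (Suc n) \<sigma>) - frag_extend (D n) ?b =
         - (chain_boundary (Suc n) (frag_extend (T (Suc n)) (\<rho> (Suc n) \<sigma>)) - frag_extend (\<lambda>\<tau>. frag_extend (T n) (\<rho> n \<tau>)) ?b)"
        by (simp add: D_def[abs_def] chain_boundary_diff chain_boundary_cmul frag_extend_fun_diff frag_extend_fun_cmul)
      then show ?thesis using frag_dvd_minus[OF 1] by simp
    qed
    show "int p dvd frag_eval (\<lambda>_. 1) (D 0 \<sigma>)" if \<sigma>: "singular_simplex 0 Z \<sigma>" for \<sigma>
    proof -
      have "1 < length R" using R(1) p_ge_3 by simp
      have "frag_eval (\<lambda>_. 1) (T 0 \<tau>) = fact (p - 1)" for \<tau>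
        using frag_eval_truncated_chain_single[OF \<open>1 < length R\<close>] R(1)
        by (simp add: T_def tc_def lt_def simplex_letters_def frag_eval_extend)
      then have "frag_eval (\<lambda>_. 1) (frag_extend (T 0) (\<rho> 0 \<sigma>)) = fact (p - 1)"
        using \<rho>(5)[OF \<sigma>] frag_eval_fun_cmul[of "fact (p - 1)" "\<lambda>_. 1" "\<rho> 0 \<sigma>"] by (simp add: frag_eval_extend)
      then show ?thesis by (simp add: D_def frag_eval_diff frag_eval_cmul)
    qed
  qed
  then obtain H where H: "\<And>n \<sigma>. n \<le> N \<Longrightarrow> singular_simplex n Z \<sigma> \<Longrightarrow> singular_chain (Suc n) (EG G) (H n \<sigma>) \<and>
     (\<forall>g\<in>carrier G. H n (simplex_map n (act g) \<sigma>) = chain_map (Suc n) (EG_action G g) (H n \<sigma>)) \<and>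
     frag_dvd p (D n \<sigma> - frag_extend (H (n - 1)) (chain_boundary n (frag_of \<sigma>)) - chain_boundary (Suc n) (H n \<sigma>))"
    by blast
  have top: "D n \<sigma> = frag_cmul (fact (p - 1)) (frag_of (simplex_map n fst \<sigma>))" if "p - 1 \<le> n" for n \<sigma>
  proof -
    \<comment> \<open>The word has n + 1 letters, at least p, which is more than the number of
      rows.\<close>
    have "T n \<tau> = 0" for \<tau>
      using that R(1) by (simp add: T_def tc_def truncated_chain_def lt_def)
    then have "frag_extend (T n) (\<rho> n \<sigma>) = 0" by (intro frag_extend_eq_0)
    then show ?thesis by (simp add: D_def)
  qed
  show ?thesis
  proof (intro exI[of _ H] allI impI)
    fix n \<sigma> assume n: "n \<le> N" and \<sigma>: "singular_simplex n Z \<sigma>"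
    show "singular_chain (Suc n) (EG G) (H n \<sigma>) \<and>
     (\<forall>g\<in>carrier G. H n (simplex_map n (act g) \<sigma>) = chain_map (Suc n) (EG_action G g) (H n \<sigma>)) \<and>
     (p - 1 \<le> n \<longrightarrow> frag_dvd p (frag_cmul (fact (p - 1)) (frag_of (simplex_map n fst \<sigma>))
       - frag_extend (H (n - 1)) (chain_boundary n (frag_of \<sigma>)) - chain_boundary (Suc n) (H n \<sigma>)))"
    proof (intro conjI impI)
      assume "p - 1 \<le> n"
      from H[OF n \<sigma>, unfolded top[OF this]]
      show "frag_dvd p (frag_cmul (fact (p - 1)) (frag_of (simplex_map n fst \<sigma>))
          - frag_extend (H (n - 1)) (chain_boundary n (frag_of \<sigma>)) - chain_boundary (Suc n) (H n \<sigma>))"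
        by (elim conjE)
    qed (use H[OF n \<sigma>] in blast)+
  qed
qed

end

section \<open>From homotopies to cohomology classes\<close>

context chessboard
begin

lemma fact_inverse: "\<exists>i. [fact (p - 1) * i = 1] (mod int p)"
proof -
  have "\<not> p dvd fact (p - 1)" using prime_dvd_fact_iff[OF prime_p, of "p - 1"] p_pos by simp
  then have "coprime p (fact (p - 1))" using prime_p by (rule prime_imp_coprime_nat[rotated])
  then have "coprime (int (fact (p - 1))) (int p)" by (simp only: coprime_int_iff coprime_commute)
  then show ?thesis using cong_solve_coprime_int[of "fact (p - 1)" "int p"] by simp
qed

lemma cocycles_carrier: "\<phi> \<in> cocycles n Y A \<Longrightarrow> \<phi> \<in> carrier (cochain_group n Y A)"
  by (simp add: cocycles_def kernel_def)

lemma continuous_quot_E: "continuous_map (EG G) (BG G) E.quot"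
  using E.continuous_map_quot by (simp add: BG_def)

lemma continuous_quot_Z: "continuous_map Z borel Z.quot"
  using Z.continuous_map_quot by (simp add: borel_construction_def)

lemma continuous_projection: "continuous_map borel (BG G) borel_projection"
  by (rule continuous_map_borel_projection[OF group_cyclic_perm_group group_action_chessboard])

lemma pullback_cocycle:
  "\<phi> \<in> cocycles n (BG G) A \<Longrightarrow> cochain_pullback n borel borel_projection \<phi> \<in> cocycles n borel A"
  by (rule cochain_pullback_cocycles[OF abelian_integer_mod_group continuous_projection])

lemma pullback_chain_eval:
  assumes \<phi>: "\<phi> \<in> cocycles n (BG G) A" and c: "singular_chain n Z c"
  shows "[cochain_pullback n borel borel_projection \<phi> (chain_map n Z.quot c) =
     frag_eval (\<lambda>\<tau>. \<phi> (frag_of (simplex_map n E.quot \<tau>))) (chain_map n fst c)] (mod int p)"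
proof -
  let ?\<phi> = "cochain_pullback n borel borel_projection \<phi>"
  have "[?\<phi> (chain_map n Z.quot c) = frag_eval (\<lambda>\<tau>. ?\<phi> (frag_of (simplex_map n Z.quot \<tau>))) c] (mod int p)"
    by (rule cochain_chain_map_eval[OF p_pos cocycles_carrier[OF pullback_cocycle[OF \<phi>]] continuous_quot_Z c])
  moreover have "frag_eval (\<lambda>\<tau>. ?\<phi> (frag_of (simplex_map n Z.quot \<tau>))) c =
      frag_eval (\<lambda>\<tau>. \<phi> (frag_of (simplex_map n E.quot \<tau>))) (chain_map n fst c)"
    unfolding chain_map_def frag_eval_extend
    using c by (intro frag_eval_cong) (auto simp: pullback_eval singular_chain_def)
  ultimately show ?thesis by simp
qed

lemma homotopy_eval:
  assumes \<phi>: "\<phi> \<in> cocycles n (BG G) A" and b: "singular_chain (Suc n) (EG G) b"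
    and dvd: "frag_dvd p (a - c - chain_boundary (Suc n) b)"
  shows "[frag_eval (\<lambda>\<tau>. \<phi> (frag_of (simplex_map n E.quot \<tau>))) a =
     frag_eval (\<lambda>\<tau>. \<phi> (frag_of (simplex_map n E.quot \<tau>))) c] (mod int p)"
proof -
  let ?w = "\<lambda>\<tau>. \<phi> (frag_of (simplex_map n E.quot \<tau>))"
  have "int p dvd frag_eval ?w (chain_boundary (Suc n) b)"
    by (rule cocycle_eval_boundary[OF p_pos \<phi> continuous_quot_E b])
  from dvd_add[OF frag_dvd_frag_eval[OF dvd, of ?w] this] show ?thesis
    by (simp add: frag_eval_diff cong_iff_dvd_diff)
qed

text \<open>Evaluating the homotopy formula on a cocycle leaves (p - 1)! times the pullback equal to
  a coboundary of the cochain given by H. Dividing by the unit (p - 1)! gives an invariant u that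
  descends to the Borel construction.\<close>

lemma pullback_vanishes:
  assumes n: "p - 1 \<le> n" and \<phi>: "\<phi> \<in> cocycles n (BG G) A"
  shows "cochain_pullback n borel borel_projection \<phi> \<in> coboundaries n borel A"
proof -
  obtain m where m: "n = Suc m" using n p_ge_3 by (cases n) auto
  let ?w = "\<lambda>\<tau>. \<phi> (frag_of (simplex_map n E.quot \<tau>))"
  obtain i where i: "[fact (p - 1) * i = 1] (mod int p)" using fact_inverse by blast
  obtain H where H: "\<And>n' \<sigma>. n' \<le> n \<Longrightarrow> singular_simplex n' Z \<sigma> \<Longrightarrow> singular_chain (Suc n') (EG G) (H n' \<sigma>) \<and>
     (\<forall>g\<in>carrier G. H n' (simplex_map n' (act g) \<sigma>) = chain_map (Suc n') (EG_action G g) (H n' \<sigma>)) \<and>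
     (p - 1 \<le> n' \<longrightarrow> frag_dvd p (frag_cmul (fact (p - 1)) (frag_of (simplex_map n' fst \<sigma>))
       - frag_extend (H (n' - 1)) (chain_boundary n' (frag_of \<sigma>)) - chain_boundary (Suc n') (H n' \<sigma>)))"
    using projection_homotopy[of n] by blast
  define u where "u \<tau> = i * frag_eval ?w (H m \<tau>)" for \<tau>
  have "cochain_pullback n borel borel_projection \<phi> \<in> coboundaries (Suc m) borel A"
    unfolding borel_construction_def
  proof (rule Z.coboundary_descent[OF p_pos])
    show "cochain_pullback n (orbit_space G Z act) borel_projection \<phi> \<in> carrier (cochain_group (Suc m) (orbit_space G Z act) A)"
      using cocycles_carrier[OF pullback_cocycle[OF \<phi>]] m by (simp add: borel_construction_def)
    fix g \<sigma> assume g: "g \<in> carrier G" and \<sigma>: "singular_simplex m Z \<sigma>"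
    have h: "singular_chain n (EG G) (H m \<sigma>)" "H m (simplex_map m (act g) \<sigma>) = chain_map n (EG_action G g) (H m \<sigma>)"
      using H[of m, OF _ \<sigma>] g m by auto
    show "u (simplex_map m (act g) \<sigma>) = u \<sigma>"
      using E.frag_eval_quot_act[OF g h(1), of "\<lambda>\<tau>. \<phi> (frag_of \<tau>)"] unfolding u_def h(2) by simp
  next
    fix \<sigma> assume \<sigma>: "singular_simplex (Suc m) Z \<sigma>"
    then have \<sigma>n: "singular_simplex n Z \<sigma>" using m by simp
    let ?b = "chain_boundary n (frag_of \<sigma>)"
    have "[frag_eval ?w (frag_cmul (fact (p - 1)) (frag_of (simplex_map n fst \<sigma>))) = frag_eval ?w (frag_extend (H m) ?b)] (mod int p)"
      by (rule homotopy_eval[OF \<phi>, of "H n \<sigma>"]) (use H[OF order_refl \<sigma>n] n m in auto)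
    then have 1: "[i * (fact (p - 1) * ?w (simplex_map n fst \<sigma>)) = i * frag_eval (\<lambda>\<tau>. frag_eval ?w (H m \<tau>)) ?b] (mod int p)"
      by (intro cong_scalar_left) (simp add: frag_eval_cmul frag_eval_extend)
    have "[fact (p - 1) * i * ?w (simplex_map n fst \<sigma>) = 1 * ?w (simplex_map n fst \<sigma>)] (mod int p)"
      by (rule cong_scalar_right[OF i])
    then have "[?w (simplex_map n fst \<sigma>) = i * (fact (p - 1) * ?w (simplex_map n fst \<sigma>))] (mod int p)"
      by (simp add: cong_sym_eq mult.assoc mult.left_commute mult.commute)
    from cong_trans[OF this 1] have "[?w (simplex_map n fst \<sigma>) = frag_eval u ?b] (mod int p)"
      unfolding u_def[abs_def] frag_eval_fun_cmul .
    then show "[cochain_pullback n (orbit_space G Z act) borel_projection \<phi> (frag_of (simplex_map (Suc m) Z.quot \<sigma>)) =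
        frag_eval u (chain_boundary (Suc m) (frag_of \<sigma>))] (mod int p)"
      using pullback_eval[OF \<sigma>n, of \<phi>] m by (simp add: borel_construction_def)
  qed
  then show ?thesis using m by simp
qed

text \<open>Up to the unit (p - 1)!, the cocycle is its pullback evaluated on L plus a coboundary
  given by H. A primitive of the pullback, transported along L, therefore yields a primitive of the
  cocycle.\<close>

lemma pullback_injective:
  assumes n: "n \<le> p - 2" and \<phi>: "\<phi> \<in> cocycles n (BG G) A"
    and pb: "cochain_pullback n borel borel_projection \<phi> \<in> coboundaries n borel A"
  shows "\<phi> \<in> coboundaries n (BG G) A"
proof -
  let ?w = "\<lambda>\<tau>. \<phi> (frag_of (simplex_map n E.quot \<tau>))"
  let ?\<phi> = "cochain_pullback n borel borel_projection \<phi>"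
  obtain i where i: "[fact (p - 1) * i = 1] (mod int p)" using fact_inverse by blast
  obtain H L where HL: "\<And>n \<sigma>. n \<le> p - 2 \<Longrightarrow> singular_simplex n (EG G) \<sigma> \<Longrightarrow>
     singular_chain n Z (L n \<sigma>) \<and> singular_chain (Suc n) (EG G) (H n \<sigma>) \<and>
     (\<forall>g\<in>carrier G. L n (simplex_map n (EG_action G g) \<sigma>) = chain_map n (act g) (L n \<sigma>) \<and>
        H n (simplex_map n (EG_action G g) \<sigma>) = chain_map (Suc n) (EG_action G g) (H n \<sigma>)) \<and>
     chain_boundary n (L n \<sigma>) = frag_extend (L (n - 1)) (chain_boundary n (frag_of \<sigma>)) \<and>
     frag_dvd p (frag_cmul (fact (p - 1)) (frag_of \<sigma>) - chain_map n fst (L n \<sigma>)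
       - frag_extend (H (n - 1)) (chain_boundary n (frag_of \<sigma>)) - chain_boundary (Suc n) (H n \<sigma>))"
    using section_homotopy by blast
  have main: "[?w \<sigma> = i * (?\<phi> (chain_map n Z.quot (L n \<sigma>)) +
      frag_eval (\<lambda>\<tau>. frag_eval ?w (H (n - 1) \<tau>)) (chain_boundary n (frag_of \<sigma>)))] (mod int p)"
    if \<sigma>: "singular_simplex n (EG G) \<sigma>" for \<sigma>
  proof -
    let ?b = "chain_boundary n (frag_of \<sigma>)"
    have "[frag_eval ?w (frag_cmul (fact (p - 1)) (frag_of \<sigma>)) =
        frag_eval ?w (chain_map n fst (L n \<sigma>) + frag_extend (H (n - 1)) ?b)] (mod int p)"
      by (rule homotopy_eval[OF \<phi>, of "H n \<sigma>"]) (use HL[OF n \<sigma>] in \<open>simp_all add: diff_diff_eq\<close>)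
    then have "[fact (p - 1) * ?w \<sigma> = frag_eval ?w (chain_map n fst (L n \<sigma>)) +
        frag_eval (\<lambda>\<tau>. frag_eval ?w (H (n - 1) \<tau>)) ?b] (mod int p)"
      by (simp add: frag_eval_cmul frag_eval_add frag_eval_extend)
    moreover have "[frag_eval ?w (chain_map n fst (L n \<sigma>)) + frag_eval (\<lambda>\<tau>. frag_eval ?w (H (n - 1) \<tau>)) ?b =
        ?\<phi> (chain_map n Z.quot (L n \<sigma>)) + frag_eval (\<lambda>\<tau>. frag_eval ?w (H (n - 1) \<tau>)) ?b] (mod int p)"
      using pullback_chain_eval[OF \<phi>, of "L n \<sigma>"] HL[OF n \<sigma>] by (intro cong_add) (auto intro: cong_sym)
    ultimately have "[fact (p - 1) * ?w \<sigma> = ?\<phi> (chain_map n Z.quot (L n \<sigma>)) +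
        frag_eval (\<lambda>\<tau>. frag_eval ?w (H (n - 1) \<tau>)) ?b] (mod int p)" by (rule cong_trans)
    from cong_scalar_left[OF this, of i]
    have 1: "[i * (fact (p - 1) * ?w \<sigma>) = i * (?\<phi> (chain_map n Z.quot (L n \<sigma>)) +
        frag_eval (\<lambda>\<tau>. frag_eval ?w (H (n - 1) \<tau>)) ?b)] (mod int p)" .
    have "[fact (p - 1) * i * ?w \<sigma> = 1 * ?w \<sigma>] (mod int p)"
      by (rule cong_scalar_right[OF i])
    then have "[?w \<sigma> = i * (fact (p - 1) * ?w \<sigma>)] (mod int p)"
      by (simp add: cong_sym_eq mult.assoc mult.left_commute mult.commute)
    from this 1 show ?thesis by (rule cong_trans)
  qed
  show ?thesis
  proof (cases n)
    case 0
    \<comment> \<open>In degree 0 a coboundary is zero, so there is no primitive and the cocycle is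
      shown to vanish outright.\<close>
    then have \<phi>0: "?\<phi> = \<one>\<^bsub>cochain_group n borel A\<^esub>" using pb by (simp add: coboundaries_def)
    have w0: "\<phi> (frag_of \<tau>) = 0" if \<tau>: "singular_simplex n (BG G) \<tau>" for \<tau>
    proof -
      obtain \<sigma> where \<sigma>: "singular_simplex n (EG G) \<sigma>" "simplex_map n E.quot \<sigma> = \<tau>"
        using E.lift_singular_simplex \<tau> unfolding BG_def by blast
      have "singular_chain n borel (chain_map n Z.quot (L n \<sigma>))"
        using singular_chain_chain_map[OF _ continuous_quot_Z] HL[OF n \<sigma>(1)] by blast
      then have "?\<phi> (chain_map n Z.quot (L n \<sigma>)) = 0" by (simp add: \<phi>0 one_cochain_group)
      then have "[\<phi> (frag_of \<tau>) = 0] (mod int p)"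
        using main[OF \<sigma>(1)] \<sigma>(2) 0 by (simp add: chain_boundary_def)
      moreover have "\<phi> (frag_of \<tau>) = \<phi> (frag_of \<tau>) mod int p"
        using cochain_frag_eval[OF p_pos cocycles_carrier[OF \<phi>], of "frag_of \<tau>"] \<tau> by (simp add: singular_chain_of)
      ultimately show ?thesis by (simp add: cong_def)
    qed
    have "\<phi> = \<one>\<^bsub>cochain_group n (BG G) A\<^esub>"
    proof (rule extensionalityI[of _ "singular_chain_set n (BG G)"])
      show "\<phi> \<in> extensional (singular_chain_set n (BG G))"
        using cocycles_carrier[OF \<phi>] by (simp add: carrier_cochain_group)
      fix c assume "c \<in> singular_chain_set n (BG G)"
      then have c: "singular_chain n (BG G) c" by simp
      have "frag_eval (\<lambda>\<tau>. \<phi> (frag_of \<tau>)) c = frag_eval (\<lambda>_. 0) c"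
        using c w0 by (intro frag_eval_cong) (auto simp: singular_chain_def)
      then show "\<phi> c = \<one>\<^bsub>cochain_group n (BG G) A\<^esub> c"
        using cochain_frag_eval[OF p_pos cocycles_carrier[OF \<phi>] c] c
        by (simp add: one_cochain_group frag_eval_def)
    qed (simp add: one_cochain_group)
    then show ?thesis using 0 by (simp add: coboundaries_def)
  next
    case (Suc m)
    then obtain \<psi> where \<psi>: "\<psi> \<in> carrier (cochain_group m borel A)" "?\<phi> = coboundary_map m borel \<psi>"
      using pb by (auto simp: coboundaries_def)
    let ?v = "\<lambda>\<tau>. \<psi> (frag_of (simplex_map m Z.quot \<tau>))"
    \<comment> \<open>The two parts are the primitive transported along L and the contribution of
      the homotopy H; the factor i inverts (p - 1)! modulo p.\<close>
    define u where "u \<tau> = i * (frag_eval ?v (L m \<tau>) + frag_eval ?w (H m \<tau>))" for \<tau>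
    have m: "m \<le> p - 2" using n Suc by simp
    have "\<phi> \<in> coboundaries (Suc m) (BG G) A"
      unfolding BG_def
    proof (rule E.coboundary_descent[OF p_pos])
      show "\<phi> \<in> carrier (cochain_group (Suc m) (orbit_space G (EG G) (EG_action G)) A)"
        using cocycles_carrier[OF \<phi>] Suc by (simp add: BG_def)
      fix g \<sigma> assume g: "g \<in> carrier G" and \<sigma>: "singular_simplex m (EG G) \<sigma>"
      have L: "singular_chain m Z (L m \<sigma>)" "L m (simplex_map m (EG_action G g) \<sigma>) = chain_map m (act g) (L m \<sigma>)"
        and h: "singular_chain n (EG G) (H m \<sigma>)" "H m (simplex_map m (EG_action G g) \<sigma>) = chain_map n (EG_action G g) (H m \<sigma>)"
        using HL[OF m \<sigma>] g Suc by auto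
      show "u (simplex_map m (EG_action G g) \<sigma>) = u \<sigma>"
        using E.frag_eval_quot_act[OF g h(1), of "\<lambda>\<tau>. \<phi> (frag_of \<tau>)"] Z.frag_eval_quot_act[OF g L(1), of "\<lambda>\<tau>. \<psi> (frag_of \<tau>)"]
        unfolding u_def h(2) L(2) by simp
    next
      fix \<sigma> assume \<sigma>: "singular_simplex (Suc m) (EG G) \<sigma>"
      then have \<sigma>n: "singular_simplex n (EG G) \<sigma>" using Suc by simp
      let ?b = "chain_boundary n (frag_of \<sigma>)" and ?L = "L n \<sigma>"
      have L: "singular_chain n Z ?L" "chain_boundary n ?L = frag_extend (L m) ?b"
        using HL[OF n \<sigma>n] Suc by auto
      have bL: "singular_chain m Z (chain_boundary n ?L)" using singular_chain_boundary[OF L(1)] Suc by simp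
      have "singular_chain n borel (chain_map n Z.quot ?L)"
        by (rule singular_chain_chain_map[OF L(1) continuous_quot_Z])
      then have "?\<phi> (chain_map n Z.quot ?L) = \<psi> (chain_map m Z.quot (chain_boundary n ?L))"
        unfolding \<psi>(2) using chain_boundary_chain_map[OF L(1), of Z.quot] Suc by (simp add: coboundary_map_def)
      moreover have "[\<psi> (chain_map m Z.quot (chain_boundary n ?L)) = frag_eval ?v (chain_boundary n ?L)] (mod int p)"
        by (rule cochain_chain_map_eval[OF p_pos \<psi>(1) continuous_quot_Z bL])
      ultimately have "[?\<phi> (chain_map n Z.quot ?L) = frag_eval (\<lambda>\<tau>. frag_eval ?v (L m \<tau>)) ?b] (mod int p)"
        by (simp add: L(2) frag_eval_extend)
      then have "[i * (?\<phi> (chain_map n Z.quot ?L) + frag_eval (\<lambda>\<tau>. frag_eval ?w (H m \<tau>)) ?b) = frag_eval u ?b] (mod int p)"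
        unfolding u_def[abs_def] frag_eval_fun_cmul frag_eval_fun_add
        by (intro cong_scalar_left cong_add cong_refl)
      from cong_trans[OF main[OF \<sigma>n, unfolded Suc diff_Suc_1, folded Suc] this]
      show "[\<phi> (frag_of (simplex_map (Suc m) E.quot \<sigma>)) = frag_eval u (chain_boundary (Suc m) (frag_of \<sigma>))] (mod int p)"
        unfolding Suc by simp
    qed
    then show ?thesis using Suc by simp
  qed
qed

lemma cohomology_class:
  assumes "u \<in> carrier (cohomology_group n Y A)"
  obtains \<phi> where "\<phi> \<in> cocycles n Y A" "u = coboundaries n Y A #>\<^bsub>cocycle_group n Y A\<^esub> \<phi>"
  using assms by (auto simp: cohomology_group_def FactGroup_def RCOSETS_def carrier_cocycle_group)

lemma one_cohomology: "\<one>\<^bsub>cohomology_group n Y A\<^esub> = coboundaries n Y A"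
  by (simp add: cohomology_group_def FactGroup_def)

lemma coset_eq_coboundaries:
  assumes "\<phi> \<in> cocycles n Y A"
  shows "coboundaries n Y A #>\<^bsub>cocycle_group n Y A\<^esub> \<phi> = coboundaries n Y A \<longleftrightarrow> \<phi> \<in> coboundaries n Y A"
proof -
  interpret C: comm_group "cocycle_group n Y A" by (simp add: comm_group_cocycle_group)
  note sub = subgroup_coboundaries[OF abelian_integer_mod_group, of n Y p]
  have "\<phi> \<in> coboundaries n Y A #>\<^bsub>cocycle_group n Y A\<^esub> \<phi>"
    using C.rcos_self[OF _ sub] assms by (simp add: carrier_cocycle_group)
  then show ?thesis using C.coset_join2[OF _ sub] assms by (auto simp: carrier_cocycle_group)
qed

lemma induced_trivial_iff:
  assumes u: "u \<in> carrier (cohomology_group n (BG G) A)"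
  shows "cohom_induced n borel A borel_projection u = \<one>\<^bsub>cohomology_group n borel A\<^esub> \<longleftrightarrow>
     p - 1 \<le> n \<or> u = \<one>\<^bsub>cohomology_group n (BG G) A\<^esub>"
proof -
  obtain \<phi> where \<phi>: "\<phi> \<in> cocycles n (BG G) A" "u = coboundaries n (BG G) A #>\<^bsub>cocycle_group n (BG G) A\<^esub> \<phi>"
    using cohomology_class[OF u] by blast
  have 1: "cohom_induced n borel A borel_projection u = \<one>\<^bsub>cohomology_group n borel A\<^esub> \<longleftrightarrow>
      cochain_pullback n borel borel_projection \<phi> \<in> coboundaries n borel A"
    unfolding \<phi>(2) one_cohomology
      cohom_induced_coset[OF abelian_integer_mod_group continuous_projection \<phi>(1)]
    by (rule coset_eq_coboundaries[OF pullback_cocycle[OF \<phi>(1)]])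
  have 2: "u = \<one>\<^bsub>cohomology_group n (BG G) A\<^esub> \<longleftrightarrow> \<phi> \<in> coboundaries n (BG G) A"
    unfolding \<phi>(2) one_cohomology by (rule coset_eq_coboundaries[OF \<phi>(1)])
  show ?thesis
  proof (cases "p - 1 \<le> n")
    case True
    then show ?thesis using 1 pullback_vanishes[OF True \<phi>(1)] by simp
  next
    case False
    then have n: "n \<le> p - 2" by simp
    show ?thesis
      using 1 2 False pullback_injective[OF n \<phi>(1)]
        cochain_pullback_coboundaries[OF abelian_integer_mod_group continuous_projection, of \<phi> n p] by blast
  qed
qed

end

theorem theorem6p9:
  fixes p k :: nat
  assumes "prime p" and "odd p"
    and "p - 1 \<le> k" and "k \<le> 2 * p - 2"
  shows "fadell_husseini_index (cyclic_perm_group p) (integer_mod_group p)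
           (chessboard_space k p) (chessboard_action k p)
         = cohomology_ge (p - 1) (BG (cyclic_perm_group p)) (integer_mod_group p)"
proof -
  interpret chessboard p k by unfold_locales (fact assms)+
  have g: "group (cohomology_group n Y A)" for n and Y :: "'z topology"
    by (simp add: comm_group.axioms comm_group_cohomology_group)
  have comp: "u n \<in> carrier (cohomology_group n (BG G) A)" if "u \<in> carrier (total_cohomology (BG G) A)" for u n
    using that by (auto simp: total_cohomology_def carrier_sum_group g)
  have "total_cohom_induced borel A borel_projection u = \<one>\<^bsub>total_cohomology borel A\<^esub> \<longleftrightarrow>
      (\<forall>n<p - 1. u n = \<one>\<^bsub>cohomology_group n (BG G) A\<^esub>)" if u: "u \<in> carrier (total_cohomology (BG G) A)" for u
  proof -
    have "total_cohom_induced borel A borel_projection u = \<one>\<^bsub>total_cohomology borel A\<^esub> \<longleftrightarrow>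
        (\<forall>n. cohom_induced n borel A borel_projection (u n) = \<one>\<^bsub>cohomology_group n borel A\<^esub>)"
      by (auto simp: total_cohomology_def total_cohom_induced_def fun_eq_iff)
    also have "\<dots> \<longleftrightarrow> (\<forall>n. p - 1 \<le> n \<or> u n = \<one>\<^bsub>cohomology_group n (BG G) A\<^esub>)"
      by (simp only: induced_trivial_iff[OF comp[OF u]])
    also have "\<dots> \<longleftrightarrow> (\<forall>n<p - 1. u n = \<one>\<^bsub>cohomology_group n (BG G) A\<^esub>)"
      unfolding not_less[symmetric] by blast
    finally show ?thesis .
  qed
  then show ?thesis
    unfolding fadell_husseini_index_def cohomology_ge_def kernel_def by blast
qed

end
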